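(* Consider a 2DMBC with forward channel $P_{Y_f,Z_f|X_f}$ and backward channel $P_{Y_b,Z_b|X_b}$. Let the random variables $X_f,Y_f,Z_f$ (resp. $X_b,Y_b,Z_b$) be consistent with the channel distribution $P_{Y_f,Z_f|X_f}$ (resp. $P_{Y_b,Z_b|X_b}$). Let $V_f, V_b, W_{1,f}, W_{2,f}, W_{1,b}, W_{2,b}$ be random variables from arbitrary (finite) sets such that $V_f$, $V_b$, $(W_{1,f},W_{2,f})$ and $(W_{1,b},W_{2,b})$ are independent and the following Markov chains hold: $$V_f\leftrightarrow Y_f\leftrightarrow (X_f,Z_f),\qquad W_{2,b}\leftrightarrow W_{1,b}\leftrightarrow X_b\leftrightarrow (Y_b,Z_b),$$ $$V_b\leftrightarrow Y_b\leftrightarrow (X_b,Z_b),\qquad W_{2,f}\leftrightarrow W_{1,f}\leftrightarrow X_f\leftrightarrow (Y_f,Z_f).$$ Put $$R^A_{s1}=I(V_f;X_f)-I(V_f;Z_f),\qquad R^A_{s2}=I(W_{1,b};Y_b|W_{2,b})-I(W_{1,b};Z_b|W_{2,b}),$$ $$R^B_{s1}=I(V_b;X_b)-I(V_b;Z_b),\qquad R^B_{s2}=I(W_{1,f};Y_f|W_{2,f})-I(W_{1,f};Z_f|W_{2,f}).$$ Then the secret-key capacity of the 2DMBC satisfies $$C^{2DMBC}_{sk}(P_{Y_f,Z_f|X_f},P_{Y_b,Z_b|X_b})\ \geq\ \max\{L_A,L_B\},$$ where $$L_A=\sup\left\{\frac{n_f R^A_{s1}+n_b[R^A_{s2}]_+}{n_f+n_b}\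 :\ n_f I(V_f;Y_f|X_f)< n_b I(W_{1,b};Y_b)\right\},$$ the supremum being over $n_f,n_b,P_{X_f,V_f},P_{X_b,W_{2,b},W_{1,b}}$, and $$L_B=\sup\left\{\frac{n_b R^B_{s1}+n_f[R^B_{s2}]_+}{n_f+n_b}\ :\ n_b I(V_b;Y_b|X_b)< n_f I(W_{1,f};Y_f)\right\},$$ the supremum being over $n_f,n_b,P_{X_b,V_b},P_{X_f,W_{2,f},W_{1,f}}$. Here $n_f,n_b$ range over nonnegative integers with $n_f+n_b>0$, and the random variables range over all choices allowed above.
   Context: All alphabets are finite; logarithms are base 2; $[x]_+=\max\{0,x\}$; $H$ and $I$ denote Shannon entropy and mutual information; $X\leftrightarrow Y\leftrightarrow Z$ means that $X,Y,Z$ form a Markov chain in this order (and similarly for longer chains). Channels. A discrete memoryless broadcast channel (DMBC) $X\rightarrow(Y,Z)$ is a memoryless channel with input $X$ and outputs $Y,Z$, specified by a conditional distribution $P_{Y,Z|X}$. A 2DMBC is a pair of independent DMBCs: a forward DMBC $X_f\rightarrow(Y_f,Z_f)$ (input by Alice, $Y_f$ received by Bob, $Z_f$ received by the passive adversary Eve), specified by $P_{Y_f,Z_f|X_f}$ over finite sets $\mathcal X_f,\mathcal Y_f,\mathcal Z_f$, and a backward DMBC $X_b\rightarrow(Y_b,Z_b)$ (input by Bob, $Y_b$ received by Alice, $Z_b$ received by Eve), specified by $P_{Y_b,Z_b|X_b}$ over finite sets $\mathcal X_b,\mathcal Y_b,\mathcal Z_b$. SKE protocol. A secret key establishment (SKE)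 protocol in the 2DMBC setup consists of an arbitrary finite number of consecutive communication rounds; either party may initiate. In each round either Alice sends a sequence of symbols over the forward DMBC or Bob sends a sequence of symbols over the backward DMBC; the legitimate receiver of the round then computes the sequence to be sent in the next round. A sent sequence is a (possibly randomized) function of all sequences previously sent or received by the sender, the local randomness being independent of the other parties' views. The view of a party at the end of the protocol is the collection of all sequences it sent and/or received: $View_A$ for Alice (forward inputs and backward outputs $Y_b$), $View_B$ for Bob (backward inputs and forward outputs $Y_f$), $View_E$ for Eve (all outputs $Z_f$ and $Z_b$). At the end, one of Alice and Bob computes a key $S$ as a function of his/her view, and the other computes an estimate $\hat S$ of it as a function of his/her view. Let $n_f$ and $n_b$ be the total numbers of uses of the forward and backward channels in the protocol. For $R_{sk}\ge 0$ and $0\le\delta\le1$, the protocol is $(R_{sk},\delta)$-secure if $$\frac{H(S)}{n_f+n_b}>R_{sk}-\delta,\qquad \Pr(\hat S\ne S)<\delta,\qquad \frac{H(S|View_E)}{H(S)}>1-\delta .$$ The last condition is regarded as satisfied if $H(S)=0$. The secret-key capacity $C^{2DMBC}_{sk}(P_{Y_f,Z_f|X_f},P_{Y_b,Z_b|X_b})$ is the largest $R_{sk}\ge0$ such that for any arbitrarily small $\delta>0$ there exists an $(R_{sk},\delta)$-secure SKE protocol. *)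

theory Defs
  imports "HOL-Probability.Probability"
begin

section \<open>Shannon information measures of discrete random variables, base 2\<close>

text \<open>
  A random variable is a function on a sample space carrying a \<^typ>\<open>'w pmf\<close>.  The constants below
  are those of \<^theory>\<open>HOL-Probability.Information\<close>; since \<open>space (measure_pmf p) = UNIV\<close>, they are
  what \<open>\<H>(X)\<close>, \<open>\<H>(X | Y)\<close>, \<open>\<I>(X ; Y)\<close>, \<open>\<I>(X ; Y | Z)\<close> abbreviate in the locale
  \<^locale>\<open>information_space\<close> for \<open>measure_pmf p\<close> and \<open>b = 2\<close>.
\<close>

definition ent :: "'w pmf \<Rightarrow> ('w \<Rightarrow> 'a) \<Rightarrow> real" where
  "ent p X = prob_space.entropy (measure_pmf p) 2 (count_space (range X)) X"

definition cond_ent :: "'w pmf \<Rightarrow> ('w \<Rightarrow> 'a) \<Rightarrow> ('w \<Rightarrow> 'b) \<Rightarrow> real" where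
  "cond_ent p X Y = prob_space.conditional_entropy (measure_pmf p) 2
     (count_space (range X)) (count_space (range Y)) X Y"

definition mut_inf :: "'w pmf \<Rightarrow> ('w \<Rightarrow> 'a) \<Rightarrow> ('w \<Rightarrow> 'b) \<Rightarrow> real" where
  "mut_inf p X Y = prob_space.mutual_information (measure_pmf p) 2
     (count_space (range X)) (count_space (range Y)) X Y"

definition cond_mut_inf ::
    "'w pmf \<Rightarrow> ('w \<Rightarrow> 'a) \<Rightarrow> ('w \<Rightarrow> 'b) \<Rightarrow> ('w \<Rightarrow> 'c) \<Rightarrow> real" where
  "cond_mut_inf p X Y Z = prob_space.conditional_mutual_information (measure_pmf p) 2
     (count_space (range X)) (count_space (range Y)) (count_space (range Z)) X Y Z"

text \<open>\<open>X \<leftrightarrow> Y \<leftrightarrow> Z\<close>: \<open>P(x,y,z) = P(x,y) P(z|y)\<close>, multiplied out by \<open>P(y)\<close>.\<close>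

definition markov3 :: "'w pmf \<Rightarrow> ('w \<Rightarrow> 'a) \<Rightarrow> ('w \<Rightarrow> 'b) \<Rightarrow> ('w \<Rightarrow> 'c) \<Rightarrow> bool" where
  "markov3 p X Y Z \<longleftrightarrow> (\<forall>x y z.
     pmf (map_pmf (\<lambda>\<omega>. (X \<omega>, Y \<omega>, Z \<omega>)) p) (x, y, z) * pmf (map_pmf Y p) y =
     pmf (map_pmf (\<lambda>\<omega>. (X \<omega>, Y \<omega>)) p) (x, y) * pmf (map_pmf (\<lambda>\<omega>. (Y \<omega>, Z \<omega>)) p) (y, z))"

text \<open>\<open>X \<leftrightarrow> Y \<leftrightarrow> Z \<leftrightarrow> U\<close>: at each of the two inner variables, past and future are conditionally
  independent given the present.\<close>

definition markov4 ::
    "'w pmf \<Rightarrow> ('w \<Rightarrow> 'a) \<Rightarrow> ('w \<Rightarrow> 'b) \<Rightarrow> ('w \<Rightarrow> 'c) \<Rightarrow> ('w \<Rightarrow> 'd) \<Rightarrow> bool" where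
  "markov4 p X Y Z U \<longleftrightarrow>
     markov3 p X Y (\<lambda>\<omega>. (Z \<omega>, U \<omega>)) \<and> markov3 p (\<lambda>\<omega>. (X \<omega>, Y \<omega>)) Z U"

section \<open>Discrete memoryless broadcast channels\<close>

type_synonym ('x, 'y, 'z) dmbc = "'x \<Rightarrow> ('y \<times> 'z) pmf"

primrec dmbc_seq :: "('x, 'y, 'z) dmbc \<Rightarrow> 'x list \<Rightarrow> ('y \<times> 'z) list pmf" where
  "dmbc_seq W [] = return_pmf []"
| "dmbc_seq W (x # xs) =
     bind_pmf (W x) (\<lambda>yz. map_pmf (\<lambda>yzs. yz # yzs) (dmbc_seq W xs))"

definition consistent ::
    "('x, 'y, 'z) dmbc \<Rightarrow> 'w pmf \<Rightarrow> ('w \<Rightarrow> 'x) \<Rightarrow> ('w \<Rightarrow> 'y) \<Rightarrow> ('w \<Rightarrow> 'z) \<Rightarrow> bool" where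
  "consistent W p X Y Z \<longleftrightarrow> (\<forall>x y z.
     pmf (map_pmf (\<lambda>\<omega>. (X \<omega>, Y \<omega>, Z \<omega>)) p) (x, y, z) = pmf (map_pmf X p) x * pmf (W x) (y, z))"

section \<open>Secret key establishment protocols\<close>

text \<open>
  A legitimate party's view is the chronological list of the symbols it has sent (\<^const>\<open>Inl\<close>) or
  received (\<^const>\<open>Inr\<close>); in Eve's view \<^const>\<open>Inl\<close> marks forward and \<^const>\<open>Inr\<close> backward outputs.
  The length of each round is fixed in advance, so the concatenation determines the individual
  sequences.
\<close>

type_synonym ('s, 'r) view = "('s + 'r) list"
type_synonym ('xf, 'yf, 'zf, 'xb, 'yb, 'zb) views =
  "('xf, 'yb) view \<times> ('xb, 'yf) view \<times> ('zf, 'zb) view"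

text \<open>
  A round is given by its number of channel uses and by a stochastic map from the sender's current
  view to the sequence sent.  Fresh randomness in each round is no restriction: if a party draws all
  its local randomness once, independently of everything else, then conditionally on the three
  current views the next sequence it sends still depends only on its own view.
\<close>

datatype ('xf, 'yf, 'xb, 'yb) round =
    Forward nat "('xf, 'yb) view \<Rightarrow> 'xf list pmf"
  | Backward nat "('xb, 'yf) view \<Rightarrow> 'xb list pmf"

primrec is_forward :: "('xf, 'yf, 'xb, 'yb) round \<Rightarrow> bool" where
  "is_forward (Forward n f) = True"
| "is_forward (Backward n g) = False"

primrec round_wf :: "('xf, 'yf, 'xb, 'yb) round \<Rightarrow> bool" where
  "round_wf (Forward n f) \<longleftrightarrow> 0 < n \<and> (\<forall>v. \<forall>xs \<in> set_pmf (f v). length xs = n)"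
| "round_wf (Backward n g) \<longleftrightarrow> 0 < n \<and> (\<forall>v. \<forall>xs \<in> set_pmf (g v). length xs = n)"

primrec forward_uses :: "('xf, 'yf, 'xb, 'yb) round \<Rightarrow> nat" where
  "forward_uses (Forward n f) = n"
| "forward_uses (Backward n g) = 0"

primrec backward_uses :: "('xf, 'yf, 'xb, 'yb) round \<Rightarrow> nat" where
  "backward_uses (Forward n f) = 0"
| "backward_uses (Backward n g) = n"

primrec run_round ::
    "('xf, 'yf, 'zf) dmbc \<Rightarrow> ('xb, 'yb, 'zb) dmbc \<Rightarrow> ('xf, 'yf, 'xb, 'yb) round
     \<Rightarrow> ('xf, 'yf, 'zf, 'xb, 'yb, 'zb) views \<Rightarrow> ('xf, 'yf, 'zf, 'xb, 'yb, 'zb) views pmf" where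
  "run_round Wf Wb (Forward n f) = (\<lambda>(a, b, e).
     bind_pmf (f a) (\<lambda>xs. map_pmf (\<lambda>yzs.
       (a @ map Inl xs, b @ map (Inr \<circ> fst) yzs, e @ map (Inl \<circ> snd) yzs)) (dmbc_seq Wf xs)))"
| "run_round Wf Wb (Backward n g) = (\<lambda>(a, b, e).
     bind_pmf (g b) (\<lambda>xs. map_pmf (\<lambda>yzs.
       (a @ map (Inr \<circ> fst) yzs, b @ map Inl xs, e @ map (Inr \<circ> snd) yzs)) (dmbc_seq Wb xs)))"

primrec run_rounds ::
    "('xf, 'yf, 'zf) dmbc \<Rightarrow> ('xb, 'yb, 'zb) dmbc \<Rightarrow> ('xf, 'yf, 'xb, 'yb) round list
     \<Rightarrow> ('xf, 'yf, 'zf, 'xb, 'yb, 'zb) views \<Rightarrow> ('xf, 'yf, 'zf, 'xb, 'yb, 'zb) views pmf" where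
  "run_rounds Wf Wb [] v = return_pmf v"
| "run_rounds Wf Wb (r # rs) v = bind_pmf (run_round Wf Wb r v) (run_rounds Wf Wb rs)"

text \<open>\<open>key_by_alice\<close> tells which party's output is the key \<open>S\<close>; the other output is the estimate.
  Finite key alphabets are coded in \<^typ>\<open>nat\<close>.\<close>

record ('xf, 'yf, 'xb, 'yb) protocol =
  rounds :: "('xf, 'yf, 'xb, 'yb) round list"
  out_alice :: "('xf, 'yb) view \<Rightarrow> nat"
  out_bob :: "('xb, 'yf) view \<Rightarrow> nat"
  key_by_alice :: bool

definition protocol_wf :: "('xf, 'yf, 'xb, 'yb) protocol \<Rightarrow> bool" where
  "protocol_wf \<pi> \<longleftrightarrow>
     rounds \<pi> \<noteq> [] \<and> (\<forall>r \<in> set (rounds \<pi>). round_wf r) \<and>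
     successively (\<lambda>r r'. is_forward r \<noteq> is_forward r') (rounds \<pi>) \<and>
     finite (range (out_alice \<pi>)) \<and> finite (range (out_bob \<pi>))"

definition n_f :: "('xf, 'yf, 'xb, 'yb) protocol \<Rightarrow> nat" where
  "n_f \<pi> = (\<Sum>r \<leftarrow> rounds \<pi>. forward_uses r)"

definition n_b :: "('xf, 'yf, 'xb, 'yb) protocol \<Rightarrow> nat" where
  "n_b \<pi> = (\<Sum>r \<leftarrow> rounds \<pi>. backward_uses r)"

definition execution ::
    "('xf, 'yf, 'zf) dmbc \<Rightarrow> ('xb, 'yb, 'zb) dmbc \<Rightarrow> ('xf, 'yf, 'xb, 'yb) protocol
     \<Rightarrow> ('xf, 'yf, 'zf, 'xb, 'yb, 'zb) views pmf" where
  "execution Wf Wb \<pi> = run_rounds Wf Wb (rounds \<pi>) ([], [], [])"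

definition key ::
    "('xf, 'yf, 'xb, 'yb) protocol \<Rightarrow> ('xf, 'yf, 'zf, 'xb, 'yb, 'zb) views \<Rightarrow> nat" where
  "key \<pi> = (\<lambda>(a, b, e). if key_by_alice \<pi> then out_alice \<pi> a else out_bob \<pi> b)"

definition key_estimate ::
    "('xf, 'yf, 'xb, 'yb) protocol \<Rightarrow> ('xf, 'yf, 'zf, 'xb, 'yb, 'zb) views \<Rightarrow> nat" where
  "key_estimate \<pi> = (\<lambda>(a, b, e). if key_by_alice \<pi> then out_bob \<pi> b else out_alice \<pi> a)"

definition view_eve ::
    "('xf, 'yf, 'zf, 'xb, 'yb, 'zb) views \<Rightarrow> ('zf, 'zb) view" where
  "view_eve = (\<lambda>(a, b, e). e)"

definition secure ::
    "('xf, 'yf, 'zf) dmbc \<Rightarrow> ('xb, 'yb, 'zb) dmbc \<Rightarrow> real \<Rightarrow> real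
     \<Rightarrow> ('xf, 'yf, 'xb, 'yb) protocol \<Rightarrow> bool" where
  "secure Wf Wb R \<delta> \<pi> \<longleftrightarrow>
     (let p = execution Wf Wb \<pi>; S = key \<pi>; S' = key_estimate \<pi> in
       ent p S / real (n_f \<pi> + n_b \<pi>) > R - \<delta> \<and>
       measure_pmf.prob p {\<omega>. S' \<omega> \<noteq> S \<omega>} < \<delta> \<and>
       (ent p S = 0 \<or> cond_ent p S view_eve / ent p S > 1 - \<delta>))"

definition achievable :: "('xf, 'yf, 'zf) dmbc \<Rightarrow> ('xb, 'yb, 'zb) dmbc \<Rightarrow> real \<Rightarrow> bool" where
  "achievable Wf Wb R \<longleftrightarrow> 0 \<le> R \<and>
     (\<forall>\<delta>. 0 < \<delta> \<and> \<delta> \<le> 1 \<longrightarrow> (\<exists>\<pi>. protocol_wf \<pi> \<and> secure Wf Wb R \<delta> \<pi>))"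

text \<open>The achievable rates form a closed bounded set containing 0 when the channel alphabets are finite,
  so the supremum is the largest achievable rate.\<close>

definition sk_capacity :: "('xf, 'yf, 'zf) dmbc \<Rightarrow> ('xb, 'yb, 'zb) dmbc \<Rightarrow> ereal" where
  "sk_capacity Wf Wb = Sup {ereal R | R. achievable Wf Wb R}"

section \<open>The two lower bounds\<close>

text \<open>All variables live on one sample space; \<^typ>\<open>nat\<close> suffices for the space and for the auxiliary
  alphabets, since all alphabets are finite.\<close>

record ('xf, 'yf, 'zf, 'xb, 'yb, 'zb) variables =
  law :: "nat pmf"
  X_f :: "nat \<Rightarrow> 'xf"
  Y_f :: "nat \<Rightarrow> 'yf"
  Z_f :: "nat \<Rightarrow> 'zf"
  X_b :: "nat \<Rightarrow> 'xb"
  Y_b :: "nat \<Rightarrow> 'yb"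
  Z_b :: "nat \<Rightarrow> 'zb"
  V_f :: "nat \<Rightarrow> nat"
  V_b :: "nat \<Rightarrow> nat"
  W1_f :: "nat \<Rightarrow> nat"
  W2_f :: "nat \<Rightarrow> nat"
  W1_b :: "nat \<Rightarrow> nat"
  W2_b :: "nat \<Rightarrow> nat"

definition independent4 ::
    "'w pmf \<Rightarrow> ('w \<Rightarrow> 'a) \<Rightarrow> ('w \<Rightarrow> 'b) \<Rightarrow> ('w \<Rightarrow> 'c) \<Rightarrow> ('w \<Rightarrow> 'd) \<Rightarrow> bool" where
  "independent4 p A B C D \<longleftrightarrow>
     map_pmf (\<lambda>\<omega>. (A \<omega>, B \<omega>, C \<omega>, D \<omega>)) p =
     pair_pmf (map_pmf A p) (pair_pmf (map_pmf B p) (pair_pmf (map_pmf C p) (map_pmf D p)))"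

definition admissible ::
    "('xf, 'yf, 'zf) dmbc \<Rightarrow> ('xb, 'yb, 'zb) dmbc
     \<Rightarrow> ('xf, 'yf, 'zf, 'xb, 'yb, 'zb) variables \<Rightarrow> bool" where
  "admissible Wf Wb u \<longleftrightarrow>
     consistent Wf (law u) (X_f u) (Y_f u) (Z_f u) \<and>
     consistent Wb (law u) (X_b u) (Y_b u) (Z_b u) \<and>
     finite (range (V_f u)) \<and> finite (range (V_b u)) \<and>
     finite (range (W1_f u)) \<and> finite (range (W2_f u)) \<and>
     finite (range (W1_b u)) \<and> finite (range (W2_b u)) \<and>
     independent4 (law u) (V_f u) (V_b u)
       (\<lambda>\<omega>. (W1_f u \<omega>, W2_f u \<omega>)) (\<lambda>\<omega>. (W1_b u \<omega>, W2_b u \<omega>)) \<and>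
     markov3 (law u) (V_f u) (Y_f u) (\<lambda>\<omega>. (X_f u \<omega>, Z_f u \<omega>)) \<and>
     markov4 (law u) (W2_b u) (W1_b u) (X_b u) (\<lambda>\<omega>. (Y_b u \<omega>, Z_b u \<omega>)) \<and>
     markov3 (law u) (V_b u) (Y_b u) (\<lambda>\<omega>. (X_b u \<omega>, Z_b u \<omega>)) \<and>
     markov4 (law u) (W2_f u) (W1_f u) (X_f u) (\<lambda>\<omega>. (Y_f u \<omega>, Z_f u \<omega>))"

definition R_A_s1 :: "('xf, 'yf, 'zf, 'xb, 'yb, 'zb) variables \<Rightarrow> real" where
  "R_A_s1 u = mut_inf (law u) (V_f u) (X_f u) - mut_inf (law u) (V_f u) (Z_f u)"

definition R_A_s2 :: "('xf, 'yf, 'zf, 'xb, 'yb, 'zb) variables \<Rightarrow> real" where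
  "R_A_s2 u = cond_mut_inf (law u) (W1_b u) (Y_b u) (W2_b u)
            - cond_mut_inf (law u) (W1_b u) (Z_b u) (W2_b u)"

definition R_B_s1 :: "('xf, 'yf, 'zf, 'xb, 'yb, 'zb) variables \<Rightarrow> real" where
  "R_B_s1 u = mut_inf (law u) (V_b u) (X_b u) - mut_inf (law u) (V_b u) (Z_b u)"

definition R_B_s2 :: "('xf, 'yf, 'zf, 'xb, 'yb, 'zb) variables \<Rightarrow> real" where
  "R_B_s2 u = cond_mut_inf (law u) (W1_f u) (Y_f u) (W2_f u)
            - cond_mut_inf (law u) (W1_f u) (Z_f u) (W2_f u)"

text \<open>The suprema are taken in \<^typ>\<open>ereal\<close>, so that the supremum over an empty set is \<open>-\<infinity>\<close> (e.g.
  \<open>L_A\<close> when the backward channel to Alice has zero capacity).\<close>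

definition L_A :: "('xf, 'yf, 'zf) dmbc \<Rightarrow> ('xb, 'yb, 'zb) dmbc \<Rightarrow> ereal" where
  "L_A Wf Wb = Sup {ereal ((real nf * R_A_s1 u + real nb * max 0 (R_A_s2 u)) / (real nf + real nb))
     | nf nb u. 0 < nf + nb \<and> admissible Wf Wb u \<and>
         real nf * cond_mut_inf (law u) (V_f u) (Y_f u) (X_f u)
         < real nb * mut_inf (law u) (W1_b u) (Y_b u)}"

definition L_B :: "('xf, 'yf, 'zf) dmbc \<Rightarrow> ('xb, 'yb, 'zb) dmbc \<Rightarrow> ereal" where
  "L_B Wf Wb = Sup {ereal ((real nb * R_B_s1 u + real nf * max 0 (R_B_s2 u)) / (real nf + real nb))
     | nf nb u. 0 < nf + nb \<and> admissible Wf Wb u \<and>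
         real nb * cond_mut_inf (law u) (V_b u) (Y_b u) (X_b u)
         < real nf * mut_inf (law u) (W1_f u) (Y_f u)}"

end

(*
  For L_A, Alice sends an iid sequence X^n over the forward channel. A random codebook, indexed by
  triples t = (t_2, s, r), contains words v(t) and superposed words w_2(t_2), w_1(t). Consider the
  ideal experiment in which t is uniform, Y^n is the output of the channel V -> Y for the input v(t),
  (X^n, Z^n) is drawn given Y^n, and Bob sends w_1(t) through the prefix channel. If the codebook has
  more than 2^(n I(V;Y)) words, then Y^n is nearly iid (soft covering), so that drawing t from its
  posterior given the actual Y^n gives nearly the same joint law. In the ideal experiment Alice decodes
  t from X^n and from her backward output by joint typicality; for fixed (t_2, s), the index r of rate
  above n_f I(V_f;Z_f) + n_b I(W_1;Z_b|W_2) makes Eve's observation nearly independent of s (soft covering again).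
  The rates of t_2, s, r fit together exactly when n_f I(V_f;Y_f|X_f) < n_b I(W_1;Y_b), and s
  has the rate of the bound. When R_s2 is negative, one takes W_2 = W_1 instead. L_B follows by exchanging Alice and Bob.
*)
theory Submission
  imports Defs
begin

section \<open>Total variation distance\<close>

text \<open>The words v(t) must be numerous enough to imitate Bob's iid output, yet few enough for
  Alice to decode. Her own X^n resolves I(V;X) of the I(V;Y) bits per letter; the backward channel
  must carry the rest, which equals I(V;Y|X) because V - Y - X is a Markov chain. The clouds t_2
  take up the unprotected part of the index: Eve may learn t_2, so key and randomization are limited
  by informations conditional on W_2. As the words v(t) are drawn independently of the cloud
  centres, all of them take part in the covering. The demands on the code are expectations over one
  random codebook and involve words only in pairs, so second moments and union bounds suffice. An
  output depends only on a view, and views record channel symbols but no local randomness, so Bob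
  cannot output s. The key is therefore Alice's decision, which Bob guesses. Passing from the ideal
  to the actual experiment and replacing s by that decision turns a code error \<beta> into 2
  \<beta> in agreement and 4 \<beta> in secrecy.\<close>

abbreviation prob_of :: "'a pmf \<Rightarrow> 'a set \<Rightarrow> real" where
  "prob_of p \<equiv> measure_pmf.prob p"

abbreviation mean :: "'a pmf \<Rightarrow> ('a \<Rightarrow> real) \<Rightarrow> real" where
  "mean p \<equiv> measure_pmf.expectation p"

lemmas map_calc = map_bind_pmf map_pmf_comp o_def

lemma expectation_bind_finite:
  fixes h :: "'b \<Rightarrow> real"
  assumes "finite (set_pmf p)" "\<And>x. x \<in> set_pmf p \<Longrightarrow> finite (set_pmf (f x))"
  shows "mean (bind_pmf p f) h
    = mean p (\<lambda>x. mean (f x) h)"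
  using assms
  by (subst pmf_expectation_bind[OF assms(1)]) (auto simp: integral_measure_pmf[OF assms(1)])

lemma expectation_pair_finite:
  fixes h :: "'a \<times> 'b \<Rightarrow> real"
  assumes "finite (set_pmf p)" "finite (set_pmf q)"
  shows "mean (pair_pmf p q) h
    = mean p (\<lambda>x. mean q (\<lambda>y. h (x, y)))"
  unfolding pair_pmf_def
  by (subst expectation_bind_finite) (use assms in \<open>auto simp: expectation_bind_finite\<close>)

lemma prob_bind_pmf:
  "prob_of (bind_pmf p f) A = mean p (\<lambda>x. prob_of (f x) A)"
proof -
  have "ennreal (prob_of (bind_pmf p f) A) = (\<integral>\<^sup>+x. ennreal (prob_of (f x) A) \<partial>p)"
    by (simp add: measure_pmf.emeasure_eq_measure[symmetric])
  also have "\<dots> = ennreal (mean p (\<lambda>x. prob_of (f x) A))"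
    by (intro nn_integral_eq_integral measure_pmf.integrable_const_bound[where B=1]) auto
  finally show ?thesis
    by (subst (asm) ennreal_inj) (auto intro: integral_nonneg_AE)
qed

lemma prob_map_pmf: "prob_of (map_pmf f p) A = prob_of p {x. f x \<in> A}"
  by (simp add: vimage_def)

lemma prob_le_sum:
  assumes "finite I" "\<And>x. x \<in> set_pmf p \<Longrightarrow> x \<in> A \<Longrightarrow> \<exists>i\<in>I. x \<in> B i"
  shows "prob_of p A \<le> (\<Sum>i\<in>I. prob_of p (B i))"
proof -
  have "prob_of p A \<le> prob_of p (\<Union>i\<in>I. B i)"
    using assms by (intro measure_pmf.finite_measure_mono_AE) (auto simp: AE_measure_pmf_iff)
  also have "\<dots> \<le> (\<Sum>i\<in>I. prob_of p (B i))"
    by (intro measure_pmf.finite_measure_subadditive_finite) (use assms in auto)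
  finally show ?thesis .
qed

lemma prob_mono_support:
  assumes "\<And>x. x \<in> set_pmf p \<Longrightarrow> x \<in> A \<Longrightarrow> x \<in> B"
  shows "prob_of p A \<le> prob_of p B"
  using assms by (intro measure_pmf.finite_measure_mono_AE) (auto simp: AE_measure_pmf_iff)

lemma prob_Un_le: "prob_of p (A \<union> B) \<le> prob_of p A + prob_of p B"
  by (rule measure_Un_le) auto

lemma prob_eq_sum_support:
  assumes "finite S" "set_pmf p \<subseteq> S"
  shows "prob_of p A = (\<Sum>x\<in>A \<inter> S. pmf p x)"
proof -
  have "prob_of p A = prob_of p (A \<inter> S)"
    using assms by (intro measure_pmf.finite_measure_eq_AE) (auto simp: AE_measure_pmf_iff)
  also have "\<dots> = (\<Sum>x\<in>A \<inter> S. pmf p x)"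
    using assms(1) by (simp add: measure_measure_pmf_finite)
  finally show ?thesis .
qed

text \<open>Total variation distance at most \<open>\<eta>\<close>. One inequality per event is
  enough, since complements give the reverse one (\<open>near_sym\<close>).\<close>

definition near :: "real \<Rightarrow> 'a pmf \<Rightarrow> 'a pmf \<Rightarrow> bool" where
  "near \<eta> p q \<longleftrightarrow> (\<forall>A. prob_of p A \<le> prob_of q A + \<eta>)"

lemma nearD: "near \<eta> p q \<Longrightarrow> prob_of p A \<le> prob_of q A + \<eta>"
  by (simp add: near_def)

lemma near_sym:
  assumes "near \<eta> p q" shows "near \<eta> q p"
  unfolding near_def
proof
  fix A
  show "prob_of q A \<le> prob_of p A + \<eta>"
    using nearD[OF assms, of "-A"] measure_pmf.prob_compl[of A p] measure_pmf.prob_compl[of A q]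
    by (simp add: Compl_eq_Diff_UNIV)
qed

lemma near_trans: "near a p q \<Longrightarrow> near b q r \<Longrightarrow> near (a + b) p r"
  unfolding near_def by (smt (verit))

lemma near_mono: "near a p q \<Longrightarrow> a \<le> b \<Longrightarrow> near b p q"
  unfolding near_def by (smt (verit))

lemma near_map: "near \<eta> p q \<Longrightarrow> near \<eta> (map_pmf f p) (map_pmf f q)"
  unfolding near_def by simp

text \<open>Among functions with values in [0,1], the difference of the two means is largest for the
  indicator of the event where p exceeds q, and for events the bound is the definition.\<close>

lemma near_expectation:
  assumes pq: "near \<eta> p q" and h: "\<And>x. 0 \<le> h x" "\<And>x. h x \<le> (1::real)"
  shows "mean p h \<le> mean q h + \<eta>"
proof -
  have E: "mean r g = (\<integral>x. pmf r x * g x \<partial>count_space UNIV)" for r and g :: "_ \<Rightarrow> real"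
    unfolding measure_pmf_eq_density by (subst integral_density) auto
  have I: "integrable (count_space UNIV) (\<lambda>x. pmf r x * g x)" if "\<And>x. 0 \<le> g x" "\<And>x. g x \<le> 1"
    for r and g :: "_ \<Rightarrow> real"
  proof -
    have "integrable (measure_pmf r) g"
      using that by (intro measure_pmf.integrable_const_bound[where B=1]) auto
    then show ?thesis
      unfolding measure_pmf_eq_density by (subst (asm) integrable_density) auto
  qed
  let ?A = "{x. pmf q x < pmf p x}"
  have P: "prob_of r ?A = (\<integral>x. pmf r x * indicator ?A x \<partial>count_space UNIV)" for r
    using E[of r "indicator ?A"] by simp
  have "mean p h - mean q h
      = (\<integral>x. pmf p x * h x - pmf q x * h x \<partial>count_space UNIV)"
    unfolding E by (subst Bochner_Integration.integral_diff) (auto intro: I h)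
  also have "\<dots> \<le> (\<integral>x. pmf p x * indicator ?A x - pmf q x * indicator ?A x \<partial>count_space UNIV)"
  proof (intro integral_mono Bochner_Integration.integrable_diff I h)
    fix x
    have "(pmf p x - pmf q x) * h x \<le> (pmf p x - pmf q x) * indicator ?A x"
      using h[of x] by (auto simp: indicator_def mult_le_0_iff not_less mult_left_le)
    then show "pmf p x * h x - pmf q x * h x \<le> pmf p x * indicator ?A x - pmf q x * indicator ?A x"
      by (simp add: algebra_simps)
  qed (auto simp: indicator_def)
  also have "\<dots> = prob_of p ?A - prob_of q ?A"
    unfolding P by (subst Bochner_Integration.integral_diff) (auto intro!: I simp: indicator_def)
  also have "\<dots> \<le> \<eta>" using nearD[OF pq, of ?A] by simp
  finally show ?thesis by simp
qed

text \<open>Data processing: a common kernel cannot separate two laws, because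
  \<open>prob_of (K x) A\<close> is a [0,1]-valued function of x.\<close>

lemma near_bind: "near \<eta> p q \<Longrightarrow> near \<eta> (bind_pmf p K) (bind_pmf q K)"
  unfolding near_def[of _ "bind_pmf p K"] prob_bind_pmf by (auto intro!: near_expectation)

text \<open>Coupling inequality: both images are read off the same sample, and membership in an
  event can change only where the two functions differ.\<close>

lemma near_disagree:
  assumes "prob_of p {x. f x \<noteq> g x} \<le> \<epsilon>"
  shows "near \<epsilon> (map_pmf f p) (map_pmf g p)"
  unfolding near_def
proof
  fix A
  have "prob_of p {x. f x \<in> A} \<le> prob_of p ({x. g x \<in> A} \<union> {x. f x \<noteq> g x})"
    by (rule prob_mono_support) auto
  also have "\<dots> \<le> prob_of p {x. g x \<in> A} + \<epsilon>"
    using prob_Un_le[of p "{x. g x \<in> A}" "{x. f x \<noteq> g x}"] assms by simp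
  finally show "prob_of (map_pmf f p) A \<le> prob_of (map_pmf g p) A + \<epsilon>"
    by (simp add: vimage_def)
qed

text \<open>The total deficit of p below q bounds the distance. Soft covering estimates this
  one-sided sum, so an excess of the codebook's output law never has to be controlled.\<close>

lemma near_by_deficit:
  assumes "finite S" "set_pmf q \<subseteq> S" "(\<Sum>x\<in>S. max 0 (pmf q x - pmf p x)) \<le> \<eta>"
  shows "near \<eta> q p"
  unfolding near_def
proof
  fix A
  have "prob_of q A = (\<Sum>x\<in>A \<inter> S. pmf q x)"
    by (rule prob_eq_sum_support[OF assms(1,2)])
  also have "\<dots> \<le> (\<Sum>x\<in>A \<inter> S. pmf p x + max 0 (pmf q x - pmf p x))"
    by (intro sum_mono) auto
  also have "\<dots> = prob_of p (A \<inter> S) + (\<Sum>x\<in>A \<inter> S. max 0 (pmf q x - pmf p x))"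
    using assms(1) by (simp add: measure_measure_pmf_finite sum.distrib)
  also have "(\<Sum>x\<in>A \<inter> S. max 0 (pmf q x - pmf p x)) \<le> (\<Sum>x\<in>S. max 0 (pmf q x - pmf p x))"
    using assms(1) by (intro sum_mono2) auto
  also have "prob_of p (A \<inter> S) \<le> prob_of p A"
    by (intro measure_pmf.finite_measure_mono) auto
  finally show "prob_of q A \<le> prob_of p A + \<eta>" using assms(3) by simp
qed

text \<open>Conditional laws with supports controlled at every a. Kernels are needed later on all
  sequences, including those of probability zero.\<close>

lemma disintegrate_pmf:
  fixes J :: "('a \<times> 'b) pmf"
  obtains K where "J = bind_pmf (map_pmf fst J) (\<lambda>a. map_pmf (Pair a) (K a))"
    and "\<And>a. set_pmf (K a) \<subseteq> snd ` set_pmf J"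
proof
  \<comment> \<open>Off the support of the first marginal the default is the second marginal, so the
    support claim stays true there.\<close>
  define K where "K a = (if a \<in> fst ` set_pmf J then map_pmf snd (cond_pmf J (fst -` {a})) else map_pmf snd J)" for a
  have ne: "set_pmf J \<inter> fst -` {a} \<noteq> {}" if "a \<in> fst ` set_pmf J" for a using that by force
  show "set_pmf (K a) \<subseteq> snd ` set_pmf J" for a
    by (auto simp: K_def set_cond_pmf[OF ne])
  have "bind_pmf (map_pmf fst J) (\<lambda>a. map_pmf (Pair a) (K a))
      = bind_pmf (map_pmf fst J) (\<lambda>a. cond_pmf J (fst -` {a}))"
  proof (rule bind_pmf_cong[OF refl])
    fix a assume "a \<in> set_pmf (map_pmf fst J)"
    then have a: "a \<in> fst ` set_pmf J" by simp
    have "map_pmf (Pair a) (K a) = map_pmf (\<lambda>x. (a, snd x)) (cond_pmf J (fst -` {a}))"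
      using a by (simp add: K_def map_pmf_comp o_def)
    also have "\<dots> = map_pmf id (cond_pmf J (fst -` {a}))"
      by (rule map_pmf_cong[OF refl]) (auto simp: set_cond_pmf[OF ne[OF a]])
    finally show "map_pmf (Pair a) (K a) = cond_pmf J (fst -` {a})" by simp
  qed
  also have "\<dots> = J"
  proof (rule pmf_eqI)
    fix x
    have "pmf (bind_pmf (map_pmf fst J) (\<lambda>a. cond_pmf J (fst -` {a}))) x
        = mean (map_pmf fst J) (\<lambda>a. pmf (cond_pmf J (fst -` {a})) x)"
      by (simp add: pmf_bind)
    also have "\<dots> = mean (map_pmf fst J)
        (\<lambda>a. indicator {fst x} a * (pmf J x / prob_of J (fst -` {fst x})))"
      by (intro integral_cong_AE) (auto simp: AE_measure_pmf_iff pmf_cond[OF ne])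
    also have "\<dots> = pmf (map_pmf fst J) (fst x) * (pmf J x / prob_of J (fst -` {fst x}))"
      by (simp add: measure_pmf_single)
    also have "\<dots> = pmf J x"
    proof (cases "pmf J x = 0")
      case False
      then have "x \<in> set_pmf J" by (simp add: set_pmf_iff)
      then have "fst x \<in> fst ` set_pmf J" by auto
      then have "prob_of J (fst -` {fst x}) > 0"
        by (metis ne measure_pmf_zero_iff measure_nonneg less_eq_real_def)
      then show ?thesis by (simp add: pmf_map)
    qed simp
    finally show "pmf (bind_pmf (map_pmf fst J) (\<lambda>a. cond_pmf J (fst -` {a}))) x = pmf J x" .
  qed
  finally show "J = bind_pmf (map_pmf fst J) (\<lambda>a. map_pmf (Pair a) (K a))" by simp
qed

section \<open>Entropy and mutual information\<close>

lemma information_space_pmf: "information_space (measure_pmf p) 2"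
  by (intro information_space.intro information_space_axioms.intro measure_pmf.prob_space_axioms) auto

lemma distributed_pmf:
  assumes "countable S" "range X \<subseteq> S"
  shows "distributed (measure_pmf p) (count_space S) X (\<lambda>x. ennreal (pmf (map_pmf X p) x))"
  unfolding distributed_def
proof (intro conjI)
  show X: "X \<in> measurable (measure_pmf p) (count_space S)"
    using assms(2) by auto
  show "distr (measure_pmf p) (count_space S) X
      = density (count_space S) (\<lambda>x. ennreal (pmf (map_pmf X p) x))"
  proof (rule measure_eqI_countable[where A=S])
    fix x assume x: "x \<in> S"
    have "emeasure (density (count_space S) (\<lambda>x. ennreal (pmf (map_pmf X p) x))) {x}
        = (\<integral>\<^sup>+y. ennreal (pmf (map_pmf X p) y) * indicator {x} y \<partial>count_space S)"
      using x by (subst emeasure_density) auto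
    also have "\<dots> = ennreal (pmf (map_pmf X p) x)"
      using x by (subst nn_integral_count_space'[where A="{x}"]) auto
    also have "\<dots> = emeasure (distr (measure_pmf p) (count_space S) X) {x}"
      using x X by (subst emeasure_distr) (auto simp: pmf_map measure_pmf.emeasure_eq_measure vimage_def)
    finally show "emeasure (distr (measure_pmf p) (count_space S) X) {x}
      = emeasure (density (count_space S) (\<lambda>x. ennreal (pmf (map_pmf X p) x))) {x}" by simp
  qed (auto simp: assms)
qed auto

lemma integral_count_space_pmf:
  fixes g :: "'a \<Rightarrow> real"
  assumes "finite (set_pmf q)" "set_pmf q \<subseteq> S"
  shows "(\<integral>x. pmf q x * g x \<partial>count_space S) = mean q g"
proof -
  have f: "{a \<in> S. pmf q a * g a \<noteq> 0} \<subseteq> set_pmf q" by (auto simp: set_pmf_iff)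
  have "(\<integral>x. pmf q x * g x \<partial>count_space S) = (\<Sum>a | a \<in> S \<and> pmf q a * g a \<noteq> 0. pmf q a * g a)"
    by (rule lebesgue_integral_count_space_finite_support) (rule finite_subset[OF f assms(1)])
  also have "\<dots> = (\<Sum>a\<in>set_pmf q. pmf q a * g a)"
    using assms by (intro sum.mono_neutral_left) (auto simp: set_pmf_iff)
  also have "\<dots> = mean q g"
    by (subst integral_measure_pmf[OF assms(1)]) auto
  finally show ?thesis .
qed

lemma simple_distributed_pmf:
  "finite (range U) \<Longrightarrow> simple_distributed (measure_pmf p) U (pmf (map_pmf U p))"
  unfolding simple_distributed_def by (auto intro: distributed_pmf countable_finite)

lemma cond_ent_eq:
  fixes X :: "'w \<Rightarrow> 'a::countable" and Y :: "'w \<Rightarrow> 'b::countable"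
  assumes "finite (set_pmf p)"
  shows "cond_ent p X Y = mean (map_pmf (\<lambda>i. (X i, Y i)) p)
    (\<lambda>(x, y). - log 2 (pmf (map_pmf (\<lambda>i. (X i, Y i)) p) (x, y) / pmf (map_pmf Y p) y))"
proof -
  interpret information_space "measure_pmf p" 2 by (rule information_space_pmf)
  let ?q = "map_pmf (\<lambda>i. (X i, Y i)) p"
  have pr: "count_space (range X) \<Otimes>\<^sub>M count_space (range Y) = count_space (range X \<times> range Y)"
    by (rule pair_measure_countable) auto
  have "cond_ent p X Y = - (\<integral>(x, y). pmf ?q (x, y) * log 2 (pmf ?q (x, y) / pmf (map_pmf Y p) y)
      \<partial>count_space (range X \<times> range Y))"
    unfolding cond_ent_def pr[symmetric]
    by (rule conditional_entropy_generic_eq)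
      (auto simp: pr intro!: sigma_finite_measure_count_space_countable distributed_pmf)
  also have "\<dots> = - mean ?q (\<lambda>(x, y). log 2 (pmf ?q (x, y) / pmf (map_pmf Y p) y))"
    by (subst integral_count_space_pmf[of ?q "range X \<times> range Y", symmetric])
      (use assms in \<open>auto simp: case_prod_beta simp del: pmf_map intro!: Bochner_Integration.integral_cong\<close>)
  finally show ?thesis by (simp add: case_prod_beta)
qed

lemma ent_eq:
  fixes X :: "'w \<Rightarrow> 'a::countable"
  assumes "finite (set_pmf p)"
  shows "ent p X = mean (map_pmf X p) (\<lambda>x. - log 2 (pmf (map_pmf X p) x))"
proof -
  interpret information_space "measure_pmf p" 2 by (rule information_space_pmf)
  have "ent p X = - (\<integral>x. pmf (map_pmf X p) x * log 2 (pmf (map_pmf X p) x) \<partial>count_space (range X))"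
    unfolding ent_def by (rule entropy_distr) (auto intro!: distributed_pmf)
  also have "\<dots> = - mean (map_pmf X p) (\<lambda>x. log 2 (pmf (map_pmf X p) x))"
    by (subst integral_count_space_pmf[of _ "range X", symmetric]) (use assms in auto)
  finally show ?thesis by simp
qed

lemma ent_le_log_card:
  assumes "finite (range X)" "card (range X) \<le> K"
  shows "ent p X \<le> log 2 (real K)"
proof -
  interpret information_space "measure_pmf p" 2 by (rule information_space_pmf)
  have "card (range X) > 0" using assms by (simp add: card_gt_0_iff)
  then show ?thesis
    using entropy_le_card[OF simple_distributed_pmf[OF assms(1)]] assms(2) unfolding ent_def by simp (smt (verit) Transcendental.log_mono of_nat_0_less_iff of_nat_mono)
qed

lemma mut_inf_eq:
  assumes "finite (range X)" "finite (range Y)"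
  shows "mut_inf p X Y = mean (map_pmf (\<lambda>i. (X i, Y i)) p)
    (\<lambda>(x, y). log 2 (pmf (map_pmf (\<lambda>i. (X i, Y i)) p) (x, y) / (pmf (map_pmf X p) x * pmf (map_pmf Y p) y)))"
proof -
  interpret information_space "measure_pmf p" 2 by (rule information_space_pmf)
  have fin: "finite (range (\<lambda>i. (X i, Y i)))"
    by (rule finite_subset[of _ "range X \<times> range Y"]) (use assms in auto)
  show ?thesis
    unfolding mut_inf_def
    using mutual_information_simple_distributed[OF assms[THEN simple_distributed_pmf] simple_distributed_pmf[OF fin]]
    by (subst integral_measure_pmf[of "range (\<lambda>i. (X i, Y i))"]) (use fin in \<open>auto simp: case_prod_beta\<close>)
qed

lemma cond_mut_inf_eq:
  assumes "finite (range X)" "finite (range Y)" "finite (range Z)"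
  shows "cond_mut_inf p X Y Z = mean (map_pmf (\<lambda>i. (X i, Y i, Z i)) p)
    (\<lambda>(x, y, z). log 2 (pmf (map_pmf (\<lambda>i. (X i, Y i, Z i)) p) (x, y, z) /
       (pmf (map_pmf (\<lambda>i. (X i, Z i)) p) (x, z) *
        (pmf (map_pmf (\<lambda>i. (Y i, Z i)) p) (y, z) / pmf (map_pmf Z p) z))))"
proof -
  interpret information_space "measure_pmf p" 2 by (rule information_space_pmf)
  have fins: "finite (range (\<lambda>i. (X i, Y i, Z i)))" "finite (range (\<lambda>i. (X i, Z i)))"
    "finite (range (\<lambda>i. (Y i, Z i)))"
    by (rule finite_subset[of _ "range X \<times> range Y \<times> range Z"] finite_subset[of _ "range X \<times> range Z"]
      finite_subset[of _ "range Y \<times> range Z"]; use assms in auto)+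
  have 1: "simple_distributed (measure_pmf p) Z (pmf (map_pmf Z p))"
   and 2: "simple_distributed (measure_pmf p) (\<lambda>i. (Y i, Z i)) (pmf (map_pmf (\<lambda>i. (Y i, Z i)) p))"
   and 3: "simple_distributed (measure_pmf p) (\<lambda>i. (X i, Z i)) (pmf (map_pmf (\<lambda>i. (X i, Z i)) p))"
   and 4: "simple_distributed (measure_pmf p) (\<lambda>i. (X i, Y i, Z i)) (pmf (map_pmf (\<lambda>i. (X i, Y i, Z i)) p))"
    using assms fins by (simp_all add: simple_distributed_pmf)
  show ?thesis
    unfolding cond_mut_inf_def
    using conditional_mutual_information_eq[OF 1 2 3 4]
    by (subst integral_measure_pmf[of "range (\<lambda>i. (X i, Y i, Z i))"]) (use fins in \<open>auto simp: case_prod_beta\<close>)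
qed

text \<open>The posterior of the key given Eve's observation exceeds 2 / K only on an event of mass
  at most 4 \<eta>. Elsewhere a sample contributes at least log K - 1, and on that event at least 0.
  The loss is a fraction of log K plus a constant, whatever the size of Eve's alphabet, as the ratio
  in the security condition requires.\<close>

lemma equivocation_bound:
  fixes q :: "(nat \<times> 'e) pmf"
  assumes fin: "finite (set_pmf q)" and K: "K > 0"
    and near: "near \<eta> q (pair_pmf (pmf_of_set {..<K}) Q)"
    and nn: "\<And>x y. (x, y) \<in> set_pmf q \<Longrightarrow> pmf q (x, y) \<le> pmf (map_pmf snd q) y"
    and small: "4 * \<eta> \<le> 1"
  shows "mean q (\<lambda>(x, y). - log 2 (pmf q (x, y) / pmf (map_pmf snd q) y))
    \<ge> (1 - 4 * \<eta>) * (log 2 (real K) - 1)"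
proof (cases "K = 1")
  \<comment> \<open>Here log K - 1 is negative, so the claim follows from the nonnegativity of
    conditional entropy.\<close>
  case True
  have "0 \<le> mean q (\<lambda>(x, y). - log 2 (pmf q (x, y) / pmf (map_pmf snd q) y))"
  proof (rule integral_nonneg_AE, unfold AE_measure_pmf_iff, safe)
    fix x y assume xy: "(x, y) \<in> set_pmf q"
    then have "0 < pmf q (x, y)" by (simp add: pmf_positive)
    then show "0 \<le> - log 2 (pmf q (x, y) / pmf (map_pmf snd q) y)"
      using nn[OF xy] by simp
  qed
  moreover have "(1 - 4 * \<eta>) * (log 2 (real K) - 1) \<le> 0" using True small by simp
  ultimately show ?thesis by linarith
next
  case False
  then have K2: "K \<ge> 2" using K by simp
  let ?u = "pmf_of_set {..<K}"
  let ?PE = "map_pmf snd q"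
  have un: "pmf ?u x \<le> 1 / real K" for x
    using K by (subst pmf_of_set) (auto simp: indicator_def)
  have nearE: "near \<eta> ?PE Q"
    using near_map[OF near, of snd] by (simp add: map_snd_pair_pmf)
  \<comment> \<open>The posterior refers to the marginal of q itself and not to \<open>Q\<close>;
    the exchange costs a second \<eta>.\<close>
  have near2: "near (2 * \<eta>) q (pair_pmf ?u ?PE)"
  proof -
    have c: "pair_pmf ?u R = bind_pmf R (\<lambda>e. map_pmf (\<lambda>x. (x, e)) ?u)" for R :: "'e pmf"
      unfolding pair_pmf_def map_pmf_def by (rule bind_commute_pmf)
    have "near \<eta> (pair_pmf ?u Q) (pair_pmf ?u ?PE)"
      unfolding c by (rule near_bind[OF near_sym[OF nearE]])
    from near_trans[OF near this] show ?thesis by simp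
  qed
  \<comment> \<open>Under the product law, \<open>B\<close> has at most half of the mass that it has under \<open>q\<close>; as the two laws
    are \<open>2\<eta>\<close>-close, that mass is at most \<open>4\<eta>\<close>.\<close>
  define B where "B = {(x, y). pmf q (x, y) > (2 / real K) * pmf ?PE y} \<inter> set_pmf q"
  have finB: "finite B" using fin by (auto simp: B_def)
  have "prob_of (pair_pmf ?u ?PE) B = (\<Sum>b\<in>B. pmf (pair_pmf ?u ?PE) b)"
    using finB by (simp add: measure_measure_pmf_finite)
  also have "\<dots> \<le> (\<Sum>b\<in>B. pmf q b / 2)"
  proof (rule sum_mono)
    fix b assume b: "b \<in> B"
    obtain x y where xy: "b = (x, y)" by force
    have "pmf (pair_pmf ?u ?PE) b \<le> (1 / real K) * pmf ?PE y"
      unfolding xy pmf_pair by (intro mult_right_mono un) simp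
    then show "pmf (pair_pmf ?u ?PE) b \<le> pmf q b / 2"
      using b xy by (auto simp: B_def)
  qed
  also have "\<dots> = prob_of q B / 2"
    using finB by (simp add: measure_measure_pmf_finite sum_divide_distrib)
  finally have B4: "prob_of q B \<le> 4 * \<eta>" using nearD[OF near2, of B] by simp
  have lK: "log 2 (real K) - 1 \<ge> 0"
    using K2 by (simp add: le_log_iff)
  have "(1 - 4 * \<eta>) * (log 2 (real K) - 1) \<le> prob_of q (- B) * (log 2 (real K) - 1)"
    using B4 lK measure_pmf.prob_compl[of B q] by (intro mult_right_mono) (auto simp: Compl_eq_Diff_UNIV)
  also have "\<dots> = mean q (\<lambda>w. indicator (- B) w * (log 2 (real K) - 1))"
    by simp
  also have "\<dots> \<le> mean q (\<lambda>(x, y). - log 2 (pmf q (x, y) / pmf (map_pmf snd q) y))"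
  proof (rule integral_mono_AE)
    show "AE w in q. indicator (- B) w * (log 2 (real K) - 1)
      \<le> (case w of (x, y) \<Rightarrow> - log 2 (pmf q (x, y) / pmf (map_pmf snd q) y))"
      unfolding AE_measure_pmf_iff
    proof safe
      fix x y assume xy: "(x, y) \<in> set_pmf q"
      then have p: "0 < pmf q (x, y)" by (simp add: pmf_positive)
      have pe: "0 < pmf ?PE y" using nn[OF xy] p by linarith
      have r: "0 < pmf q (x, y) / pmf ?PE y" "pmf q (x, y) / pmf ?PE y \<le> 1" using p pe nn[OF xy] by auto
      show "indicator (- B) (x, y) * (log 2 (real K) - 1) \<le> - log 2 (pmf q (x, y) / pmf (map_pmf snd q) y)"
      proof (cases "(x, y) \<in> B")
        case True then show ?thesis using r by simp
      next
        case False
        then have "pmf q (x, y) / pmf ?PE y \<le> 2 / real K"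
          using xy pe by (auto simp: B_def field_simps not_less)
        then have "log 2 (pmf q (x, y) / pmf ?PE y) \<le> log 2 (2 / real K)"
          using r K by (subst log_le_cancel_iff) auto
        also have "\<dots> = 1 - log 2 (real K)" using K by (simp add: log_divide)
        finally show ?thesis using False by simp
      qed
    qed
  qed (use fin in \<open>auto intro: integrable_measure_pmf_finite\<close>)
  finally show ?thesis .
qed

lemma cond_ent_ge:
  fixes S :: "'w \<Rightarrow> nat" and E :: "'w \<Rightarrow> 'e::countable"
  assumes fin: "finite (set_pmf p)" and K: "K > 0" and small: "4 * \<eta> \<le> 1"
    and near: "near \<eta> (map_pmf (\<lambda>i. (S i, E i)) p) (pair_pmf (pmf_of_set {..<K}) Q)"
  shows "cond_ent p S E \<ge> (1 - 4 * \<eta>) * (log 2 (real K) - 1)"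
proof -
  let ?q = "map_pmf (\<lambda>i. (S i, E i)) p"
  have E: "map_pmf E p = map_pmf snd ?q" by (simp add: map_pmf_comp o_def)
  have "pmf ?q (x, y) \<le> pmf (map_pmf E p) y" for x y
    unfolding pmf_map by (intro measure_pmf.finite_measure_mono) auto
  then show ?thesis
    unfolding cond_ent_eq[OF fin] E
    by (intro equivocation_bound[OF _ K near _ small]) (use fin E in auto)
qed

text \<open>Entropy is the conditional entropy given a constant.\<close>

lemma ent_ge:
  fixes S :: "'w \<Rightarrow> nat"
  assumes fin: "finite (set_pmf p)" and K: "K > 0" and small: "4 * \<eta> \<le> 1"
    and near: "near \<eta> (map_pmf S p) (pmf_of_set {..<K})"
  shows "ent p S \<ge> (1 - 4 * \<eta>) * (log 2 (real K) - 1)"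
proof -
  have "near \<eta> (map_pmf (\<lambda>i. (S i, ())) p) (pair_pmf (pmf_of_set {..<K}) (return_pmf ()))"
    using near_map[OF near, of "\<lambda>x. (x, ())"] by (simp add: map_pmf_comp o_def pair_return_pmf2)
  from cond_ent_ge[OF fin K small this]
  have "cond_ent p S (\<lambda>_. ()) \<ge> (1 - 4 * \<eta>) * (log 2 (real K) - 1)" .
  moreover have "pmf (map_pmf (\<lambda>i. (S i, ())) p) (x, ()) = pmf (map_pmf S p) x" for x
    by (simp add: pmf_map vimage_def)
  then have "cond_ent p S (\<lambda>_. ()) = ent p S"
    unfolding cond_ent_eq[OF fin] ent_eq[OF fin] by simp
  ultimately show ?thesis by simp
qed

section \<open>Soft covering\<close>

abbreviation joint :: "'a pmf \<Rightarrow> ('a \<Rightarrow> 'b pmf) \<Rightarrow> ('a \<times> 'b) pmf" where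
  "joint P W \<equiv> bind_pmf P (\<lambda>u. map_pmf (Pair u) (W u))"

lemma expectation_joint:
  fixes h :: "'a \<times> 'b \<Rightarrow> real"
  assumes "finite (set_pmf P)" "\<And>u. u \<in> set_pmf P \<Longrightarrow> finite (set_pmf (W u))"
  shows "mean (joint P W) h
    = mean P (\<lambda>u. mean (W u) (\<lambda>y. h (u, y)))"
  using assms by (subst expectation_bind_finite) auto

text \<open>Only covariances enter the variance of an average, so pairwise independence already
  makes it shrink like 1 / card T. The variance of a single term is bounded by its second
  moment.\<close>

lemma pairwise_mean_square:
  fixes g :: "'u \<Rightarrow> real"
  assumes T: "finite T" "T \<noteq> {}" and fin: "finite (set_pmf C)"
    and marg: "\<And>t. t \<in> T \<Longrightarrow> map_pmf (c t) C = P"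
    and pair: "\<And>t t'. t \<in> T \<Longrightarrow> t' \<in> T \<Longrightarrow> t \<noteq> t' \<Longrightarrow> map_pmf (\<lambda>\<omega>. (c t \<omega>, c t' \<omega>)) C = pair_pmf P P"
  defines "\<mu> \<equiv> mean P g"
  shows "mean C (\<lambda>\<omega>. ((\<Sum>t\<in>T. g (c t \<omega>)) / real (card T) - \<mu>)\<^sup>2)
    \<le> mean P (\<lambda>u. (g u)\<^sup>2) / real (card T)"
proof -
  have cT: "real (card T) > 0" using T by (simp add: card_gt_0_iff)
  note int = integrable_measure_pmf_finite[OF fin]
  have finP: "finite (set_pmf P)"
    using T marg fin by (metis ex_in_conv finite_imageI set_map_pmf)
  note intP = integrable_measure_pmf_finite[OF finP]
  define d where "d t \<omega> = g (c t \<omega>) - \<mu>" for t \<omega>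
  have mean: "mean P (\<lambda>u. g u - \<mu>) = 0"
    by (subst Bochner_Integration.integral_diff) (auto simp: \<mu>_def intro: intP)
  have off: "mean C (\<lambda>\<omega>. d t \<omega> * d t' \<omega>) = 0" if "t \<in> T" "t' \<in> T" "t \<noteq> t'" for t t'
  proof -
    have "mean C (\<lambda>\<omega>. d t \<omega> * d t' \<omega>)
        = mean (map_pmf (\<lambda>\<omega>. (c t \<omega>, c t' \<omega>)) C) (\<lambda>(u, u'). (g u - \<mu>) * (g u' - \<mu>))"
      by (simp add: d_def)
    also have "\<dots> = mean P (\<lambda>u. mean P (\<lambda>u'. (g u - \<mu>) * (g u' - \<mu>)))"
      unfolding pair[OF that] by (subst expectation_pair_finite[OF finP finP]) simp
    also have "\<dots> = 0" by (simp add: mean)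
    finally show ?thesis .
  qed
  have diag: "mean C (\<lambda>\<omega>. d t \<omega> * d t \<omega>) \<le> mean P (\<lambda>u. (g u)\<^sup>2)"
    if "t \<in> T" for t
  proof -
    have "mean C (\<lambda>\<omega>. d t \<omega> * d t \<omega>)
        = mean (map_pmf (c t) C) (\<lambda>u. (g u - \<mu>)\<^sup>2)"
      by (simp add: d_def power2_eq_square)
    also have "\<dots> = mean P (\<lambda>u. (g u)\<^sup>2 - 2 * \<mu> * g u + \<mu>\<^sup>2)"
      unfolding marg[OF that] by (simp add: power2_eq_square algebra_simps)
    also have "\<dots> = mean P (\<lambda>u. (g u)\<^sup>2) - 2 * \<mu> * \<mu> + \<mu>\<^sup>2"
      by (subst Bochner_Integration.integral_add, rule intP, rule intP,
          subst Bochner_Integration.integral_diff, rule intP, rule intP) (simp add: \<mu>_def)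
    finally show ?thesis by (simp add: power2_eq_square)
  qed
  have eq: "((\<Sum>t\<in>T. g (c t \<omega>)) / real (card T) - \<mu>)\<^sup>2 = (\<Sum>t\<in>T. \<Sum>t'\<in>T. d t \<omega> * d t' \<omega>) / (real (card T))\<^sup>2" for \<omega>
  proof -
    have "(\<Sum>t\<in>T. g (c t \<omega>)) / real (card T) - \<mu> = (\<Sum>t\<in>T. d t \<omega>) / real (card T)"
      using cT by (simp add: d_def sum_subtractf field_simps)
    then show ?thesis by (simp add: power_divide power2_eq_square[of "sum _ _"] sum_product)
  qed
  have "mean C (\<lambda>\<omega>. ((\<Sum>t\<in>T. g (c t \<omega>)) / real (card T) - \<mu>)\<^sup>2)
      = (\<Sum>t\<in>T. \<Sum>t'\<in>T. mean C (\<lambda>\<omega>. d t \<omega> * d t' \<omega>)) / (real (card T))\<^sup>2"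
    unfolding eq by (simp add: Bochner_Integration.integral_sum int)
  also have "\<dots> \<le> (\<Sum>t\<in>T. \<Sum>t'\<in>T. if t' = t then mean P (\<lambda>u. (g u)\<^sup>2) else 0) / (real (card T))\<^sup>2"
    by (intro divide_right_mono sum_mono) (use off diag in auto)
  also have "\<dots> = mean P (\<lambda>u. (g u)\<^sup>2) / real (card T)"
    using T cT by (simp add: power2_eq_square)
  finally show ?thesis .
qed

text \<open>This is the nonnegativity of the variance of |f|.\<close>

lemma expectation_abs_le_sqrt:
  fixes f :: "'a \<Rightarrow> real"
  assumes "finite (set_pmf p)"
  shows "mean p (\<lambda>x. \<bar>f x\<bar>) \<le> sqrt (mean p (\<lambda>x. (f x)\<^sup>2))"
proof -
  note int = integrable_measure_pmf_finite[OF assms]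
  have "0 \<le> measure_pmf.variance p (\<lambda>x. \<bar>f x\<bar>)"
    by (rule measure_pmf.variance_positive)
  also have "\<dots> = mean p (\<lambda>x. (f x)\<^sup>2) - (mean p (\<lambda>x. \<bar>f x\<bar>))\<^sup>2"
    by (subst measure_pmf.variance_eq) (auto intro: int)
  finally show ?thesis by (intro real_le_rsqrt) simp
qed

text \<open>For each y, the output law of the codebook is a sample mean of the likelihoods
  \<open>pmf (W u) y\<close>. Cut off where the likelihood exceeds a times its mean, this sample
  mean deviates on average by at most the fraction sqrt (a / card T) of \<open>pmf Q y\<close>, and
  the mass cut off is the atypicality probability. With a about 2^(n I), a codebook of rate above I
  covers the output law.\<close>

lemma soft_covering:
  fixes W :: "'u \<Rightarrow> 'o pmf" and c :: "'t \<Rightarrow> 'c \<Rightarrow> 'u"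
  assumes T: "finite T" "T \<noteq> {}" and fin: "finite (set_pmf C)"
    and marg: "\<And>t. t \<in> T \<Longrightarrow> map_pmf (c t) C = P"
    and pair: "\<And>t t'. t \<in> T \<Longrightarrow> t' \<in> T \<Longrightarrow> t \<noteq> t' \<Longrightarrow> map_pmf (\<lambda>\<omega>. (c t \<omega>, c t' \<omega>)) C = pair_pmf P P"
    and S: "finite S" "\<And>u. u \<in> set_pmf P \<Longrightarrow> set_pmf (W u) \<subseteq> S" and a: "0 \<le> a"
  defines "Q \<equiv> bind_pmf P W"
  shows "mean C (\<lambda>\<omega>. \<Sum>y\<in>S. max 0 (pmf Q y - (\<Sum>t\<in>T. pmf (W (c t \<omega>)) y) / real (card T)))
    \<le> prob_of (joint P W) {(u, y). pmf (W u) y > a * pmf Q y} + sqrt (a / real (card T))"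
proof -
  have cT: "real (card T) > 0" using T by (simp add: card_gt_0_iff)
  note int = integrable_measure_pmf_finite[OF fin]
  have finP: "finite (set_pmf P)"
    using T marg fin by (metis ex_in_conv finite_imageI set_map_pmf)
  note intP = integrable_measure_pmf_finite[OF finP]
  have finW: "finite (set_pmf (W u))" if "u \<in> set_pmf P" for u
    using S that finite_subset by blast
  have SQ: "set_pmf Q \<subseteq> S" using S by (auto simp: Q_def)
  have Qe: "pmf Q y = mean P (\<lambda>u. pmf (W u) y)" for y
    by (simp add: Q_def pmf_bind)
  \<comment> \<open>Discarding the atypical pairs bounds the second moment of the summands by \<open>a * pmf Q y\<close> times the first.\<close>
  define g where "g y u = (if pmf (W u) y \<le> a * pmf Q y then pmf (W u) y else 0)" for y u
  define \<mu> where "\<mu> y = mean P (g y)" for y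
  have g0: "0 \<le> g y u" "g y u \<le> pmf (W u) y" for y u by (auto simp: g_def)
  have \<mu>Q: "\<mu> y \<le> pmf Q y" for y unfolding \<mu>_def Qe
    by (intro integral_mono intP g0)
  have dev: "mean C (\<lambda>\<omega>. \<bar>(\<Sum>t\<in>T. g y (c t \<omega>)) / real (card T) - \<mu> y\<bar>)
      \<le> pmf Q y * sqrt (a / real (card T))" for y
  proof -
    have "mean P (\<lambda>u. (g y u)\<^sup>2) \<le> mean P (\<lambda>u. a * pmf Q y * pmf (W u) y)"
      by (intro integral_mono intP) (auto simp: g_def power2_eq_square intro!: mult_right_mono mult_nonneg_nonneg a)
    also have "\<dots> = a * (pmf Q y)\<^sup>2" by (simp add: Qe[symmetric] power2_eq_square)
    finally have *: "mean P (\<lambda>u. (g y u)\<^sup>2) / real (card T) \<le> a * (pmf Q y)\<^sup>2 / real (card T)"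
      using cT by (intro divide_right_mono) auto
    have "mean C (\<lambda>\<omega>. \<bar>(\<Sum>t\<in>T. g y (c t \<omega>)) / real (card T) - \<mu> y\<bar>)
      \<le> sqrt (mean C (\<lambda>\<omega>. ((\<Sum>t\<in>T. g y (c t \<omega>)) / real (card T) - \<mu> y)\<^sup>2))"
      by (rule expectation_abs_le_sqrt[OF fin])
    also have "\<dots> \<le> sqrt (a * (pmf Q y)\<^sup>2 / real (card T))"
      unfolding \<mu>_def
      by (intro real_sqrt_le_mono order_trans[OF pairwise_mean_square[OF T fin marg pair] *])
    also have "\<dots> = pmf Q y * sqrt (a / real (card T))"
      by (simp add: real_sqrt_mult real_sqrt_divide)
    finally show ?thesis .
  qed
  \<comment> \<open>Truncation only lowers the sample mean, so the deficit is at most the truncated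
    mass plus the fluctuation of the truncated sample mean.\<close>
  have "mean C (\<lambda>\<omega>. \<Sum>y\<in>S. max 0 (pmf Q y - (\<Sum>t\<in>T. pmf (W (c t \<omega>)) y) / real (card T)))
      \<le> mean C (\<lambda>\<omega>. \<Sum>y\<in>S. (pmf Q y - \<mu> y) + \<bar>(\<Sum>t\<in>T. g y (c t \<omega>)) / real (card T) - \<mu> y\<bar>)"
  proof (intro integral_mono int sum_mono)
    fix \<omega> y
    have "(\<Sum>t\<in>T. g y (c t \<omega>)) / real (card T) \<le> (\<Sum>t\<in>T. pmf (W (c t \<omega>)) y) / real (card T)"
      using cT by (intro divide_right_mono sum_mono g0) auto
    then show "max 0 (pmf Q y - (\<Sum>t\<in>T. pmf (W (c t \<omega>)) y) / real (card T))
      \<le> (pmf Q y - \<mu> y) + \<bar>(\<Sum>t\<in>T. g y (c t \<omega>)) / real (card T) - \<mu> y\<bar>"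
      using \<mu>Q[of y] by (auto simp: abs_if)
  qed
  also have "\<dots> = (\<Sum>y\<in>S. (pmf Q y - \<mu> y)
      + mean C (\<lambda>\<omega>. \<bar>(\<Sum>t\<in>T. g y (c t \<omega>)) / real (card T) - \<mu> y\<bar>))"
    by (subst Bochner_Integration.integral_sum, rule int, intro sum.cong refl,
        subst Bochner_Integration.integral_add, rule int, rule int, simp)
  also have "\<dots> \<le> (\<Sum>y\<in>S. (pmf Q y - \<mu> y) + pmf Q y * sqrt (a / real (card T)))"
    by (intro sum_mono add_left_mono dev)
  also have "\<dots> = (\<Sum>y\<in>S. pmf Q y - \<mu> y) + sqrt (a / real (card T))"
    using sum_pmf_eq_1[OF S(1) SQ] by (simp add: sum.distrib sum_distrib_right[symmetric])
  also have "(\<Sum>y\<in>S. pmf Q y - \<mu> y)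
      = prob_of (joint P W) {(u, y). pmf (W u) y > a * pmf Q y}"
  proof -
    have "(\<Sum>y\<in>S. pmf Q y - \<mu> y) = (\<Sum>y\<in>S. mean P (\<lambda>u. pmf (W u) y - g y u))"
      unfolding Qe \<mu>_def by (intro sum.cong refl Bochner_Integration.integral_diff[symmetric] intP)
    also have "\<dots> = mean P (\<lambda>u. \<Sum>y\<in>S. pmf (W u) y - g y u)"
      by (rule Bochner_Integration.integral_sum[symmetric]) (rule intP)
    also have "\<dots> = mean P (\<lambda>u. prob_of (W u) {y. pmf (W u) y > a * pmf Q y})"
    proof (intro integral_cong_AE; (simp add: AE_measure_pmf_iff)?; intro ballI)
      fix u assume u: "u \<in> set_pmf P"
      have "(\<Sum>y\<in>S. pmf (W u) y - g y u) = (\<Sum>y\<in>{y. pmf (W u) y > a * pmf Q y} \<inter> S. pmf (W u) y)"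
        using S(1) by (intro sum.mono_neutral_cong_right) (auto simp: g_def)
      also have "\<dots> = prob_of (W u) {y. pmf (W u) y > a * pmf Q y}"
        by (rule prob_eq_sum_support[OF S(1) S(2)[OF u], symmetric])
      finally show "(\<Sum>y\<in>S. pmf (W u) y - g y u) = prob_of (W u) {y. pmf (W u) y > a * pmf Q y}" .
    qed
    also have "\<dots> = prob_of (joint P W) {(u, y). pmf (W u) y > a * pmf Q y}"
      by (simp add: prob_bind_pmf vimage_def)
    finally show ?thesis .
  qed
  finally show ?thesis .
qed

text \<open>If y is drawn from q, the likelihood ratio k / q has mean at most 1, and Markov's
  inequality applies. With k the output law of a wrong codeword, this is the chance that it passes a
  threshold test.\<close>

lemma prob_density_ge:
  assumes "finite S" "set_pmf q \<subseteq> S" "0 < c"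
  shows "prob_of q {y. c * pmf q y \<le> pmf k y} \<le> 1 / c"
proof -
  let ?A = "{y. c * pmf q y \<le> pmf k y} \<inter> S"
  have "c * prob_of q {y. c * pmf q y \<le> pmf k y} = (\<Sum>y\<in>?A. c * pmf q y)"
    by (subst prob_eq_sum_support[OF assms(1,2)]) (simp add: sum_distrib_left)
  also have "\<dots> \<le> (\<Sum>y\<in>?A. pmf k y)" by (intro sum_mono) auto
  also have "\<dots> = prob_of k ?A" using assms(1) by (simp add: measure_measure_pmf_finite)
  also have "\<dots> \<le> 1" by simp
  finally show ?thesis using assms(3) by (simp add: field_simps)
qed

lemma Pi_pmf_pair:
  assumes "finite A" "i \<in> A" "j \<in> A" "i \<noteq> j"
  shows "map_pmf (\<lambda>f. (f i, f j)) (Pi_pmf A d p) = pair_pmf (p i) (p j)"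
proof -
  have "map_pmf (\<lambda>f. (f i, f j)) (Pi_pmf A d p) = map_pmf (\<lambda>f. (f i, f j)) (Pi_pmf {i, j} d p)"
    using assms by (subst Pi_pmf_subset[of A "{i, j}"]) (auto simp: map_pmf_comp o_def)
  also have "\<dots> = map_pmf (\<lambda>f. (f i, f j)) (map_pmf (\<lambda>(y, f). f(i := y)) (pair_pmf (p i) (Pi_pmf {j} d p)))"
    using assms by (subst Pi_pmf_insert) auto
  also have "\<dots> = map_pmf (\<lambda>(y, f). (y, f j)) (pair_pmf (p i) (Pi_pmf {j} d p))"
    using assms by (auto simp: map_pmf_comp o_def case_prod_beta intro!: map_pmf_cong)
  also have "\<dots> = pair_pmf (p i) (map_pmf (\<lambda>f. f j) (Pi_pmf {j} d p))"
    by (simp add: pair_map_pmf2 apsnd_def map_prod_def)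
  also have "map_pmf (\<lambda>f. f j) (Pi_pmf {j} d p) = p j"
    by (subst Pi_pmf_component) auto
  finally show ?thesis .
qed

lemma finite_set_Pi_pmf:
  assumes "finite A" "\<And>i. i \<in> A \<Longrightarrow> finite (set_pmf (p i))"
  shows "finite (set_pmf (Pi_pmf A d p))"
  using assms by (subst set_Pi_pmf) (auto intro!: finite_PiE_dflt)

section \<open>Random superposition codes\<close>

text \<open>A codeword is indexed by \<open>(m, s, r)\<close>: the cloud \<open>m < M\<close>, the key \<open>s < K\<close> and the randomization \<open>r < L\<close>.
  Given its cloud centre \<open>w\<close>, drawn from \<open>P2\<close>, the words of a cloud are independent with law \<open>A w\<close>.\<close>

locale superposition =
  fixes P2 :: "'w pmf" and A :: "'w \<Rightarrow> 'u pmf" and M K L :: nat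
  assumes fin2: "finite (set_pmf P2)" and finA: "\<And>w. finite (set_pmf (A w))"
    and pos: "0 < M" "0 < K" "0 < L"
begin

definition I :: "(nat \<times> nat) set" where "I = {..<K} \<times> {..<L}"
definition T :: "(nat \<times> nat \<times> nat) set" where "T = {..<M} \<times> I"

definition book :: "(nat \<Rightarrow> 'w \<times> (nat \<times> nat \<Rightarrow> 'u)) pmf" where
  "book = Pi_pmf {..<M} undefined (\<lambda>_. joint P2 (\<lambda>w. Pi_pmf I undefined (\<lambda>_. A w)))"

definition cw :: "(nat \<Rightarrow> 'w \<times> (nat \<times> nat \<Rightarrow> 'u)) \<Rightarrow> nat \<times> nat \<times> nat \<Rightarrow> 'u" where
  "cw \<omega> t = snd (\<omega> (fst t)) (snd t)"

lemma finI: "finite I" and finT: "finite T" "T \<noteq> {}" and cardT: "real (card T) = real M * real K * real L"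
  and cardI: "real (card I) = real K * real L"
  using pos by (auto simp: I_def T_def)

section \<open>Marginals of the random codebook\<close>

lemma finite_book: "finite (set_pmf book)"
  unfolding book_def using finI fin2 finA by (auto intro!: finite_set_Pi_pmf finite_imageI)

lemma book_cluster: "m < M \<Longrightarrow> map_pmf (\<lambda>\<omega>. \<omega> m) book = joint P2 (\<lambda>w. Pi_pmf I undefined (\<lambda>_. A w))"
  unfolding book_def by (subst Pi_pmf_component) auto

lemma book_marginal:
  assumes "m < M" "i \<in> I"
  shows "map_pmf (\<lambda>\<omega>. (fst (\<omega> m), cw \<omega> (m, i))) book = joint P2 A"
proof -
  have "map_pmf (\<lambda>\<omega>. (fst (\<omega> m), cw \<omega> (m, i))) book
      = map_pmf (\<lambda>(w, f). (w, f i)) (map_pmf (\<lambda>\<omega>. \<omega> m) book)"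
    by (simp add: map_pmf_comp o_def cw_def case_prod_beta)
  also have "\<dots> = bind_pmf P2 (\<lambda>w. map_pmf (Pair w) (map_pmf (\<lambda>f. f i) (Pi_pmf I undefined (\<lambda>_. A w))))"
    unfolding book_cluster[OF assms(1)] by (simp add: map_calc)
  also have "\<dots> = joint P2 A"
    using assms(2) finI by (simp add: Pi_pmf_component)
  finally show ?thesis .
qed

lemma book_pair_same:
  assumes "m < M" "i \<in> I" "j \<in> I" "i \<noteq> j"
  shows "map_pmf (\<lambda>\<omega>. (fst (\<omega> m), cw \<omega> (m, i), cw \<omega> (m, j))) book = joint P2 (\<lambda>w. pair_pmf (A w) (A w))"
proof -
  have "map_pmf (\<lambda>\<omega>. (fst (\<omega> m), cw \<omega> (m, i), cw \<omega> (m, j))) book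
      = map_pmf (\<lambda>(w, f). (w, f i, f j)) (map_pmf (\<lambda>\<omega>. \<omega> m) book)"
    by (simp add: map_pmf_comp o_def cw_def case_prod_beta)
  also have "\<dots> = bind_pmf P2 (\<lambda>w. map_pmf (Pair w) (map_pmf (\<lambda>f. (f i, f j)) (Pi_pmf I undefined (\<lambda>_. A w))))"
    unfolding book_cluster[OF assms(1)] by (simp add: map_calc)
  also have "\<dots> = joint P2 (\<lambda>w. pair_pmf (A w) (A w))"
    using assms finI by (simp add: Pi_pmf_pair)
  finally show ?thesis .
qed

lemma book_pair_diff:
  assumes "m < M" "m' < M" "m \<noteq> m'" "i \<in> I" "j \<in> I"
  shows "map_pmf (\<lambda>\<omega>. (cw \<omega> (m, i), cw \<omega> (m', j))) book = pair_pmf (bind_pmf P2 A) (bind_pmf P2 A)"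
proof -
  let ?C = "joint P2 (\<lambda>w. Pi_pmf I undefined (\<lambda>_. A w))"
  have "map_pmf (\<lambda>\<omega>. (cw \<omega> (m, i), cw \<omega> (m', j))) book
      = map_pmf (\<lambda>(a, b). (snd a i, snd b j)) (map_pmf (\<lambda>\<omega>. (\<omega> m, \<omega> m')) book)"
    by (simp add: map_pmf_comp o_def cw_def case_prod_beta)
  also have "\<dots> = map_pmf (\<lambda>(a, b). (snd a i, snd b j)) (pair_pmf ?C ?C)"
    using assms unfolding book_def by (subst Pi_pmf_pair) auto
  also have "\<dots> = pair_pmf (map_pmf (\<lambda>a. snd a i) ?C) (map_pmf (\<lambda>a. snd a j) ?C)"
    by (rule map_pair)
  also have "\<dots> = pair_pmf (bind_pmf P2 A) (bind_pmf P2 A)"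
    using assms finI by (simp add: map_calc Pi_pmf_component)
  finally show ?thesis .
qed

lemma book_codeword:
  assumes "t \<in> T" shows "map_pmf (\<lambda>\<omega>. cw \<omega> t) book = bind_pmf P2 A"
proof -
  obtain m i where t: "t = (m, i)" "m < M" "i \<in> I" using assms by (auto simp: T_def)
  have "map_pmf (\<lambda>\<omega>. cw \<omega> t) book = map_pmf snd (map_pmf (\<lambda>\<omega>. (fst (\<omega> m), cw \<omega> (m, i))) book)"
    by (simp add: map_pmf_comp o_def t)
  also have "\<dots> = bind_pmf P2 A"
    unfolding book_marginal[OF t(2,3)] by (simp add: map_calc)
  finally show ?thesis .
qed

lemma codeword_support:
  assumes "\<omega> \<in> set_pmf book" "t \<in> T"
  shows "cw \<omega> t \<in> set_pmf (bind_pmf P2 A)"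
  using book_codeword[OF assms(2)] assms(1) by (metis imageI set_map_pmf)

text \<open>The law of the image under f is the same for every cloud centre. Two words of one cloud,
  though correlated through their centre, therefore have independent images, and all M K L words
  count towards the covering.\<close>

lemma expected_cover_deficit:
  fixes W :: "'v \<Rightarrow> 'y pmf" and f :: "'u \<Rightarrow> 'v"
  assumes f: "\<And>w. map_pmf f (A w) = P" and W: "\<And>v. finite (set_pmf (W v))" and a: "0 \<le> a"
  defines "S \<equiv> \<Union>v\<in>set_pmf P. set_pmf (W v)"
  shows "mean book (\<lambda>\<omega>. \<Sum>y\<in>S. max 0
      (pmf (bind_pmf P W) y - pmf (bind_pmf (pmf_of_set T) (\<lambda>t. W (f (cw \<omega> t)))) y))
    \<le> prob_of (joint P W) {(v, y). pmf (W v) y > a * pmf (bind_pmf P W) y}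
      + sqrt (a / (real M * real K * real L))"
proof -
  have finP: "finite (set_pmf P)" using f finA by (metis finite_imageI set_map_pmf)
  have fP: "map_pmf f (bind_pmf P2 A) = P"
    by (simp add: map_bind_pmf f bind_pmf_const)
  have "pmf (bind_pmf (pmf_of_set T) (\<lambda>t. W (f (cw \<omega> t)))) y = (\<Sum>t\<in>T. pmf (W (f (cw \<omega> t))) y) / real (card T)" for \<omega> y
    using finT by (simp add: pmf_bind integral_pmf_of_set)
  moreover have "mean book (\<lambda>\<omega>. \<Sum>y\<in>S. max 0 (pmf (bind_pmf P W) y
        - (\<Sum>t\<in>T. pmf (W (f (cw \<omega> t))) y) / real (card T)))
      \<le> prob_of (joint P W) {(v, y). pmf (W v) y > a * pmf (bind_pmf P W) y} + sqrt (a / real (card T))"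
  proof (rule soft_covering[where c="\<lambda>t \<omega>. f (cw \<omega> t)"])
    show "map_pmf (\<lambda>\<omega>. f (cw \<omega> t)) book = P" if "t \<in> T" for t
      using arg_cong[OF book_codeword[OF that], of "map_pmf f"] fP by (simp add: map_pmf_comp o_def)
    show "map_pmf (\<lambda>\<omega>. (f (cw \<omega> t), f (cw \<omega> t'))) book = pair_pmf P P"
      if tt: "t \<in> T" "t' \<in> T" "t \<noteq> t'" for t t'
    proof -
      obtain m i where t1: "t = (m, i)" "m < M" "i \<in> I" using tt(1) by (auto simp: T_def)
      obtain m' i' where t2: "t' = (m', i')" "m' < M" "i' \<in> I" using tt(2) by (auto simp: T_def)
      note t = t1 t2
      show ?thesis
      proof (cases "m = m'")
        case True
        have "map_pmf (\<lambda>\<omega>. (f (cw \<omega> t), f (cw \<omega> t'))) book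
            = map_pmf (\<lambda>(w, a, b). (f a, f b)) (map_pmf (\<lambda>\<omega>. (fst (\<omega> m), cw \<omega> (m, i), cw \<omega> (m, i'))) book)"
          using t True by (simp add: map_pmf_comp o_def)
        also have "\<dots> = pair_pmf P P"
          using t True tt
          by (subst book_pair_same) (auto simp: map_calc map_pair f bind_pmf_const)
        finally show ?thesis .
      next
        case False
        have "map_pmf (\<lambda>\<omega>. (f (cw \<omega> t), f (cw \<omega> t'))) book
            = map_pmf (\<lambda>(a, b). (f a, f b)) (map_pmf (\<lambda>\<omega>. (cw \<omega> (m, i), cw \<omega> (m', i'))) book)"
          using t by (simp add: map_pmf_comp o_def)
        also have "\<dots> = pair_pmf P P"
          using t False by (subst book_pair_diff) (auto simp: map_pair fP)
        finally show ?thesis .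
      qed
    qed
  qed (use finT finite_book a finP W in \<open>auto simp: S_def\<close>)
  ultimately show ?thesis by (simp add: cardT)
qed

text \<open>For fixed m and s and a given centre, the L words over r are independent with law
  \<open>A w\<close>, so soft covering applies conditionally with L words. The law approached
  depends on the cloud but not on s, which is the source of secrecy.\<close>

lemma expected_secrecy_deficit:
  fixes Z :: "'u \<Rightarrow> 'z pmf"
  assumes Z: "\<And>u. finite (set_pmf (Z u))" and a: "0 \<le> a" and m: "m < M" and s: "s < K"
  defines "S \<equiv> \<Union>u\<in>set_pmf (bind_pmf P2 A). set_pmf (Z u)"
  shows "mean book (\<lambda>\<omega>. \<Sum>z\<in>S. max 0
      (pmf (bind_pmf (A (fst (\<omega> m))) Z) z - (\<Sum>r<L. pmf (Z (cw \<omega> (m, s, r))) z) / real L))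
    \<le> prob_of (bind_pmf P2 (\<lambda>w. map_pmf (Pair w) (joint (A w) Z)))
        {(w, u, z). pmf (Z u) z > a * pmf (bind_pmf (A w) Z) z} + sqrt (a / real L)"
    (is "?lhs \<le> _")
proof -
  define h where "h w f = (\<Sum>z\<in>S. max 0 (pmf (bind_pmf (A w) Z) z - (\<Sum>r<L. pmf (Z (f (s, r))) z) / real L))"
    for w and f :: "nat \<times> nat \<Rightarrow> 'u"
  let ?p = "\<lambda>w. prob_of (joint (A w) Z) {(u, z). pmf (Z u) z > a * pmf (bind_pmf (A w) Z) z}"
  have finPi: "finite (set_pmf (Pi_pmf I undefined (\<lambda>_. A w)))" for w
    using finI finA by (intro finite_set_Pi_pmf)
  have "?lhs = mean (map_pmf (\<lambda>\<omega>. \<omega> m) book) (\<lambda>(w, f). h w f)"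
    by (simp add: h_def cw_def case_prod_beta)
  also have "\<dots> = mean P2 (\<lambda>w. mean (Pi_pmf I undefined (\<lambda>_. A w)) (h w))"
    unfolding book_cluster[OF m] using fin2 finPi by (subst expectation_joint) auto
  also have "\<dots> \<le> mean P2 (\<lambda>w. ?p w + sqrt (a / real L))"
  proof (rule integral_mono_AE; (unfold AE_measure_pmf_iff)?; (intro integrable_measure_pmf_finite fin2)?)
    show "\<forall>w\<in>set_pmf P2. mean (Pi_pmf I undefined (\<lambda>_. A w)) (h w) \<le> ?p w + sqrt (a / real L)"
    proof
      fix w assume w: "w \<in> set_pmf P2"
      have "mean (Pi_pmf I undefined (\<lambda>_. A w)) (\<lambda>f. \<Sum>z\<in>S. max 0 (pmf (bind_pmf (A w) Z) z
            - (\<Sum>r\<in>{..<L}. pmf (Z (f (s, r))) z) / real (card {..<L}))) \<le> ?p w + sqrt (a / real (card {..<L}))"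
      proof (rule soft_covering[where c="\<lambda>r f. f (s, r)"])
        show "map_pmf (\<lambda>f. f (s, t)) (Pi_pmf I undefined (\<lambda>_. A w)) = A w" if "t \<in> {..<L}" for t
          using that s finI by (subst Pi_pmf_component) (auto simp: I_def)
        show "map_pmf (\<lambda>f. (f (s, t), f (s, t'))) (Pi_pmf I undefined (\<lambda>_. A w)) = pair_pmf (A w) (A w)"
          if "t \<in> {..<L}" "t' \<in> {..<L}" "t \<noteq> t'" for t t'
          using that s finI by (subst Pi_pmf_pair) (auto simp: I_def)
      qed (use finPi a fin2 finA Z w pos in \<open>auto simp: S_def\<close>)
      then show "mean (Pi_pmf I undefined (\<lambda>_. A w)) (h w) \<le> ?p w + sqrt (a / real L)"
        by (simp add: h_def[abs_def])
    qed
  qed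
  also have "\<dots> = mean P2 ?p + sqrt (a / real L)"
    by (subst Bochner_Integration.integral_add) (auto intro: integrable_measure_pmf_finite fin2)
  also have "mean P2 ?p = prob_of (bind_pmf P2 (\<lambda>w. map_pmf (Pair w) (joint (A w) Z)))
        {(w, u, z). pmf (Z u) z > a * pmf (bind_pmf (A w) Z) z}"
    by (simp add: prob_bind_pmf[of P2] vimage_def)
  finally show ?thesis .
qed

text \<open>Two likelihood-ratio tests: \<open>c1\<close> compares with the overall output law, to
  exclude words of other clouds; \<open>c2\<close> compares with the output law of the word's own
  cloud, to exclude its other words.\<close>

definition typical :: "('u \<Rightarrow> 'o pmf) \<Rightarrow> real \<Rightarrow> real \<Rightarrow> (nat \<Rightarrow> 'w \<times> (nat \<times> nat \<Rightarrow> 'u)) \<Rightarrow> nat \<times> nat \<times> nat \<Rightarrow> 'o \<Rightarrow> bool" where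
  "typical D c1 c2 \<omega> t y \<longleftrightarrow> c1 * pmf (bind_pmf (bind_pmf P2 A) D) y \<le> pmf (D (cw \<omega> t)) y
     \<and> c2 * pmf (bind_pmf (A (fst (\<omega> (fst t)))) D) y \<le> pmf (D (cw \<omega> t)) y"

text \<open>A union bound on the decoding error, written without a decoder so that it can be
  averaged over the codebook before a decoder is chosen. The last sum may use the centre of t
  because t' lies in the same cloud.\<close>

definition confusion :: "('u \<Rightarrow> 'o pmf) \<Rightarrow> real \<Rightarrow> real \<Rightarrow> (nat \<Rightarrow> 'w \<times> (nat \<times> nat \<Rightarrow> 'u)) \<Rightarrow> nat \<times> nat \<times> nat \<Rightarrow> real" where
  "confusion D c1 c2 \<omega> t = prob_of (D (cw \<omega> t)) {y. \<not> typical D c1 c2 \<omega> t y}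
     + (\<Sum>t'\<in>{t' \<in> T. fst t' \<noteq> fst t}. prob_of (D (cw \<omega> t))
          {y. c1 * pmf (bind_pmf (bind_pmf P2 A) D) y \<le> pmf (D (cw \<omega> t')) y})
     + (\<Sum>t'\<in>{t' \<in> T. fst t' = fst t \<and> t' \<noteq> t}. prob_of (D (cw \<omega> t))
          {y. c2 * pmf (bind_pmf (A (fst (\<omega> (fst t)))) D) y \<le> pmf (D (cw \<omega> t')) y})"

lemma confusion_nonneg: "0 \<le> confusion D c1 c2 \<omega> t"
  unfolding confusion_def by (intro add_nonneg_nonneg sum_nonneg) auto

text \<open>The decoder accepts any typical index. If the true one is typical, an error forces a
  wrong index to pass one of the two tests. Only the key component is returned; it stays below K on
  every input because it becomes the key itself.\<close>

lemma typical_decoder: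
  obtains dec where "\<And>t. t \<in> T \<Longrightarrow> prob_of (D (cw \<omega> t)) {y. dec y \<noteq> fst (snd t)} \<le> confusion D c1 c2 \<omega> t"
    and "\<And>y. dec y < K"
proof
  define cand where "cand y = (SOME t. t \<in> T \<and> typical D c1 c2 \<omega> t y)" for y
  \<comment> \<open>The default 0 keeps the value below K when no index is typical.\<close>
  define dec where "dec y = (if \<exists>t\<in>T. typical D c1 c2 \<omega> t y then fst (snd (cand y)) else 0)" for y
  have cand: "cand y \<in> T \<and> typical D c1 c2 \<omega> (cand y) y" if "\<exists>t\<in>T. typical D c1 c2 \<omega> t y" for y
    unfolding cand_def by (rule someI_ex) (use that in blast)
  show "dec y < K" for y
  proof (cases "\<exists>t\<in>T. typical D c1 c2 \<omega> t y")
    case True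
    then show ?thesis using cand[OF True] unfolding dec_def by (auto simp: T_def I_def)
  qed (use pos in \<open>auto simp: dec_def\<close>)
  fix t assume t: "t \<in> T"
  let ?p = "prob_of (D (cw \<omega> t))"
  let ?A = "{y. \<not> typical D c1 c2 \<omega> t y}"
  let ?B = "\<lambda>t'. {y. c1 * pmf (bind_pmf (bind_pmf P2 A) D) y \<le> pmf (D (cw \<omega> t')) y}"
  let ?C = "\<lambda>t'. {y. c2 * pmf (bind_pmf (A (fst (\<omega> (fst t)))) D) y \<le> pmf (D (cw \<omega> t')) y}"
  let ?I = "{t' \<in> T. fst t' \<noteq> fst t}" and ?J = "{t' \<in> T. fst t' = fst t \<and> t' \<noteq> t}"
  have "{y. dec y \<noteq> fst (snd t)} \<subseteq> ?A \<union> ((\<Union>t'\<in>?I. ?B t') \<union> (\<Union>t'\<in>?J. ?C t'))"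
  proof (intro subsetI)
    fix y assume "y \<in> {y. dec y \<noteq> fst (snd t)}"
    then have ne: "dec y \<noteq> fst (snd t)" by simp
    show "y \<in> ?A \<union> ((\<Union>t'\<in>?I. ?B t') \<union> (\<Union>t'\<in>?J. ?C t'))"
    proof (cases "typical D c1 c2 \<omega> t y")
      case True
      then have ex: "\<exists>t\<in>T. typical D c1 c2 \<omega> t y" using t by blast
      note c = cand[OF ex]
      have "cand y \<noteq> t" using ne ex by (auto simp: dec_def)
      \<comment> \<open>A wrong candidate from another cloud passes the first test; one from the
        same cloud shares the centre of t and passes the second.\<close>
      then have "cand y \<in> ?I \<and> y \<in> ?B (cand y) \<or> cand y \<in> ?J \<and> y \<in> ?C (cand y)"
        using c unfolding typical_def by (cases "fst (cand y) = fst t") auto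
      then show ?thesis by blast
    qed simp
  qed
  then have "?p {y. dec y \<noteq> fst (snd t)} \<le> ?p (?A \<union> ((\<Union>t'\<in>?I. ?B t') \<union> (\<Union>t'\<in>?J. ?C t')))"
    by (intro measure_pmf.finite_measure_mono) auto
  also have "\<dots> \<le> ?p ?A + (?p (\<Union>t'\<in>?I. ?B t') + ?p (\<Union>t'\<in>?J. ?C t'))"
    by (intro order_trans[OF prob_Un_le] add_left_mono prob_Un_le)
  also have "\<dots> \<le> ?p ?A + ((\<Sum>t'\<in>?I. ?p (?B t')) + (\<Sum>t'\<in>?J. ?p (?C t')))"
    using finT(1) by (intro add_left_mono add_mono prob_le_sum) auto
  finally show "?p {y. dec y \<noteq> fst (snd t)} \<le> confusion D c1 c2 \<omega> t"
    by (simp add: confusion_def)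
qed

text \<open>A word of another cloud is independent of the output, and a word of the same cloud is so
  given the centre. By \<open>prob_density_ge\<close> they pass their tests with chance at most 1 /
  c1 and 1 / c2, and there are at most M K L and K L of them.\<close>

lemma expected_confusion:
  fixes D :: "'u \<Rightarrow> 'o pmf"
  assumes D: "\<And>u. finite (set_pmf (D u))" and c: "0 < c1" "0 < c2" and t: "t \<in> T"
  shows "mean book (\<lambda>\<omega>. confusion D c1 c2 \<omega> t)
    \<le> prob_of (bind_pmf P2 (\<lambda>w. map_pmf (Pair w) (joint (A w) D)))
        {(w, u, y). \<not> (c1 * pmf (bind_pmf (bind_pmf P2 A) D) y \<le> pmf (D u) y
           \<and> c2 * pmf (bind_pmf (A w) D) y \<le> pmf (D u) y)}
      + real M * real K * real L / c1 + real K * real L / c2"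
proof -
  obtain m i where mi: "t = (m, i)" "m < M" "i \<in> I" using t by (auto simp: T_def)
  note intg = integrable_measure_pmf_finite[OF finite_book]
  let ?q = "bind_pmf (bind_pmf P2 A) D"
  let ?S = "\<Union>u\<in>set_pmf (bind_pmf P2 A). set_pmf (D u)"
  have finS: "finite ?S" using fin2 finA D by auto
  have 1: "mean book (\<lambda>\<omega>. prob_of (D (cw \<omega> t)) {y. \<not> typical D c1 c2 \<omega> t y})
      = prob_of (bind_pmf P2 (\<lambda>w. map_pmf (Pair w) (joint (A w) D)))
        {(w, u, y). \<not> (c1 * pmf ?q y \<le> pmf (D u) y \<and> c2 * pmf (bind_pmf (A w) D) y \<le> pmf (D u) y)}"
      (is "?l = _")
  proof -
    have "?l = mean (map_pmf (\<lambda>\<omega>. (fst (\<omega> m), cw \<omega> (m, i))) book)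
        (\<lambda>(w, u). prob_of (D u) {y. \<not> (c1 * pmf ?q y \<le> pmf (D u) y \<and> c2 * pmf (bind_pmf (A w) D) y \<le> pmf (D u) y)})"
      by (simp add: typical_def mi)
    also have "\<dots> = mean P2 (\<lambda>w. mean (A w)
        (\<lambda>u. prob_of (D u) {y. \<not> (c1 * pmf ?q y \<le> pmf (D u) y \<and> c2 * pmf (bind_pmf (A w) D) y \<le> pmf (D u) y)}))"
      unfolding book_marginal[OF mi(2,3)] using fin2 finA by (subst expectation_joint) auto
    finally show ?thesis
      by (simp add: prob_bind_pmf vimage_def)
  qed
  have 2: "mean book (\<lambda>\<omega>. prob_of (D (cw \<omega> t)) {y. c1 * pmf ?q y \<le> pmf (D (cw \<omega> t')) y}) \<le> 1 / c1"
    (is "?l \<le> _") if t': "t' \<in> {t' \<in> T. fst t' \<noteq> fst t}" for t'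
  proof -
    obtain m' i' where mi': "t' = (m', i')" "m' < M" "i' \<in> I" "m' \<noteq> m" using t' mi by (auto simp: T_def)
    have "?l = mean (map_pmf (\<lambda>\<omega>. (cw \<omega> (m', i'), cw \<omega> (m, i))) book)
        (\<lambda>(u', u). prob_of (D u) {y. c1 * pmf ?q y \<le> pmf (D u') y})"
      by (simp add: mi mi')
    also have "\<dots> = mean (bind_pmf P2 A) (\<lambda>u'. mean (bind_pmf P2 A)
        (\<lambda>u. prob_of (D u) {y. c1 * pmf ?q y \<le> pmf (D u') y}))"
      using fin2 finA mi mi' by (subst book_pair_diff) (auto simp: expectation_pair_finite)
    also have "\<dots> = mean (bind_pmf P2 A) (\<lambda>u'. prob_of ?q {y. c1 * pmf ?q y \<le> pmf (D u') y})"
      by (subst prob_bind_pmf[of "bind_pmf P2 A"]) simp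
    also have "\<dots> \<le> mean (bind_pmf P2 A) (\<lambda>u'. 1 / c1)"
      using fin2 finA c
      by (intro integral_mono integrable_measure_pmf_finite prob_density_ge[OF finS]) auto
    finally show ?thesis by simp
  qed
  have 3: "mean book (\<lambda>\<omega>. prob_of (D (cw \<omega> t))
      {y. c2 * pmf (bind_pmf (A (fst (\<omega> (fst t)))) D) y \<le> pmf (D (cw \<omega> t')) y}) \<le> 1 / c2"
    (is "?l \<le> _") if t': "t' \<in> {t' \<in> T. fst t' = fst t \<and> t' \<noteq> t}" for t'
  proof -
    obtain i' where mi': "t' = (m, i')" "i' \<in> I" "i' \<noteq> i"
      using t' mi by (intro that[of "snd t'"]) (auto simp: T_def)
    have B: "prob_of (bind_pmf (A w) D) {y. c2 * pmf (bind_pmf (A w) D) y \<le> pmf (D u') y} \<le> 1 / c2" for w u'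
      using finA D c by (intro prob_density_ge[of "\<Union>u\<in>set_pmf (A w). set_pmf (D u)"]) auto
    let ?g = "\<lambda>w u' u. prob_of (D u) {y. c2 * pmf (bind_pmf (A w) D) y \<le> pmf (D u') y}"
    have "?l = mean (map_pmf (\<lambda>\<omega>. (fst (\<omega> m), cw \<omega> (m, i'), cw \<omega> (m, i))) book)
        (\<lambda>(w, u', u). ?g w u' u)"
      by (simp add: mi mi')
    also have "\<dots> = mean P2 (\<lambda>w. mean (A w) (\<lambda>u'. mean (A w) (?g w u')))"
      using fin2 finA mi mi' by (subst book_pair_same) (auto simp: expectation_joint expectation_pair_finite)
    also have "\<dots> = mean P2 (\<lambda>w. mean (A w) (\<lambda>u'.
        prob_of (bind_pmf (A w) D) {y. c2 * pmf (bind_pmf (A w) D) y \<le> pmf (D u') y}))"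
      by (intro Bochner_Integration.integral_cong refl prob_bind_pmf[symmetric])
    also have "\<dots> \<le> mean P2 (\<lambda>w. mean (A w) (\<lambda>u'. 1 / c2))"
      by (intro integral_mono integrable_measure_pmf_finite fin2 finA B)
    finally show ?thesis by simp
  qed
  have card1: "real (card {t' \<in> T. fst t' \<noteq> fst t}) \<le> real M * real K * real L"
    unfolding cardT[symmetric] by (intro of_nat_mono card_mono finT) auto
  have "{t' \<in> T. fst t' = fst t \<and> t' \<noteq> t} \<subseteq> Pair m ` I" using mi by (auto simp: T_def)
  from card_mono[OF _ this] have card2: "real (card {t' \<in> T. fst t' = fst t \<and> t' \<noteq> t}) \<le> real K * real L"
    unfolding cardI[symmetric] using finI card_image_le[OF finI, of "Pair m"] by simp
  have "mean book (\<lambda>\<omega>. confusion D c1 c2 \<omega> t)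
      = mean book (\<lambda>\<omega>. prob_of (D (cw \<omega> t)) {y. \<not> typical D c1 c2 \<omega> t y})
      + (\<Sum>t'\<in>{t' \<in> T. fst t' \<noteq> fst t}. mean book (\<lambda>\<omega>. prob_of (D (cw \<omega> t))
          {y. c1 * pmf ?q y \<le> pmf (D (cw \<omega> t')) y}))
      + (\<Sum>t'\<in>{t' \<in> T. fst t' = fst t \<and> t' \<noteq> t}. mean book (\<lambda>\<omega>. prob_of (D (cw \<omega> t))
          {y. c2 * pmf (bind_pmf (A (fst (\<omega> (fst t)))) D) y \<le> pmf (D (cw \<omega> t')) y}))"
    unfolding confusion_def
    by (simp add: Bochner_Integration.integral_sum Bochner_Integration.integral_add intg)
  also have "\<dots> \<le> prob_of (bind_pmf P2 (\<lambda>w. map_pmf (Pair w) (joint (A w) D)))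
        {(w, u, y). \<not> (c1 * pmf ?q y \<le> pmf (D u) y \<and> c2 * pmf (bind_pmf (A w) D) y \<le> pmf (D u) y)}
      + real M * real K * real L / c1 + real K * real L / c2"
  proof (intro add_mono)
    show "(\<Sum>t'\<in>{t' \<in> T. fst t' \<noteq> fst t}. mean book (\<lambda>\<omega>. prob_of (D (cw \<omega> t))
          {y. c1 * pmf ?q y \<le> pmf (D (cw \<omega> t')) y})) \<le> real M * real K * real L / c1"
      using card1 c by (intro order_trans[OF sum_bounded_above[OF 2]]) (auto simp: divide_right_mono)
    show "(\<Sum>t'\<in>{t' \<in> T. fst t' = fst t \<and> t' \<noteq> t}. mean book (\<lambda>\<omega>. prob_of (D (cw \<omega> t))
          {y. c2 * pmf (bind_pmf (A (fst (\<omega> (fst t)))) D) y \<le> pmf (D (cw \<omega> t')) y})) \<le> real K * real L / c2"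
      using card2 c by (intro order_trans[OF sum_bounded_above[OF 3]]) (auto simp: divide_right_mono)
  qed (use 1 in simp)
  finally show ?thesis .
qed

text \<open>By convexity of the positive part, the deficit of the mixture over m is at most the
  average of the deficits for the single pairs (m, s). The average of the cloud output laws over m
  is the same for all s, hence the product form.\<close>

lemma secrecy_deficit_near:
  fixes Z :: "'u \<Rightarrow> 'z pmf"
  assumes Z: "\<And>u. finite (set_pmf (Z u))" and \<omega>: "\<omega> \<in> set_pmf book"
  defines "S \<equiv> \<Union>u\<in>set_pmf (bind_pmf P2 A). set_pmf (Z u)"
  shows "near ((\<Sum>m<M. \<Sum>s<K. \<Sum>z\<in>S. max 0 (pmf (bind_pmf (A (fst (\<omega> m))) Z) z
        - (\<Sum>r<L. pmf (Z (cw \<omega> (m, s, r))) z) / real L)) / (real M * real K))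
    (pair_pmf (pmf_of_set {..<K}) (bind_pmf (pmf_of_set {..<M}) (\<lambda>m. bind_pmf (A (fst (\<omega> m))) Z)))
    (bind_pmf (pmf_of_set T) (\<lambda>t. map_pmf (Pair (fst (snd t))) (Z (cw \<omega> t))))"
    (is "near (_ / _) ?R ?P")
proof (rule near_by_deficit)
  have w: "fst (\<omega> m) \<in> set_pmf P2" if "m < M" for m
  proof -
    have "\<omega> m \<in> set_pmf (joint P2 (\<lambda>w. Pi_pmf I undefined (\<lambda>_. A w)))"
      using \<omega> by (subst book_cluster[OF that, symmetric]) auto
    then show ?thesis by auto
  qed
  show "finite ({..<K} \<times> S)" unfolding S_def using fin2 finA Z by auto
  have ne: "{..<K} \<noteq> {}" "{..<M} \<noteq> {}" using pos by auto
  show "set_pmf ?R \<subseteq> {..<K} \<times> S"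
    using w ne by (auto simp: S_def)
  define e where "e m s z = pmf (bind_pmf (A (fst (\<omega> m))) Z) z - (\<Sum>r<L. pmf (Z (cw \<omega> (m, s, r))) z) / real L" for m s z
  have R: "pmf ?R (s, z) = (\<Sum>m<M. pmf (bind_pmf (A (fst (\<omega> m))) Z) z) / (real M * real K)" if "s < K" for s z
    using ne that pos by (simp add: pmf_pair pmf_bind[of "pmf_of_set _"] integral_pmf_of_set)
  have P: "pmf ?P (s, z) = (\<Sum>m<M. \<Sum>r<L. pmf (Z (cw \<omega> (m, s, r))) z) / (real M * real K * real L)" if s: "s < K" for s z
  proof -
    have Pr: "pmf (map_pmf (Pair s') X) (s, z) = (if s' = s then pmf X z else 0)" for s' and X :: "'z pmf"
    proof (cases "s' = s")
      case True
      then show ?thesis by (simp add: pmf_map_inj' inj_on_def)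
    next
      case False
      then have "Pair s' -` {(s, z)} = {}" by auto
      then show ?thesis using False by (simp add: pmf_map)
    qed
    have "pmf ?P (s, z) = (\<Sum>t\<in>T. if fst (snd t) = s then pmf (Z (cw \<omega> t)) z else 0) / real (card T)"
      using finT by (simp add: pmf_bind integral_pmf_of_set Pr)
    also have "(\<Sum>t\<in>T. if fst (snd t) = s then pmf (Z (cw \<omega> t)) z else 0)
        = (\<Sum>m<M. \<Sum>s'<K. \<Sum>r<L. if s' = s then pmf (Z (cw \<omega> (m, s', r))) z else 0)"
      unfolding T_def I_def sum.cartesian_product by (intro sum.cong refl) auto
    also have "\<dots> = (\<Sum>m<M. \<Sum>s'<K. if s' = s then \<Sum>r<L. pmf (Z (cw \<omega> (m, s, r))) z else 0)"
      by (intro sum.cong refl) auto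
    also have "\<dots> = (\<Sum>m<M. \<Sum>r<L. pmf (Z (cw \<omega> (m, s, r))) z)"
      using s by simp
    finally show ?thesis by (simp add: cardT)
  qed
  have d: "max 0 (pmf ?R (s, z) - pmf ?P (s, z)) \<le> (\<Sum>m<M. max 0 (e m s z)) / (real M * real K)" if "s < K" for s z
  proof -
    have "pmf ?R (s, z) - pmf ?P (s, z) = (\<Sum>m<M. e m s z) / (real M * real K)"
      unfolding R[OF that] P[OF that] e_def
      using pos by (simp add: sum_subtractf sum_divide_distrib diff_divide_distrib field_simps)
    also have "\<dots> \<le> (\<Sum>m<M. max 0 (e m s z)) / (real M * real K)"
      by (intro divide_right_mono sum_mono) auto
    finally show ?thesis using sum_nonneg[of "{..<M}" "\<lambda>m. max 0 (e m s z)"] by simp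
  qed
  have "(\<Sum>x\<in>{..<K} \<times> S. max 0 (pmf ?R x - pmf ?P x))
      = (\<Sum>s<K. \<Sum>z\<in>S. max 0 (pmf ?R (s, z) - pmf ?P (s, z)))"
    by (simp add: sum.cartesian_product case_prod_beta)
  also have "\<dots> \<le> (\<Sum>s<K. \<Sum>z\<in>S. (\<Sum>m<M. max 0 (e m s z)) / (real M * real K))"
    by (intro sum_mono d) auto
  also have "\<dots> = (\<Sum>m<M. \<Sum>s<K. \<Sum>z\<in>S. max 0 (e m s z)) / (real M * real K)"
    unfolding sum_divide_distrib[symmetric]
    by (subst (2) sum.swap, subst sum.swap) simp
  finally show "(\<Sum>x\<in>{..<K} \<times> S. max 0 (pmf ?R x - pmf ?P x))
    \<le> (\<Sum>m<M. \<Sum>s<K. \<Sum>z\<in>S. max 0 (pmf (bind_pmf (A (fst (\<omega> m))) Z) z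
        - (\<Sum>r<L. pmf (Z (cw \<omega> (m, s, r))) z) / real L)) / (real M * real K)"
    unfolding e_def .
qed

text \<open>Covering, decoding and secrecy are bounded in expectation over the same codebook, and
  \<open>\<beta>\<close> is the sum of the three bounds. Some codebook keeps the sum of the three
  quantities below it, hence each of them. The claim on the support of \<open>u\<close> later yields
  the block lengths of the codewords.\<close>

theorem superposition_code_exists:
  fixes W :: "'v \<Rightarrow> 'y pmf" and f :: "'u \<Rightarrow> 'v" and D :: "'u \<Rightarrow> 'o pmf" and Z :: "'u \<Rightarrow> 'z pmf"
  assumes f: "\<And>w. map_pmf f (A w) = P"
    and W: "\<And>v. finite (set_pmf (W v))" and D: "\<And>u. finite (set_pmf (D u))" and Z: "\<And>u. finite (set_pmf (Z u))"
    and a: "0 \<le> a1" "0 \<le> a3" and c: "0 < c1" "0 < c2"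
  defines "\<beta> \<equiv> prob_of (joint P W) {(v, y). pmf (W v) y > a1 * pmf (bind_pmf P W) y}
      + sqrt (a1 / (real M * real K * real L))
      + prob_of (bind_pmf P2 (\<lambda>w. map_pmf (Pair w) (joint (A w) D)))
        {(w, u, y). \<not> (c1 * pmf (bind_pmf (bind_pmf P2 A) D) y \<le> pmf (D u) y
           \<and> c2 * pmf (bind_pmf (A w) D) y \<le> pmf (D u) y)}
      + real M * real K * real L / c1 + real K * real L / c2
      + prob_of (bind_pmf P2 (\<lambda>w. map_pmf (Pair w) (joint (A w) Z)))
        {(w, u, z). pmf (Z u) z > a3 * pmf (bind_pmf (A w) Z) z} + sqrt (a3 / real L)"
  obtains u dec Q where "\<And>t. t \<in> T \<Longrightarrow> u t \<in> set_pmf (bind_pmf P2 A)"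
    and "\<And>y. dec y < K"
    and "near \<beta> (bind_pmf P W) (bind_pmf (pmf_of_set T) (\<lambda>t. W (f (u t))))"
    and "prob_of (joint (pmf_of_set T) (\<lambda>t. D (u t))) {(t, y). dec y \<noteq> fst (snd t)} \<le> \<beta>"
    and "near \<beta> (bind_pmf (pmf_of_set T) (\<lambda>t. map_pmf (Pair (fst (snd t))) (Z (u t))))
      (pair_pmf (pmf_of_set {..<K}) Q)"
proof -
  note int = integrable_measure_pmf_finite[OF finite_book]
  define S1 where "S1 = (\<Union>v\<in>set_pmf P. set_pmf (W v))"
  define S3 where "S3 = (\<Union>u\<in>set_pmf (bind_pmf P2 A). set_pmf (Z u))"
  define cov where "cov \<omega> = (\<Sum>y\<in>S1. max 0
      (pmf (bind_pmf P W) y - pmf (bind_pmf (pmf_of_set T) (\<lambda>t. W (f (cw \<omega> t)))) y))" for \<omega>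
  define err where "err \<omega> = (\<Sum>t\<in>T. confusion D c1 c2 \<omega> t) / real (card T)" for \<omega>
  define leak where "leak \<omega> m s = (\<Sum>z\<in>S3. max 0 (pmf (bind_pmf (A (fst (\<omega> m))) Z) z
        - (\<Sum>r<L. pmf (Z (cw \<omega> (m, s, r))) z) / real L))" for \<omega> m s
  define sec where "sec \<omega> = (\<Sum>m<M. \<Sum>s<K. leak \<omega> m s) / (real M * real K)" for \<omega>
  define \<beta>1 where "\<beta>1 = prob_of (joint P W) {(v, y). pmf (W v) y > a1 * pmf (bind_pmf P W) y}
      + sqrt (a1 / (real M * real K * real L))"
  define \<beta>2 where "\<beta>2 = prob_of (bind_pmf P2 (\<lambda>w. map_pmf (Pair w) (joint (A w) D)))
        {(w, u, y). \<not> (c1 * pmf (bind_pmf (bind_pmf P2 A) D) y \<le> pmf (D u) y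
           \<and> c2 * pmf (bind_pmf (A w) D) y \<le> pmf (D u) y)}
      + real M * real K * real L / c1 + real K * real L / c2"
  define \<beta>3 where "\<beta>3 = prob_of (bind_pmf P2 (\<lambda>w. map_pmf (Pair w) (joint (A w) Z)))
        {(w, u, z). pmf (Z u) z > a3 * pmf (bind_pmf (A w) Z) z} + sqrt (a3 / real L)"
  have cT: "real (card T) > 0" using finT by (simp add: card_gt_0_iff)
  have "mean book cov \<le> \<beta>1"
    unfolding cov_def[abs_def] \<beta>1_def S1_def by (rule expected_cover_deficit[OF f W a(1)])
  moreover have "mean book err \<le> \<beta>2"
  proof -
    have "mean book err
        = (\<Sum>t\<in>T. mean book (\<lambda>\<omega>. confusion D c1 c2 \<omega> t)) / real (card T)"
      unfolding err_def[abs_def] by (simp add: Bochner_Integration.integral_sum int)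
    also have "\<dots> \<le> (\<Sum>t\<in>T. \<beta>2) / real (card T)"
      unfolding \<beta>2_def by (intro divide_right_mono sum_mono expected_confusion D c) auto
    finally show ?thesis using cT by simp
  qed
  moreover have "mean book sec \<le> \<beta>3"
  proof -
    have "mean book sec
        = (\<Sum>m<M. \<Sum>s<K. mean book (\<lambda>\<omega>. leak \<omega> m s)) / (real M * real K)"
      unfolding sec_def[abs_def] by (simp add: Bochner_Integration.integral_sum int)
    also have "\<dots> \<le> (\<Sum>m<M. \<Sum>s<K. \<beta>3) / (real M * real K)"
      unfolding \<beta>3_def leak_def S3_def
      by (intro divide_right_mono sum_mono expected_secrecy_deficit Z a) auto
    finally show ?thesis using pos by simp
  qed
  moreover have "mean book (\<lambda>\<omega>. cov \<omega> + err \<omega> + sec \<omega>)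
      = mean book cov + mean book err + mean book sec"
    by (subst Bochner_Integration.integral_add, rule int, rule int, subst Bochner_Integration.integral_add, rule int, rule int, rule refl)
  moreover have "\<beta> = \<beta>1 + \<beta>2 + \<beta>3"
    unfolding \<beta>_def \<beta>1_def \<beta>2_def \<beta>3_def by (simp only: add.assoc)
  ultimately have "mean book (\<lambda>\<omega>. cov \<omega> + err \<omega> + sec \<omega>) \<le> \<beta>"
    by linarith
  moreover have "\<exists>\<omega>\<in>set_pmf book. cov \<omega> + err \<omega> + sec \<omega> \<le> mean book (\<lambda>\<omega>. cov \<omega> + err \<omega> + sec \<omega>)"
  proof (rule ccontr)
    let ?e = "mean book (\<lambda>\<omega>. cov \<omega> + err \<omega> + sec \<omega>)"
    assume "\<not> ?thesis"
    then have lt: "?e < cov \<omega> + err \<omega> + sec \<omega>" if "\<omega> \<in> set_pmf book" for \<omega> using that by (auto simp: not_le)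
    have "0 < (\<Sum>\<omega>\<in>set_pmf book. pmf book \<omega> * (cov \<omega> + err \<omega> + sec \<omega> - ?e))"
      using lt finite_book by (intro sum_pos) (auto simp: pmf_positive set_pmf_not_empty)
    also have "\<dots> = mean book (\<lambda>\<omega>. cov \<omega> + err \<omega> + sec \<omega> - ?e)"
      by (subst integral_measure_pmf[OF finite_book]) (simp_all only: real_scaleR_def)
    also have "\<dots> = 0" by (subst Bochner_Integration.integral_diff, rule int, rule int, simp)
    finally show False by simp
  qed
  ultimately obtain \<omega> where \<omega>: "\<omega> \<in> set_pmf book" and le: "cov \<omega> + err \<omega> + sec \<omega> \<le> \<beta>"
    by (meson order_trans)
  have nn: "0 \<le> cov \<omega>" "0 \<le> err \<omega>" "0 \<le> sec \<omega>"
    unfolding cov_def err_def sec_def leak_def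
    by (auto intro!: divide_nonneg_nonneg sum_nonneg confusion_nonneg)
  obtain dec where dec: "\<And>t. t \<in> T \<Longrightarrow> prob_of (D (cw \<omega> t)) {y. dec y \<noteq> fst (snd t)} \<le> confusion D c1 c2 \<omega> t"
    and decK: "\<And>y. dec y < K"
    by (rule typical_decoder[of D \<omega> c1 c2], rule that)
  show thesis
  proof (rule that[of "cw \<omega>" dec])
    show "cw \<omega> t \<in> set_pmf (bind_pmf P2 A)" if "t \<in> T" for t
      by (rule codeword_support[OF \<omega> that])
    have "finite (set_pmf P)" using finite_imageI[OF finA, of f undefined] f[of undefined] by (metis set_map_pmf)
    show "near \<beta> (bind_pmf P W) (bind_pmf (pmf_of_set T) (\<lambda>t. W (f (cw \<omega> t))))"
    proof (intro near_by_deficit)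
      show "set_pmf (bind_pmf P W) \<subseteq> S1" by (simp add: S1_def)
      show "finite S1" unfolding S1_def using W \<open>finite (set_pmf P)\<close> by blast
    qed (use le nn cov_def[of \<omega>] in linarith)
    have "prob_of (joint (pmf_of_set T) (\<lambda>t. D (cw \<omega> t))) {(t, y). dec y \<noteq> fst (snd t)}
        = (\<Sum>t\<in>T. prob_of (D (cw \<omega> t)) {y. dec y \<noteq> fst (snd t)}) / real (card T)"
      using finT by (simp add: prob_bind_pmf integral_pmf_of_set vimage_def)
    also have "\<dots> \<le> err \<omega>" unfolding err_def by (intro divide_right_mono sum_mono dec) auto
    finally show "prob_of (joint (pmf_of_set T) (\<lambda>t. D (cw \<omega> t))) {(t, y). dec y \<noteq> fst (snd t)} \<le> \<beta>"
      using le nn by simp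
    have "near (sec \<omega>) (pair_pmf (pmf_of_set {..<K}) (bind_pmf (pmf_of_set {..<M}) (\<lambda>m. bind_pmf (A (fst (\<omega> m))) Z)))
        (bind_pmf (pmf_of_set T) (\<lambda>t. map_pmf (Pair (fst (snd t))) (Z (cw \<omega> t))))"
      unfolding sec_def leak_def S3_def by (rule secrecy_deficit_near[OF Z \<omega>])
    from near_sym[OF this] show "near \<beta> (bind_pmf (pmf_of_set T) (\<lambda>t. map_pmf (Pair (fst (snd t))) (Z (cw \<omega> t))))
      (pair_pmf (pmf_of_set {..<K}) (bind_pmf (pmf_of_set {..<M}) (\<lambda>m. bind_pmf (A (fst (\<omega> m))) Z)))"
      by (rule near_mono) (use le nn in linarith)
  qed (rule decK)
qed

end

section \<open>The protocol of a code\<close>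

lemma pair_bind_pmf:
  "pair_pmf (bind_pmf A f) (bind_pmf B g) = bind_pmf A (\<lambda>a. bind_pmf B (\<lambda>b. pair_pmf (f a) (g b)))"
  unfolding pair_pmf_def bind_assoc_pmf
  by (intro bind_pmf_cong refl) (subst bind_commute_pmf, rule refl)

text \<open>A guess outside \<open>{..<K}\<close> is always wrong, so a best guess exists within
  this finite set.\<close>

lemma best_guess_exists:
  fixes g :: "'a \<Rightarrow> nat"
  assumes "\<And>a. g a < K"
  shows "\<exists>s0<K. \<forall>s. prob_of q {a. g a \<noteq> s0} \<le> prob_of q {a. g a \<noteq> s}"
proof -
  let ?e = "\<lambda>s. prob_of q {a. g a \<noteq> s}"
  have ne: "{..<K} \<noteq> {}" using assms[of undefined] by auto
  obtain s0 where s0: "s0 \<in> {..<K}" "\<And>s. s \<in> {..<K} \<Longrightarrow> ?e s0 \<le> ?e s"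
    using ex_min_if_finite[of "?e ` {..<K}"] ne by (force simp: not_less)
  have "?e s0 \<le> ?e s" for s
  proof (cases "s < K")
    case False
    then have "{a. g a \<noteq> s} = UNIV" using assms by auto
    then show ?thesis by simp
  qed (use s0 in auto)
  then show ?thesis using s0 by auto
qed

lemma run_two_rounds:
  "execution Wf Wb \<lparr>rounds = [Forward n (\<lambda>_. PX), Backward m (\<lambda>b. G (map projr b))], out_alice = oa, out_bob = ob, key_by_alice = k\<rparr>
    = bind_pmf PX (\<lambda>xs. bind_pmf (dmbc_seq Wf xs) (\<lambda>yzs. bind_pmf (G (map fst yzs)) (\<lambda>xbs.
        map_pmf (\<lambda>yzb. (map Inl xs @ map (Inr \<circ> fst) yzb, map Inr (map fst yzs) @ map Inl xbs,
          map Inl (map snd yzs) @ map (Inr \<circ> snd) yzb)) (dmbc_seq Wb xbs))))"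
  by (simp add: execution_def map_pmf_def bind_assoc_pmf bind_return_pmf o_def bind_return_pmf')

text \<open>The actual experiment draws y from \<open>PY\<close> and t from its posterior; the ideal
  one draws t uniformly and y from \<open>KY t\<close>. Given (y, t), both continue by the same
  kernel \<open>tail\<close>, so they are as close as the two laws of y. Decoding and secrecy thus
  hold within 2 \<beta> in the actual experiment, and replacing s t by Alice's decision in the
  secrecy claim costs another 2 \<beta>.\<close>

lemma protocol_of_code:
  fixes Wf :: "('xf, 'yf, 'zf) dmbc" and Wb :: "('xb, 'yb, 'zb) dmbc"
    and KXZ :: "'yf list \<Rightarrow> ('xf list \<times> 'zf list) pmf" and T :: "'t set" and s :: "'t \<Rightarrow> nat"
    and dec :: "'xf list \<times> 'yb list \<Rightarrow> nat"
  assumes n: "0 < n" "0 < m"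
    and PX: "\<And>xs. xs \<in> set_pmf PX \<Longrightarrow> length xs = n"
    and reverse: "bind_pmf PX (\<lambda>xs. map_pmf (\<lambda>yzs. (map fst yzs, xs, map snd yzs)) (dmbc_seq Wf xs)) = joint PY KXZ"
    and leny: "\<And>ys. ys \<in> set_pmf PY \<Longrightarrow> length ys = n"
    and T: "finite T" "T \<noteq> {}"
    and KXb: "\<And>t xs. t \<in> T \<Longrightarrow> xs \<in> set_pmf (KXb t) \<Longrightarrow> length xs = m"
    and dec: "\<And>y. dec y < K"
    and cover: "near \<beta> PY (bind_pmf (pmf_of_set T) KY)"
    and decode: "prob_of (joint (pmf_of_set T) (\<lambda>t. pair_pmf (bind_pmf (KY t) (\<lambda>y. map_pmf fst (KXZ y)))
        (bind_pmf (KXb t) (\<lambda>x. map_pmf (map fst) (dmbc_seq Wb x))))) {(t, y). dec y \<noteq> s t} \<le> \<beta>"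
    and secret: "near \<beta> (bind_pmf (pmf_of_set T) (\<lambda>t. map_pmf (Pair (s t)) (pair_pmf (bind_pmf (KY t) (\<lambda>y. map_pmf snd (KXZ y)))
        (bind_pmf (KXb t) (\<lambda>x. map_pmf (map snd) (dmbc_seq Wb x)))))) (pair_pmf (pmf_of_set {..<K}) Q)"
  obtains \<pi> Q' where "protocol_wf \<pi>" "n_f \<pi> = n" "n_b \<pi> = m"
    and "range (key \<pi> :: ('xf, 'yf, 'zf, 'xb, 'yb, 'zb) views \<Rightarrow> nat) \<subseteq> {..<K}"
    and "prob_of (execution Wf Wb \<pi>) {\<omega>. key_estimate \<pi> \<omega> \<noteq> key \<pi> \<omega>} \<le> 2 * \<beta>"
    and "near (4 * \<beta>) (map_pmf (\<lambda>\<omega>. (key \<pi> \<omega>, view_eve \<omega>)) (execution Wf Wb \<pi>)) (pair_pmf (pmf_of_set {..<K}) Q')"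
proof -
  \<comment> \<open>The law of Bob's output and the index in the ideal experiment. Its kernel
    \<open>post\<close> is the posterior from which the actual Bob draws t.\<close>
  define Jt where "Jt = bind_pmf (pmf_of_set T) (\<lambda>t. map_pmf (\<lambda>y. (y, t)) (KY t))"
  obtain post where post: "Jt = joint (map_pmf fst Jt) post" and post_T: "\<And>y. set_pmf (post y) \<subseteq> snd ` set_pmf Jt"
    by (rule disintegrate_pmf[of Jt], rule that)
  \<comment> \<open>This is needed for every y: a round must have its prescribed length on all
    views, also on those that never occur.\<close>
  have set_post: "set_pmf (post y) \<subseteq> T" for y
    using post_T[of y] T by (auto simp: Jt_def)
  define tail where "tail = (\<lambda>(ys, t). bind_pmf (KXb t) (\<lambda>xbs.
      map_pmf (\<lambda>((xs, zs), yzb). (t, ys, xs, zs, xbs, yzb)) (pair_pmf (KXZ ys) (dmbc_seq Wb xbs))))"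
  define R where "R = bind_pmf (joint PY post) tail"
  define D where "D = bind_pmf Jt tail"
  have "map_pmf fst Jt = bind_pmf (pmf_of_set T) KY"
    by (simp add: Jt_def map_calc)
  then have nearRD: "near \<beta> R D"
    unfolding R_def D_def using cover by (subst post) (intro near_bind, simp)
  have D: "D = bind_pmf (pmf_of_set T) (\<lambda>t. bind_pmf (KY t) (\<lambda>ys. bind_pmf (KXb t) (\<lambda>xbs.
      map_pmf (\<lambda>((xs, zs), yzb). (t, ys, xs, zs, xbs, yzb)) (pair_pmf (KXZ ys) (dmbc_seq Wb xbs)))))"
    by (simp add: D_def Jt_def tail_def bind_assoc_pmf bind_map_pmf)
  define wrong where "wrong = (\<lambda>(t, ys :: 'yf list, xs, zs :: 'zf list, xbs :: 'xb list, yzb :: ('yb \<times> 'zb) list). dec (xs, map fst yzb) \<noteq> s t)"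
  have Dwrong: "prob_of D {\<omega>. wrong \<omega>} \<le> \<beta>"
  proof -
    have "map_pmf (\<lambda>(t, ys, xs, zs, xbs, yzb). (t, xs, map fst yzb)) D = joint (pmf_of_set T)
       (\<lambda>t. pair_pmf (bind_pmf (KY t) (\<lambda>y. map_pmf fst (KXZ y))) (bind_pmf (KXb t) (\<lambda>x. map_pmf (map fst) (dmbc_seq Wb x))))"
      unfolding D pair_bind_pmf
      by (simp add: map_calc case_prod_beta map_pair[symmetric])
    from arg_cong[OF this, of "\<lambda>p. prob_of p {(t, y). dec y \<noteq> s t}"] decode
    show ?thesis
      by (simp add: vimage_def wrong_def case_prod_beta)
  qed
  have Rwrong: "prob_of R {\<omega>. wrong \<omega>} \<le> 2 * \<beta>"
    using nearD[OF nearRD, of "{\<omega>. wrong \<omega>}"] Dwrong by simp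
  let ?W = "\<lambda>s. {((xs, zs :: 'zf list), yzb :: ('yb \<times> 'zb) list). dec (xs, map fst yzb) \<noteq> s}"
  \<comment> \<open>Bob cannot reproduce \<open>t\<close>, because views record only channel symbols. Given his view, \<open>t\<close> is independent of
    Alice's decision, so the best guess \<open>h\<close> of that decision errs at most as often as \<open>s t\<close> does.\<close>
  define h where "h yx = (SOME s0. s0 < K \<and> (\<forall>s. prob_of (pair_pmf (KXZ (fst yx)) (dmbc_seq Wb (snd yx)))
       (?W s0)
     \<le> prob_of (pair_pmf (KXZ (fst yx)) (dmbc_seq Wb (snd yx))) (?W s)))" for yx
  have h: "h yx < K \<and> (\<forall>s. prob_of (pair_pmf (KXZ (fst yx)) (dmbc_seq Wb (snd yx)))
       (?W (h yx))
     \<le> prob_of (pair_pmf (KXZ (fst yx)) (dmbc_seq Wb (snd yx))) (?W s))" for yx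
    unfolding h_def
    by (rule someI_ex)
      (use best_guess_exists[of "\<lambda>a. dec (fst (fst a), map fst (snd a))" K] dec in \<open>simp add: case_prod_beta'\<close>)
  define bad where "bad = (\<lambda>(t :: 't, ys, xs, zs :: 'zf list, xbs, yzb :: ('yb \<times> 'zb) list). h (ys, xbs) \<noteq> dec (xs, map fst yzb))"
  have tail_le: "prob_of (tail yt) {\<omega>. bad \<omega>} \<le> prob_of (tail yt) {\<omega>. wrong \<omega>}" for yt
  proof -
    obtain ys t where yt: "yt = (ys, t)" by force
    have "prob_of (tail yt) {\<omega>. bad \<omega>} = mean (KXb t) (\<lambda>xbs.
        prob_of (pair_pmf (KXZ ys) (dmbc_seq Wb xbs)) (?W (h (ys, xbs))))"
      unfolding yt tail_def by (simp add: prob_bind_pmf bad_def vimage_def case_prod_beta' eq_commute)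
    also have "\<dots> \<le> mean (KXb t) (\<lambda>xbs.
        prob_of (pair_pmf (KXZ ys) (dmbc_seq Wb xbs)) (?W (s t)))"
    proof (intro integral_mono measure_pmf.integrable_const_bound[where B=1])
      show "prob_of (pair_pmf (KXZ ys) (dmbc_seq Wb xbs)) (?W (h (ys, xbs)))
        \<le> prob_of (pair_pmf (KXZ ys) (dmbc_seq Wb xbs)) (?W (s t))" for xbs
        using h[of "(ys, xbs)"] by simp
    qed auto
    also have "\<dots> = prob_of (tail yt) {\<omega>. wrong \<omega>}"
      unfolding yt tail_def by (simp add: prob_bind_pmf wrong_def vimage_def case_prod_beta')
    finally show ?thesis .
  qed
  have Rbad: "prob_of R {\<omega>. bad \<omega>} \<le> 2 * \<beta>"
  proof -
    have "prob_of R {\<omega>. bad \<omega>} \<le> prob_of R {\<omega>. wrong \<omega>}"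
      unfolding R_def prob_bind_pmf[of "joint PY post"]
      by (intro integral_mono measure_pmf.integrable_const_bound[where B=1] tail_le) auto
    then show ?thesis using Rwrong by simp
  qed
  define \<pi> :: "('xf, 'yf, 'xb, 'yb) protocol" where
    "\<pi> = \<lparr>rounds = [Forward n (\<lambda>_. PX), Backward m (\<lambda>b. (\<lambda>ys. bind_pmf (post ys) KXb) (map projr b))],
      out_alice = (\<lambda>a. dec (map projl (take n a), map projr (drop n a))),
      out_bob = (\<lambda>b. h (map projr (take n b), map projl (drop n b))), key_by_alice = True\<rparr>"
  define views where "views = (\<lambda>(t :: 't, ys :: 'yf list, xs :: 'xf list, zs :: 'zf list, xbs :: 'xb list, yzb :: ('yb \<times> 'zb) list).
    (map Inl xs @ map (Inr \<circ> fst) yzb, map Inr ys @ map Inl xbs, map Inl zs @ map (Inr \<circ> snd) yzb)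
      :: ('xf, 'yf, 'zf, 'xb, 'yb, 'zb) views)"
  \<comment> \<open>\<open>reverse\<close> puts y first; then x and z, which depend on y alone,
    commute past t and Bob's backward word.\<close>
  have exec: "execution Wf Wb \<pi> = map_pmf views R"
  proof -
    let ?F = "\<lambda>(ys, xs, zs). bind_pmf (post ys) (\<lambda>t. bind_pmf (KXb t) (\<lambda>xbs.
      map_pmf (\<lambda>yzb. views (t, ys, xs, zs, xbs, yzb)) (dmbc_seq Wb xbs)))"
    have "execution Wf Wb \<pi> = bind_pmf (bind_pmf PX (\<lambda>xs. map_pmf (\<lambda>yzs. (map fst yzs, xs, map snd yzs)) (dmbc_seq Wf xs))) ?F"
      unfolding \<pi>_def run_two_rounds[where G="\<lambda>ys. bind_pmf (post ys) KXb"]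
      by (simp add: views_def bind_assoc_pmf bind_map_pmf o_def)
    also have "\<dots> = bind_pmf (joint PY KXZ) ?F" by (simp only: reverse)
    also have "\<dots> = bind_pmf PY (\<lambda>ys. bind_pmf (KXZ ys) (\<lambda>(xs, zs). bind_pmf (post ys) (\<lambda>t. bind_pmf (KXb t) (\<lambda>xbs.
      map_pmf (\<lambda>yzb. views (t, ys, xs, zs, xbs, yzb)) (dmbc_seq Wb xbs)))))"
      by (simp add: bind_assoc_pmf bind_map_pmf case_prod_beta')
    also have "\<dots> = bind_pmf PY (\<lambda>ys. bind_pmf (post ys) (\<lambda>t. bind_pmf (KXb t) (\<lambda>xbs. bind_pmf (KXZ ys) (\<lambda>(xs, zs).
      map_pmf (\<lambda>yzb. views (t, ys, xs, zs, xbs, yzb)) (dmbc_seq Wb xbs)))))"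
      by (intro bind_pmf_cong refl) (simp add: case_prod_beta' bind_commute_pmf[of "KXZ _"])
    also have "\<dots> = map_pmf views R"
      by (simp add: R_def tail_def bind_assoc_pmf bind_map_pmf map_calc pair_pmf_def
          map_pmf_def bind_return_pmf case_prod_beta')
    finally show ?thesis .
  qed
  \<comment> \<open>The outputs cut the views at position n, which separates the forward from the
    backward part only if the lengths are right.\<close>
  have lenR: "length ys = n \<and> length xs = n" if "(t, ys, xs, zs, xbs, yzb) \<in> set_pmf R" for t ys xs zs xbs yzb
  proof -
    have "ys \<in> set_pmf PY" "(xs, zs) \<in> set_pmf (KXZ ys)" using that by (auto simp: R_def tail_def)
    then have "(ys, xs, zs) \<in> set_pmf (joint PY KXZ)" by auto
    then have "xs \<in> set_pmf PX" unfolding reverse[symmetric] by auto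
    then show ?thesis using PX leny \<open>ys \<in> set_pmf PY\<close> by auto
  qed
  have key_views: "key \<pi> (views (t, ys, xs, zs, xbs, yzb)) = dec (xs, map fst yzb)" if "length xs = n" for t ys xs zs xbs yzb
    using that by (simp add: key_def views_def \<pi>_def o_def)
  have est_views: "key_estimate \<pi> (views (t, ys, xs, zs, xbs, yzb)) = h (ys, xbs)" if "length ys = n" for t ys xs zs xbs yzb
    using that by (simp add: key_estimate_def views_def \<pi>_def o_def)
  define \<phi> :: "'zf list \<times> 'zb list \<Rightarrow> ('zf, 'zb) view" where "\<phi> = (\<lambda>(zs, zb). map Inl zs @ map Inr zb)"
  have secD: "near \<beta> (map_pmf (\<lambda>(t, ys, xs, zs, xbs, yzb). (s t, \<phi> (zs, map snd yzb))) D) (pair_pmf (pmf_of_set {..<K}) (map_pmf \<phi> Q))"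
  proof -
    have "map_pmf (\<lambda>(t, ys, xs, zs, xbs, yzb). (s t, zs, map snd yzb)) D = bind_pmf (pmf_of_set T) (\<lambda>t. map_pmf (Pair (s t))
       (pair_pmf (bind_pmf (KY t) (\<lambda>y. map_pmf snd (KXZ y))) (bind_pmf (KXb t) (\<lambda>x. map_pmf (map snd) (dmbc_seq Wb x)))))"
      unfolding D pair_bind_pmf
      by (simp add: map_calc case_prod_beta map_pair[symmetric])
    from near_map[OF secret[folded this], of "apsnd \<phi>"] show ?thesis
      by (simp add: map_pmf_comp o_def case_prod_beta' pair_map_pmf2)
  qed
  have secR: "near (2 * \<beta>) (map_pmf (\<lambda>(t, ys, xs, zs, xbs, yzb). (s t, \<phi> (zs, map snd yzb))) R) (pair_pmf (pmf_of_set {..<K}) (map_pmf \<phi> Q))"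
    using near_trans[OF near_map[OF nearRD] secD] by simp
  have "near (2 * \<beta>) (map_pmf (\<lambda>(t, ys, xs, zs, xbs, yzb). (dec (xs, map fst yzb), \<phi> (zs, map snd yzb))) R)
     (map_pmf (\<lambda>(t, ys, xs, zs, xbs, yzb). (s t, \<phi> (zs, map snd yzb))) R)"
    by (rule near_disagree, rule order_trans[OF _ Rwrong], rule prob_mono_support) (auto simp: wrong_def)
  from near_trans[OF this secR]
  have "near (4 * \<beta>) (map_pmf (\<lambda>(t, ys, xs, zs, xbs, yzb). (dec (xs, map fst yzb), \<phi> (zs, map snd yzb))) R) (pair_pmf (pmf_of_set {..<K}) (map_pmf \<phi> Q))"
    by simp
  also have "map_pmf (\<lambda>(t, ys, xs, zs, xbs, yzb). (dec (xs, map fst yzb), \<phi> (zs, map snd yzb))) R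
      = map_pmf (\<lambda>\<omega>. (key \<pi> \<omega>, view_eve \<omega>)) (execution Wf Wb \<pi>)"
    unfolding exec map_pmf_comp
  proof (intro map_pmf_cong refl)
    fix \<omega> assume \<omega>: "\<omega> \<in> set_pmf R"
    obtain t ys xs zs xbs yzb where eq: "\<omega> = (t, ys, xs, zs, xbs, yzb)" by (cases \<omega>)
    from \<omega> have "key \<pi> (views (t, ys, xs, zs, xbs, yzb)) = dec (xs, map fst yzb)"
      unfolding eq by (intro key_views) (simp add: lenR)
    moreover have "view_eve (views (t, ys, xs, zs, xbs, yzb)) = \<phi> (zs, map snd yzb)"
      by (simp add: views_def view_eve_def \<phi>_def)
    ultimately show "(case \<omega> of (t, ys, xs, zs, xbs, yzb) \<Rightarrow> (dec (xs, map fst yzb), \<phi> (zs, map snd yzb)))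
        = (key \<pi> (views \<omega>), view_eve (views \<omega>))"
      by (simp add: eq)
  qed
  finally have near_key: "near (4 * \<beta>) (map_pmf (\<lambda>\<omega>. (key \<pi> \<omega>, view_eve \<omega>)) (execution Wf Wb \<pi>)) (pair_pmf (pmf_of_set {..<K}) (map_pmf \<phi> Q))" .
  have err: "prob_of (execution Wf Wb \<pi>) {\<omega>. key_estimate \<pi> \<omega> \<noteq> key \<pi> \<omega>} \<le> 2 * \<beta>"
  proof -
    have "prob_of R {\<omega>. key_estimate \<pi> (views \<omega>) \<noteq> key \<pi> (views \<omega>)} \<le> prob_of R {\<omega>. bad \<omega>}"
      by (rule prob_mono_support) (auto simp: bad_def key_views est_views dest: lenR)
    then show ?thesis using Rbad unfolding exec prob_map_pmf by simp
  qed
  have wf: "protocol_wf \<pi>"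
    using n PX KXb set_post h dec unfolding protocol_wf_def \<pi>_def
    by (auto intro!: finite_subset[of "range _" "{..<K}"]) blast
  show thesis
    by (rule that[OF wf _ _ _ err near_key]) (use dec in \<open>auto simp: \<pi>_def n_f_def n_b_def key_def\<close>)
qed

section \<open>Typicality of memoryless sequences\<close>

primrec kernel_seq :: "('a \<Rightarrow> 'b pmf) \<Rightarrow> 'a list \<Rightarrow> 'b list pmf" where
  "kernel_seq K [] = return_pmf []"
| "kernel_seq K (x # xs) = bind_pmf (K x) (\<lambda>y. map_pmf ((#) y) (kernel_seq K xs))"

lemma dmbc_seq_eq: "dmbc_seq W xs = kernel_seq W xs"
  by (induction xs) auto

lemma replicate_pmf_Suc: "replicate_pmf (Suc n) p = bind_pmf p (\<lambda>x. map_pmf ((#) x) (replicate_pmf n p))"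
  by (simp add: map_pmf_def)

lemma length_kernel_seq: "ys \<in> set_pmf (kernel_seq K xs) \<Longrightarrow> length ys = length xs"
  by (induction xs arbitrary: ys) auto

lemma length_replicate_pmf: "xs \<in> set_pmf (replicate_pmf n p) \<Longrightarrow> length xs = n"
  by (simp add: set_replicate_pmf)

lemma finite_kernel_seq: "(\<And>x. finite (set_pmf (K x))) \<Longrightarrow> finite (set_pmf (kernel_seq K xs))"
  by (induction xs) auto

lemma finite_replicate_pmf: "finite (set_pmf p) \<Longrightarrow> finite (set_pmf (replicate_pmf n p))"
  by (induction n) (auto simp: replicate_pmf_Suc simp del: replicate_pmf.simps(2))

lemma pmf_Cons_kernel: "pmf (bind_pmf p (\<lambda>y. map_pmf ((#) y) q)) (z # zs) = pmf p z * pmf q zs"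
proof -
  have "bind_pmf p (\<lambda>y. map_pmf ((#) y) q) = map_pmf (\<lambda>(y, ys). y # ys) (pair_pmf p q)"
    by (simp add: pair_pmf_def map_bind_pmf map_pmf_def bind_assoc_pmf bind_return_pmf)
  moreover have "pmf (map_pmf (\<lambda>(y, ys). y # ys) (pair_pmf p q)) ((\<lambda>(y, ys). y # ys) (z, zs)) = pmf (pair_pmf p q) (z, zs)"
    by (rule pmf_map_inj') (auto simp: inj_on_def)
  ultimately show ?thesis by (simp add: pmf_pair)
qed

lemma pmf_kernel_seq_map:
  "pmf (kernel_seq K (map f l)) (map g l) = prod_list (map (\<lambda>a. pmf (K (f a)) (g a)) l)"
  by (induction l) (auto simp: pmf_Cons_kernel)

lemma pmf_replicate_map:
  "pmf (replicate_pmf (length l) p) (map g l) = prod_list (map (\<lambda>a. pmf p (g a)) l)"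
  by (induction l) (simp_all add: replicate_pmf_Suc pmf_Cons_kernel del: replicate_pmf.simps(2))

lemma map_kernel_seq: "map_pmf (map f) (kernel_seq K xs) = kernel_seq (\<lambda>x. map_pmf f (K x)) xs"
proof (induction xs)
  case (Cons x xs)
  show ?case
    by (simp add: Cons[symmetric] bind_map_pmf map_calc)
qed simp

lemma bind_kernel_seq: "bind_pmf (kernel_seq K xs) (kernel_seq K') = kernel_seq (\<lambda>x. bind_pmf (K x) K') xs"
proof (induction xs)
  case (Cons x xs)
  show ?case
    unfolding kernel_seq.simps Cons[symmetric] map_bind_pmf bind_assoc_pmf bind_map_pmf
    by (intro bind_pmf_cong refl) (simp add: bind_map_pmf bind_commute_pmf[of "kernel_seq K xs"])
qed (simp add: bind_return_pmf)

lemma bind_replicate_pmf: "bind_pmf (replicate_pmf n p) (kernel_seq K) = replicate_pmf n (bind_pmf p K)"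
proof (induction n)
  case (Suc n)
  show ?case
    unfolding replicate_pmf_Suc Suc[symmetric] map_bind_pmf bind_assoc_pmf bind_map_pmf
    by (intro bind_pmf_cong refl) (simp add: bind_map_pmf bind_commute_pmf[of "replicate_pmf n p"])
qed (simp add: bind_return_pmf)

lemma map_replicate_pmf: "map_pmf (map f) (replicate_pmf n p) = replicate_pmf n (map_pmf f p)"
proof (induction n)
  case (Suc n)
  show ?case
    by (simp add: replicate_pmf_Suc Suc[symmetric] bind_map_pmf map_calc del: replicate_pmf.simps(2))
qed simp

lemma joint_kernel_seq:
  "joint (kernel_seq A ws) (kernel_seq D) = map_pmf (\<lambda>l. (map fst l, map snd l)) (kernel_seq (\<lambda>w. joint (A w) D) ws)"
proof (induction ws)
  case (Cons w ws)
  have "joint (kernel_seq A (w # ws)) (kernel_seq D)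
     = bind_pmf (A w) (\<lambda>u. bind_pmf (D u) (\<lambda>y. map_pmf (\<lambda>(us, ys). (u # us, y # ys)) (joint (kernel_seq A ws) (kernel_seq D))))"
    by (simp add: bind_assoc_pmf bind_map_pmf map_calc bind_commute_pmf[of "kernel_seq A ws"])
  then show ?case
    unfolding Cons by (simp add: bind_assoc_pmf bind_map_pmf map_calc)
qed (simp add: bind_return_pmf)

lemma joint_replicate_pmf:
  "joint (replicate_pmf n p) (kernel_seq D) = map_pmf (\<lambda>l. (map fst l, map snd l)) (replicate_pmf n (joint p D))"
proof (induction n)
  case (Suc n)
  have "joint (replicate_pmf (Suc n) p) (kernel_seq D)
     = bind_pmf p (\<lambda>u. bind_pmf (D u) (\<lambda>y. map_pmf (\<lambda>(us, ys). (u # us, y # ys)) (joint (replicate_pmf n p) (kernel_seq D))))"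
    by (simp add: replicate_pmf_Suc bind_assoc_pmf bind_map_pmf map_calc
        bind_commute_pmf[of "replicate_pmf n p"] del: replicate_pmf.simps(2))
  then show ?case
    unfolding Suc by (simp add: replicate_pmf_Suc bind_assoc_pmf bind_map_pmf map_calc del: replicate_pmf.simps(2))
qed (simp add: bind_return_pmf)

lemma joint3_replicate_pmf:
  "bind_pmf (replicate_pmf n P2) (\<lambda>ws. map_pmf (Pair ws) (joint (kernel_seq A ws) (kernel_seq D)))
    = map_pmf (\<lambda>l. (map fst l, map (\<lambda>x. fst (snd x)) l, map (\<lambda>x. snd (snd x)) l))
        (replicate_pmf n (bind_pmf P2 (\<lambda>w. map_pmf (Pair w) (joint (A w) D))))"
proof -
  have "bind_pmf (replicate_pmf n P2) (\<lambda>ws. map_pmf (Pair ws) (joint (kernel_seq A ws) (kernel_seq D)))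
     = map_pmf (\<lambda>(ws, l). (ws, map fst l, map snd l)) (joint (replicate_pmf n P2) (kernel_seq (\<lambda>w. joint (A w) D)))"
    unfolding joint_kernel_seq by (simp add: map_calc)
  then show ?thesis
    unfolding joint_replicate_pmf by (simp add: map_pmf_comp o_def)
qed

section \<open>Weak law of large numbers for log-likelihood ratios\<close>

lemma sum_list_mean_square:
  fixes e :: "'a \<Rightarrow> real"
  assumes fin: "finite (set_pmf J)" and 0: "mean J e = 0"
  shows "mean (replicate_pmf n J) (\<lambda>l. sum_list (map e l)) = 0
    \<and> mean (replicate_pmf n J) (\<lambda>l. (sum_list (map e l))\<^sup>2)
      = real n * mean J (\<lambda>x. (e x)\<^sup>2)"
proof (induction n)
  case (Suc n)
  note finR = finite_replicate_pmf[OF fin, of n]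
  note int = integrable_measure_pmf_finite[OF fin] and intR = integrable_measure_pmf_finite[OF finR]
  have E: "mean (replicate_pmf (Suc n) J) h
      = mean J (\<lambda>x. mean (replicate_pmf n J) (\<lambda>l. h (x # l)))" for h :: "_ \<Rightarrow> real"
    unfolding replicate_pmf_Suc using fin finR by (subst expectation_bind_finite) auto
  have "mean (replicate_pmf n J) (\<lambda>l. (e x + sum_list (map e l))\<^sup>2)
      = (e x)\<^sup>2 + real n * mean J (\<lambda>x. (e x)\<^sup>2)" for x
  proof -
    have "mean (replicate_pmf n J) (\<lambda>l. (e x + sum_list (map e l))\<^sup>2)
        = mean (replicate_pmf n J) (\<lambda>l. (e x)\<^sup>2 + (2 * e x * sum_list (map e l) + (sum_list (map e l))\<^sup>2))"
      by (simp add: power2_sum algebra_simps)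
    also have "\<dots> = (e x)\<^sup>2 + real n * mean J (\<lambda>x. (e x)\<^sup>2)"
      by (subst Bochner_Integration.integral_add, rule intR, rule intR,
          subst Bochner_Integration.integral_add, rule intR, rule intR) (simp add: Suc)
    finally show ?thesis .
  qed
  moreover have "mean (replicate_pmf n J) (\<lambda>l. e x + sum_list (map e l)) = e x" for x
    by (subst Bochner_Integration.integral_add, rule intR, rule intR) (simp add: Suc)
  ultimately show ?case
    unfolding E by (simp add: 0 Bochner_Integration.integral_add[OF int int] algebra_simps)
qed simp

lemma prob_gt_le:
  fixes h :: "'a \<Rightarrow> real"
  assumes fin: "finite (set_pmf p)" and "0 < c" "\<And>x. 0 \<le> h x"
  shows "prob_of p {x. c < h x} \<le> mean p h / c"
proof -
  have "prob_of p {x. c < h x} = mean p (indicator {x. c < h x})" by simp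
  also have "\<dots> \<le> mean p (\<lambda>x. h x / c)"
    using assms by (intro integral_mono integrable_measure_pmf_finite) (auto simp: indicator_def)
  finally show ?thesis by simp
qed

text \<open>Chebyshev's inequality for the sum of the independent terms log (f / g). Products are
  compared instead of logarithms, because the likelihoods of words under memoryless channels are
  such products.\<close>

lemma aep:
  fixes f g :: "'a \<Rightarrow> real"
  assumes fin: "finite (set_pmf J)" and f: "\<And>x. x \<in> set_pmf J \<Longrightarrow> 0 < f x" and g: "\<And>x. x \<in> set_pmf J \<Longrightarrow> 0 < g x"
    and \<epsilon>: "0 < \<epsilon>"
  shows "(\<lambda>n. prob_of (replicate_pmf n J) {l. prod_list (map f l) >
      2 powr (real n * (mean J (\<lambda>x. log 2 (f x / g x)) + \<epsilon>)) * prod_list (map g l)}) \<longlonglongrightarrow> 0"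
    (is "(\<lambda>n. ?p n) \<longlonglongrightarrow> 0")
proof -
  define \<mu> where "\<mu> = mean J (\<lambda>x. log 2 (f x / g x))"
  define e where "e x = log 2 (f x / g x) - \<mu>" for x
  define C where "C = mean J (\<lambda>x. (e x)\<^sup>2)"
  have e0: "mean J e = 0"
    unfolding e_def[abs_def]
    by (subst Bochner_Integration.integral_diff) (auto simp: \<mu>_def intro: integrable_measure_pmf_finite fin)
  have bound: "?p n \<le> C / \<epsilon>\<^sup>2 * inverse (real n)" if n: "0 < n" for n
  proof -
    have "?p n \<le> prob_of (replicate_pmf n J) {l. (real n * \<epsilon>)\<^sup>2 < (sum_list (map e l))\<^sup>2}"
    proof (rule prob_mono_support)
      fix l assume l: "l \<in> set_pmf (replicate_pmf n J)"
        and "l \<in> {l. prod_list (map f l) > 2 powr (real n * (mean J (\<lambda>x. log 2 (f x / g x)) + \<epsilon>)) * prod_list (map g l)}"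
      then have gt: "2 powr (real n * (\<mu> + \<epsilon>)) * prod_list (map g l) < prod_list (map f l)" by (simp add: \<mu>_def)
      have lJ: "set l \<subseteq> set_pmf J" and len: "length l = n" using l by (auto simp: set_replicate_pmf)
      have *: "0 < prod_list (map g k) \<and> 0 < prod_list (map f k) \<and>
          log 2 (prod_list (map f k)) - log 2 (prod_list (map g k)) = sum_list (map e k) + real (length k) * \<mu>"
        if "set k \<subseteq> set_pmf J" for k
        using that
      proof (induction k)
        case (Cons x k)
        then have "0 < f x" "0 < g x" using f g by auto
        then show ?case using Cons by (auto simp: log_mult log_divide e_def algebra_simps)
      qed simp
      have "log 2 (2 powr (real n * (\<mu> + \<epsilon>)) * prod_list (map g l)) < log 2 (prod_list (map f l))"
        using gt *[OF lJ] by simp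
      then have "real n * \<epsilon> < sum_list (map e l)"
        using *[OF lJ] len by (simp add: log_mult algebra_simps)
      then have "(real n * \<epsilon>)\<^sup>2 < (sum_list (map e l))\<^sup>2"
        using \<epsilon> by (intro power_strict_mono) auto
      then show "l \<in> {l. (real n * \<epsilon>)\<^sup>2 < (sum_list (map e l))\<^sup>2}" by simp
    qed
    also have "\<dots> \<le> mean (replicate_pmf n J) (\<lambda>l. (sum_list (map e l))\<^sup>2) / (real n * \<epsilon>)\<^sup>2"
      using n \<epsilon> by (intro prob_gt_le finite_replicate_pmf fin) auto
    also have "\<dots> = C / \<epsilon>\<^sup>2 * inverse (real n)"
      using sum_list_mean_square[OF fin e0, of n] n \<epsilon> by (simp add: C_def power2_eq_square field_simps)
    finally show ?thesis .
  qed
  have lim: "(\<lambda>n. C / \<epsilon>\<^sup>2 * inverse (real n)) \<longlonglongrightarrow> 0"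
    using tendsto_mult[OF tendsto_const[of "C / \<epsilon>\<^sup>2"] lim_inverse_n] by simp
  show ?thesis
    by (rule tendsto_sandwich[OF _ _ tendsto_const lim])
      (use eventually_mono[OF eventually_gt_at_top[of 0] bound] in \<open>auto intro: always_eventually\<close>)
qed

lemma tendsto_0_le:
  fixes f g :: "nat \<Rightarrow> real"
  assumes "\<And>n. 0 \<le> f n" "\<And>n. f n \<le> g n" "g \<longlonglongrightarrow> 0"
  shows "f \<longlonglongrightarrow> 0"
  by (rule tendsto_sandwich[OF _ _ tendsto_const assms(3)]) (use assms in auto)

text \<open>Exchanging f and g changes the sign of the mean, so the lower tail is an upper tail of
  the inverse ratio.\<close>

lemma aep_lower:
  fixes f g :: "'a \<Rightarrow> real"
  assumes fin: "finite (set_pmf J)" and f: "\<And>x. x \<in> set_pmf J \<Longrightarrow> 0 < f x" and g: "\<And>x. x \<in> set_pmf J \<Longrightarrow> 0 < g x"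
    and \<epsilon>: "0 < \<epsilon>"
  shows "(\<lambda>n. prob_of (replicate_pmf n J) {l. \<not> 2 powr (real n * (mean J (\<lambda>x. log 2 (f x / g x)) - \<epsilon>))
      * prod_list (map g l) \<le> prod_list (map f l)}) \<longlonglongrightarrow> 0"
proof -
  let ?i = "mean J (\<lambda>x. log 2 (f x / g x))"
  have "mean J (\<lambda>x. log 2 (g x / f x)) = mean J (\<lambda>x. - log 2 (f x / g x))"
  proof (rule integral_cong_AE)
    show "AE x in measure_pmf J. log 2 (g x / f x) = - log 2 (f x / g x)"
      unfolding AE_measure_pmf_iff using f g by (simp add: log_divide)
  qed simp_all
  then have i: "mean J (\<lambda>x. log 2 (g x / f x)) = - ?i" by simp
  have "prob_of (replicate_pmf n J) {l. \<not> 2 powr (real n * (?i - \<epsilon>)) * prod_list (map g l) \<le> prod_list (map f l)}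
    \<le> prob_of (replicate_pmf n J) {l. prod_list (map g l) > 2 powr (real n * (mean J (\<lambda>x. log 2 (g x / f x)) + \<epsilon>)) * prod_list (map f l)}" for n
    unfolding i
  proof (rule prob_mono_support)
    fix l assume "l \<in> {l. \<not> 2 powr (real n * (?i - \<epsilon>)) * prod_list (map g l) \<le> prod_list (map f l)}"
    then have "2 powr (real n * (- ?i + \<epsilon>)) * prod_list (map f l)
        < 2 powr (real n * (- ?i + \<epsilon>)) * (2 powr (real n * (?i - \<epsilon>)) * prod_list (map g l))"
      by (intro mult_strict_left_mono) auto
    also have "\<dots> = prod_list (map g l)"
    proof -
      have "real n * (- i + \<epsilon>) + real n * (i - \<epsilon>) = 0" for i by (simp add: algebra_simps)
      then show ?thesis by (simp only: mult.assoc[symmetric] powr_add[symmetric]) simp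
    qed
    finally show "l \<in> {l. prod_list (map g l) > 2 powr (real n * (- ?i + \<epsilon>)) * prod_list (map f l)}" by simp
  qed
  from tendsto_0_le[OF measure_nonneg this aep[OF fin g f \<epsilon>]] show ?thesis .
qed

text \<open>I(U;Y) for an input u with law P and the output y of W.\<close>

definition minfo :: "'a pmf \<Rightarrow> ('a \<Rightarrow> 'b pmf) \<Rightarrow> real" where
  "minfo P W = mean (joint P W) (\<lambda>(u, y). log 2 (pmf (W u) y / pmf (bind_pmf P W) y))"

text \<open>I(U;Y|W) along a chain w -> u -> y: w selects the input law \<open>A w\<close>, and y
  depends on w through u only.\<close>

definition cminfo :: "'w pmf \<Rightarrow> ('w \<Rightarrow> 'a pmf) \<Rightarrow> ('a \<Rightarrow> 'b pmf) \<Rightarrow> real" where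
  "cminfo P2 A W = mean (bind_pmf P2 (\<lambda>w. map_pmf (Pair w) (joint (A w) W)))
     (\<lambda>(w, u, y). log 2 (pmf (W u) y / pmf (bind_pmf (A w) W) y))"

lemma pmf_bind_pos: "u \<in> set_pmf P \<Longrightarrow> y \<in> set_pmf (W u) \<Longrightarrow> 0 < pmf (bind_pmf P W) y"
  by (rule pmf_positive) auto

text \<open>The memoryless joint law is an iid list of pairs, along which both likelihoods are
  products over the letters.\<close>

lemma aep_joint:
  assumes fin: "finite (set_pmf P)" "\<And>u. finite (set_pmf (W u))" and \<epsilon>: "0 < \<epsilon>"
  shows "(\<lambda>n. prob_of (joint (replicate_pmf n P) (kernel_seq W)) {(u, y). pmf (kernel_seq W u) y >
      2 powr (real n * (minfo P W + \<epsilon>)) * pmf (bind_pmf (replicate_pmf n P) (kernel_seq W)) y}) \<longlonglongrightarrow> 0" (is ?up)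
    and "(\<lambda>n. prob_of (joint (replicate_pmf n P) (kernel_seq W)) {(u, y). \<not>
      2 powr (real n * (minfo P W - \<epsilon>)) * pmf (bind_pmf (replicate_pmf n P) (kernel_seq W)) y \<le> pmf (kernel_seq W u) y}) \<longlonglongrightarrow> 0" (is ?lo)
proof -
  let ?J = "joint P W"
  let ?f = "\<lambda>x. pmf (W (fst x)) (snd x)" and ?g = "\<lambda>x. pmf (bind_pmf P W) (snd x)"
  have finJ: "finite (set_pmf ?J)" using fin by auto
  have f: "0 < ?f x" and g: "0 < ?g x" if "x \<in> set_pmf ?J" for x
    using that by (auto simp: pmf_positive intro: pmf_bind_pos)
  have I: "mean ?J (\<lambda>x. log 2 (?f x / ?g x)) = minfo P W"
    by (simp add: minfo_def case_prod_beta')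
  have pf: "pmf (kernel_seq W (map fst l)) (map snd l) = prod_list (map ?f l)" for l
    by (rule pmf_kernel_seq_map)
  have pg: "pmf (replicate_pmf n (bind_pmf P W)) (map snd l) = prod_list (map ?g l)"
    if "l \<in> set_pmf (replicate_pmf n ?J)" for l n
    using pmf_replicate_map[of l "bind_pmf P W" snd] length_replicate_pmf[OF that] by simp
  have "prob_of (joint (replicate_pmf n P) (kernel_seq W)) {(u, y). pmf (kernel_seq W u) y >
      2 powr (real n * (minfo P W + \<epsilon>)) * pmf (bind_pmf (replicate_pmf n P) (kernel_seq W)) y}
    \<le> prob_of (replicate_pmf n ?J) {l. prod_list (map ?f l) > 2 powr (real n * (mean ?J (\<lambda>x. log 2 (?f x / ?g x)) + \<epsilon>)) * prod_list (map ?g l)}" for n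
    unfolding joint_replicate_pmf bind_replicate_pmf prob_map_pmf I
    by (rule prob_mono_support) (simp only: mem_Collect_eq prod.case pf pg)
  from tendsto_0_le[OF measure_nonneg this aep[OF finJ f g \<epsilon>]] show ?up .
  have "prob_of (joint (replicate_pmf n P) (kernel_seq W)) {(u, y). \<not>
      2 powr (real n * (minfo P W - \<epsilon>)) * pmf (bind_pmf (replicate_pmf n P) (kernel_seq W)) y \<le> pmf (kernel_seq W u) y}
    \<le> prob_of (replicate_pmf n ?J) {l. \<not> 2 powr (real n * (mean ?J (\<lambda>x. log 2 (?f x / ?g x)) - \<epsilon>)) * prod_list (map ?g l) \<le> prod_list (map ?f l)}" for n
    unfolding joint_replicate_pmf bind_replicate_pmf prob_map_pmf I
    by (rule prob_mono_support) (simp only: mem_Collect_eq prod.case pf pg simp_thms)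
  from tendsto_0_le[OF measure_nonneg this aep_lower[OF finJ f g \<epsilon>]] show ?lo .
qed

lemma aep_joint3:
  assumes fin: "finite (set_pmf P2)" "\<And>w. finite (set_pmf (A w))" "\<And>u. finite (set_pmf (W u))" and \<epsilon>: "0 < \<epsilon>"
  shows "(\<lambda>n. prob_of (bind_pmf (replicate_pmf n P2) (\<lambda>ws. map_pmf (Pair ws) (joint (kernel_seq A ws) (kernel_seq W))))
      {(w, u, y). pmf (kernel_seq W u) y >
      2 powr (real n * (cminfo P2 A W + \<epsilon>)) * pmf (bind_pmf (kernel_seq A w) (kernel_seq W)) y}) \<longlonglongrightarrow> 0" (is ?up)
    and "(\<lambda>n. prob_of (bind_pmf (replicate_pmf n P2) (\<lambda>ws. map_pmf (Pair ws) (joint (kernel_seq A ws) (kernel_seq W))))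
      {(w, u, y). \<not> 2 powr (real n * (cminfo P2 A W - \<epsilon>)) * pmf (bind_pmf (kernel_seq A w) (kernel_seq W)) y \<le> pmf (kernel_seq W u) y}) \<longlonglongrightarrow> 0" (is ?lo)
proof -
  let ?J = "bind_pmf P2 (\<lambda>w. map_pmf (Pair w) (joint (A w) W))"
  let ?f = "\<lambda>x. pmf (W (fst (snd x))) (snd (snd x))" and ?g = "\<lambda>x. pmf (bind_pmf (A (fst x)) W) (snd (snd x))"
  have finJ: "finite (set_pmf ?J)" using fin by auto
  have f: "0 < ?f x" and g: "0 < ?g x" if "x \<in> set_pmf ?J" for x
    using that by (auto simp: pmf_positive intro: pmf_bind_pos)
  have I: "mean ?J (\<lambda>x. log 2 (?f x / ?g x)) = cminfo P2 A W"
    by (simp add: cminfo_def case_prod_beta')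
  have pf: "pmf (kernel_seq W (map (\<lambda>x. fst (snd x)) l)) (map (\<lambda>x. snd (snd x)) l) = prod_list (map ?f l)" for l :: "('a \<times> 'b \<times> 'c) list"
    by (rule pmf_kernel_seq_map)
  have pg: "pmf (kernel_seq (\<lambda>x. bind_pmf (A x) W) (map fst l)) (map (\<lambda>x. snd (snd x)) l) = prod_list (map ?g l)" for l :: "('a \<times> 'b \<times> 'c) list"
    by (rule pmf_kernel_seq_map)
  have "prob_of (bind_pmf (replicate_pmf n P2) (\<lambda>ws. map_pmf (Pair ws) (joint (kernel_seq A ws) (kernel_seq W))))
      {(w, u, y). pmf (kernel_seq W u) y >
      2 powr (real n * (cminfo P2 A W + \<epsilon>)) * pmf (bind_pmf (kernel_seq A w) (kernel_seq W)) y}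
    \<le> prob_of (replicate_pmf n ?J) {l. prod_list (map ?f l) > 2 powr (real n * (mean ?J (\<lambda>x. log 2 (?f x / ?g x)) + \<epsilon>)) * prod_list (map ?g l)}" for n
    unfolding joint3_replicate_pmf bind_kernel_seq prob_map_pmf I
    by (rule prob_mono_support) (simp only: mem_Collect_eq prod.case pf pg)
  from tendsto_0_le[OF measure_nonneg this aep[OF finJ f g \<epsilon>]] show ?up .
  have "prob_of (bind_pmf (replicate_pmf n P2) (\<lambda>ws. map_pmf (Pair ws) (joint (kernel_seq A ws) (kernel_seq W))))
      {(w, u, y). \<not> 2 powr (real n * (cminfo P2 A W - \<epsilon>)) * pmf (bind_pmf (kernel_seq A w) (kernel_seq W)) y \<le> pmf (kernel_seq W u) y}
    \<le> prob_of (replicate_pmf n ?J) {l. \<not> 2 powr (real n * (mean ?J (\<lambda>x. log 2 (?f x / ?g x)) - \<epsilon>)) * prod_list (map ?g l) \<le> prod_list (map ?f l)}" for n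
    unfolding joint3_replicate_pmf bind_kernel_seq prob_map_pmf I
    by (rule prob_mono_support) (simp only: mem_Collect_eq prod.case pf pg simp_thms)
  from tendsto_0_le[OF measure_nonneg this aep_lower[OF finJ f g \<epsilon>]] show ?lo .
qed

section \<open>Block codes for the two channels\<close>

lemma joint_bind_pmf: "joint (bind_pmf P2 A) W = bind_pmf P2 (\<lambda>w. joint (A w) W)"
  by (simp add: bind_assoc_pmf)

context
  fixes P2 :: "'w2 pmf" and PV :: "'v pmf" and W1 :: "'w2 \<Rightarrow> 'w1 pmf"
    and KX :: "'v \<Rightarrow> 'x pmf" and KY :: "'w1 \<Rightarrow> 'y pmf"
begin

lemma product_law_fst:
  "map_pmf (\<lambda>(w2, (v, w), (x, y)). (v, x)) (bind_pmf P2 (\<lambda>w2. map_pmf (Pair w2)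
     (joint (pair_pmf PV (W1 w2)) (\<lambda>(v, w). pair_pmf (KX v) (KY w))))) = joint PV KX"
  by (simp add: pair_pmf_def map_bind_pmf bind_assoc_pmf bind_return_pmf map_pmf_def)

lemma product_law_snd:
  "map_pmf (\<lambda>(w2, (v, w), (x, y)). (w2, w, y)) (bind_pmf P2 (\<lambda>w2. map_pmf (Pair w2)
     (joint (pair_pmf PV (W1 w2)) (\<lambda>(v, w). pair_pmf (KX v) (KY w)))))
   = bind_pmf P2 (\<lambda>w2. map_pmf (Pair w2) (joint (W1 w2) KY))"
  by (simp add: pair_pmf_def map_bind_pmf bind_assoc_pmf bind_return_pmf map_pmf_def)

lemma product_law_output:
  "bind_pmf (pair_pmf PV (W1 w2)) (\<lambda>(v, w). pair_pmf (KX v) (KY w)) = pair_pmf (bind_pmf PV KX) (bind_pmf (W1 w2) KY)"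
  unfolding pair_bind_pmf by (simp add: pair_pmf_def[of PV] bind_assoc_pmf bind_return_pmf)

lemma product_law_output_all:
  "bind_pmf (bind_pmf P2 (\<lambda>w2. pair_pmf PV (W1 w2))) (\<lambda>(v, w). pair_pmf (KX v) (KY w))
    = pair_pmf (bind_pmf PV KX) (bind_pmf (bind_pmf P2 W1) KY)"
proof -
  have "bind_pmf P2 (\<lambda>w2. pair_pmf X (Y w2)) = pair_pmf X (bind_pmf P2 Y)" for X :: "'x pmf" and Y :: "'w2 \<Rightarrow> 'y pmf"
    unfolding pair_pmf_def bind_assoc_pmf by (rule bind_commute_pmf)
  then show ?thesis
    unfolding bind_assoc_pmf product_law_output by simp
qed

text \<open>Likelihoods of the pair of observations factorize, since v is independent of (w2, w) and
  the two channels act separately. If every factor passes its threshold, so does the product. The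
  forward threshold is the same in both tests because v does not depend on the cloud.\<close>

lemma product_atypical_below:
  assumes nn: "0 \<le> a" "0 \<le> b1" "0 \<le> b2"
  shows "prob_of (bind_pmf P2 (\<lambda>w2. map_pmf (Pair w2) (joint (pair_pmf PV (W1 w2)) (\<lambda>(v, w). pair_pmf (KX v) (KY w)))))
      {(w2, u, y). \<not> (a * b1 * pmf (bind_pmf (bind_pmf P2 (\<lambda>w2. pair_pmf PV (W1 w2))) (\<lambda>(v, w). pair_pmf (KX v) (KY w))) y
          \<le> pmf ((\<lambda>(v, w). pair_pmf (KX v) (KY w)) u) y
        \<and> a * b2 * pmf (bind_pmf (pair_pmf PV (W1 w2)) (\<lambda>(v, w). pair_pmf (KX v) (KY w))) y
          \<le> pmf ((\<lambda>(v, w). pair_pmf (KX v) (KY w)) u) y)}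
    \<le> prob_of (joint PV KX) {(v, x). \<not> a * pmf (bind_pmf PV KX) x \<le> pmf (KX v) x}
      + prob_of (joint (bind_pmf P2 W1) KY) {(w, y). \<not> b1 * pmf (bind_pmf (bind_pmf P2 W1) KY) y \<le> pmf (KY w) y}
      + prob_of (bind_pmf P2 (\<lambda>w2. map_pmf (Pair w2) (joint (W1 w2) KY)))
          {(w2, w, y). \<not> b2 * pmf (bind_pmf (W1 w2) KY) y \<le> pmf (KY w) y}"
    (is "prob_of ?L ?S \<le> prob_of _ ?A + prob_of _ ?B + prob_of _ ?C")
proof -
  let ?f = "\<lambda>(w2 :: 'w2, (v :: 'v, w :: 'w1), (x :: 'x, y :: 'y)). (v, x)"
  let ?g = "\<lambda>(w2 :: 'w2, (v :: 'v, w :: 'w1), (x :: 'x, y :: 'y)). (w2, w, y)"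
  have j: "joint (bind_pmf P2 W1) KY = map_pmf snd (bind_pmf P2 (\<lambda>w2. map_pmf (Pair w2) (joint (W1 w2) KY)))"
    by (simp add: joint_bind_pmf map_calc)
  have "?S \<subseteq> {z. ?f z \<in> ?A} \<union> {z. snd (?g z) \<in> ?B} \<union> {z. ?g z \<in> ?C}"
  proof (intro subsetI)
    fix z assume z: "z \<in> ?S"
    obtain w2 v w x y where eq: "z = (w2, (v, w), (x, y))" by (cases z) auto
    show "z \<in> {z. ?f z \<in> ?A} \<union> {z. snd (?g z) \<in> ?B} \<union> {z. ?g z \<in> ?C}"
    proof (rule ccontr)
      assume "z \<notin> {z. ?f z \<in> ?A} \<union> {z. snd (?g z) \<in> ?B} \<union> {z. ?g z \<in> ?C}"
      then have 1: "a * pmf (bind_pmf PV KX) x \<le> pmf (KX v) x"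
        and 2: "b1 * pmf (bind_pmf (bind_pmf P2 W1) KY) y \<le> pmf (KY w) y"
        and 3: "b2 * pmf (bind_pmf (W1 w2) KY) y \<le> pmf (KY w) y"
        by (auto simp: eq)
      have "a * pmf (bind_pmf PV KX) x * (b1 * pmf (bind_pmf (bind_pmf P2 W1) KY) y) \<le> pmf (KX v) x * pmf (KY w) y"
        "a * pmf (bind_pmf PV KX) x * (b2 * pmf (bind_pmf (W1 w2) KY) y) \<le> pmf (KX v) x * pmf (KY w) y"
        using nn by (intro mult_mono 1 2 3; simp)+
      then have "z \<notin> ?S"
        unfolding eq product_law_output_all product_law_output by (simp add: pmf_pair mult_ac)
      then show False using z by simp
    qed
  qed
  then have "prob_of ?L ?S \<le> prob_of ?L ({z. ?f z \<in> ?A} \<union> {z. snd (?g z) \<in> ?B} \<union> {z. ?g z \<in> ?C})"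
    by (intro measure_pmf.finite_measure_mono) auto
  also have "\<dots> \<le> prob_of ?L {z. ?f z \<in> ?A} + prob_of ?L {z. snd (?g z) \<in> ?B} + prob_of ?L {z. ?g z \<in> ?C}"
    by (intro order_trans[OF prob_Un_le] add_right_mono prob_Un_le)
  finally show ?thesis
    unfolding j product_law_fst[symmetric] product_law_snd[symmetric] prob_map_pmf mem_Collect_eq .
qed

text \<open>The same factorization for upper tails, applied later to Eve's pair of
  observations.\<close>

lemma product_atypical_above:
  assumes nn: "0 \<le> a" "0 \<le> b"
  shows "prob_of (bind_pmf P2 (\<lambda>w2. map_pmf (Pair w2) (joint (pair_pmf PV (W1 w2)) (\<lambda>(v, w). pair_pmf (KX v) (KY w)))))
      {(w2, u, y). pmf ((\<lambda>(v, w). pair_pmf (KX v) (KY w)) u) y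
          > a * b * pmf (bind_pmf (pair_pmf PV (W1 w2)) (\<lambda>(v, w). pair_pmf (KX v) (KY w))) y}
    \<le> prob_of (joint PV KX) {(v, x). pmf (KX v) x > a * pmf (bind_pmf PV KX) x}
      + prob_of (bind_pmf P2 (\<lambda>w2. map_pmf (Pair w2) (joint (W1 w2) KY)))
          {(w2, w, y). pmf (KY w) y > b * pmf (bind_pmf (W1 w2) KY) y}"
    (is "prob_of ?L ?S \<le> prob_of _ ?A + prob_of _ ?C")
proof -
  let ?f = "\<lambda>(w2 :: 'w2, (v :: 'v, w :: 'w1), (x :: 'x, y :: 'y)). (v, x)"
  let ?g = "\<lambda>(w2 :: 'w2, (v :: 'v, w :: 'w1), (x :: 'x, y :: 'y)). (w2, w, y)"
  have "?S \<subseteq> {z. ?f z \<in> ?A} \<union> {z. ?g z \<in> ?C}"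
  proof (intro subsetI)
    fix z assume z: "z \<in> ?S"
    obtain w2 v w x y where eq: "z = (w2, (v, w), (x, y))" by (cases z) auto
    show "z \<in> {z. ?f z \<in> ?A} \<union> {z. ?g z \<in> ?C}"
    proof (rule ccontr)
      assume "z \<notin> {z. ?f z \<in> ?A} \<union> {z. ?g z \<in> ?C}"
      then have 1: "pmf (KX v) x \<le> a * pmf (bind_pmf PV KX) x"
        and 3: "pmf (KY w) y \<le> b * pmf (bind_pmf (W1 w2) KY) y"
        by (auto simp: eq)
      have "pmf (KX v) x * pmf (KY w) y \<le> a * pmf (bind_pmf PV KX) x * (b * pmf (bind_pmf (W1 w2) KY) y)"
        using nn by (intro mult_mono 1 3) auto
      then have "z \<notin> ?S"
        unfolding eq product_law_output by (simp add: pmf_pair mult_ac not_less)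
      then show False using z by simp
    qed
  qed
  then have "prob_of ?L ?S \<le> prob_of ?L ({z. ?f z \<in> ?A} \<union> {z. ?g z \<in> ?C})"
    by (intro measure_pmf.finite_measure_mono) auto
  also have "\<dots> \<le> prob_of ?L {z. ?f z \<in> ?A} + prob_of ?L {z. ?g z \<in> ?C}"
    by (rule prob_Un_le)
  finally show ?thesis
    unfolding product_law_fst[symmetric] product_law_snd[symmetric] prob_map_pmf mem_Collect_eq .
qed

end

text \<open>The forward variables are described from Bob's side: \<open>v \<rightarrow> y\<close> by \<open>ky\<close>, then \<open>y \<rightarrow> (x, z)\<close> by \<open>kxz\<close>;
  \<open>reverse\<close> says that this agrees with sending \<open>px\<close> through \<open>Wf\<close>.\<close>

locale ske_kernels =
  fixes Wf :: "('xf::finite, 'yf::finite, 'zf::finite) dmbc" and Wb :: "('xb::finite, 'yb::finite, 'zb::finite) dmbc"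
    and pv :: "'v pmf" and ky :: "'v \<Rightarrow> 'yf pmf" and px :: "'xf pmf" and kxz :: "'yf \<Rightarrow> ('xf \<times> 'zf) pmf"
    and pw2 :: "'w2 pmf" and pw1 :: "'w2 \<Rightarrow> 'w1 pmf" and kx :: "'w1 \<Rightarrow> 'xb pmf"
  assumes finite_supports: "finite (set_pmf pv)" "finite (set_pmf pw2)" "\<And>w. finite (set_pmf (pw1 w))"
    and reverse: "bind_pmf px (\<lambda>x. map_pmf (\<lambda>(y, z). (y, x, z)) (Wf x)) = joint (bind_pmf pv ky) kxz"
begin

definition kX :: "'v \<Rightarrow> 'xf pmf" where "kX v = bind_pmf (ky v) (\<lambda>y. map_pmf fst (kxz y))"
definition kZ :: "'v \<Rightarrow> 'zf pmf" where "kZ v = bind_pmf (ky v) (\<lambda>y. map_pmf snd (kxz y))"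
definition kYb :: "'w1 \<Rightarrow> 'yb pmf" where "kYb w = bind_pmf (kx w) (\<lambda>x. map_pmf fst (Wb x))"
definition kZb :: "'w1 \<Rightarrow> 'zb pmf" where "kZb w = bind_pmf (kx w) (\<lambda>x. map_pmf snd (Wb x))"

text \<open>For the intended variables these six quantities are I(V_f;Y_f), I(V_f;X_f), I(V_f;Z_f)
  and, on the backward side, I(W_1;Y_b), I(W_1;Y_b|W_2), I(W_1;Z_b|W_2).\<close>

abbreviation iY where "iY \<equiv> minfo pv ky"
abbreviation iX where "iX \<equiv> minfo pv kX"
abbreviation iZ where "iZ \<equiv> minfo pv kZ"
abbreviation iB where "iB \<equiv> minfo (bind_pmf pw2 pw1) kYb"
abbreviation iB2 where "iB2 \<equiv> cminfo pw2 pw1 kYb"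
abbreviation iE2 where "iE2 \<equiv> cminfo pw2 pw1 kZb"

text \<open>Atypicality of n letters for each of the six quantities. Covering and secrecy need
  likelihood ratios bounded above, so \<open>dY\<close>, \<open>dZ\<close> and \<open>dZb\<close>
  are upper tails; decoding needs them bounded below, so \<open>dX\<close>, \<open>dYb1\<close> and
  \<open>dYb2\<close> are lower tails.\<close>

definition dY :: "real \<Rightarrow> nat \<Rightarrow> real" where
  "dY \<gamma> n = prob_of (joint (replicate_pmf n pv) (kernel_seq ky)) {(u, y). pmf (kernel_seq ky u) y >
      2 powr (real n * (iY + \<gamma>)) * pmf (bind_pmf (replicate_pmf n pv) (kernel_seq ky)) y}"
definition dX :: "real \<Rightarrow> nat \<Rightarrow> real" where
  "dX \<gamma> n = prob_of (joint (replicate_pmf n pv) (kernel_seq kX)) {(u, y). \<not>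
      2 powr (real n * (iX - \<gamma>)) * pmf (bind_pmf (replicate_pmf n pv) (kernel_seq kX)) y \<le> pmf (kernel_seq kX u) y}"
definition dZ :: "real \<Rightarrow> nat \<Rightarrow> real" where
  "dZ \<gamma> n = prob_of (joint (replicate_pmf n pv) (kernel_seq kZ)) {(u, y). pmf (kernel_seq kZ u) y >
      2 powr (real n * (iZ + \<gamma>)) * pmf (bind_pmf (replicate_pmf n pv) (kernel_seq kZ)) y}"
definition dYb1 :: "real \<Rightarrow> nat \<Rightarrow> real" where
  "dYb1 \<gamma> n = prob_of (joint (replicate_pmf n (bind_pmf pw2 pw1)) (kernel_seq kYb)) {(u, y). \<not>
      2 powr (real n * (iB - \<gamma>)) * pmf (bind_pmf (replicate_pmf n (bind_pmf pw2 pw1)) (kernel_seq kYb)) y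
      \<le> pmf (kernel_seq kYb u) y}"
definition dYb2 :: "real \<Rightarrow> nat \<Rightarrow> real" where
  "dYb2 \<gamma> n = prob_of (bind_pmf (replicate_pmf n pw2) (\<lambda>ws. map_pmf (Pair ws) (joint (kernel_seq pw1 ws) (kernel_seq kYb))))
      {(w, u, y). \<not> 2 powr (real n * (iB2 - \<gamma>)) * pmf (bind_pmf (kernel_seq pw1 w) (kernel_seq kYb)) y \<le> pmf (kernel_seq kYb u) y}"
definition dZb :: "real \<Rightarrow> nat \<Rightarrow> real" where
  "dZb \<gamma> n = prob_of (bind_pmf (replicate_pmf n pw2) (\<lambda>ws. map_pmf (Pair ws) (joint (kernel_seq pw1 ws) (kernel_seq kZb))))
      {(w, u, y). pmf (kernel_seq kZb u) y > 2 powr (real n * (iE2 + \<gamma>)) * pmf (bind_pmf (kernel_seq pw1 w) (kernel_seq kZb)) y}"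

lemma atypicality_vanishes:
  assumes "0 < \<gamma>"
  shows "dY \<gamma> \<longlonglongrightarrow> 0" "dX \<gamma> \<longlonglongrightarrow> 0" "dZ \<gamma> \<longlonglongrightarrow> 0" "dYb1 \<gamma> \<longlonglongrightarrow> 0" "dYb2 \<gamma> \<longlonglongrightarrow> 0" "dZb \<gamma> \<longlonglongrightarrow> 0"
proof -
  have f: "finite (set_pmf (bind_pmf pw2 pw1))" using finite_supports by auto
  show "dY \<gamma> \<longlonglongrightarrow> 0" unfolding dY_def[abs_def] by (rule aep_joint(1)[OF finite_supports(1) _ assms]) simp
  show "dX \<gamma> \<longlonglongrightarrow> 0" unfolding dX_def[abs_def] by (rule aep_joint(2)[OF finite_supports(1) _ assms]) simp
  show "dZ \<gamma> \<longlonglongrightarrow> 0" unfolding dZ_def[abs_def] by (rule aep_joint(1)[OF finite_supports(1) _ assms]) simp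
  show "dYb1 \<gamma> \<longlonglongrightarrow> 0" unfolding dYb1_def[abs_def] by (rule aep_joint(2)[OF f _ assms]) simp
  show "dYb2 \<gamma> \<longlonglongrightarrow> 0" unfolding dYb2_def[abs_def] by (rule aep_joint3(2)[OF finite_supports(2,3) _ assms]) simp
  show "dZb \<gamma> \<longlonglongrightarrow> 0" unfolding dZb_def[abs_def] by (rule aep_joint3(1)[OF finite_supports(2,3) _ assms]) simp
qed

text \<open>The bound of \<open>superposition_code_exists\<close> with thresholds 2 to the power
  length times (information plus or minus \<gamma>), and with the atypicality of pairs split into
  forward and backward parts.\<close>

definition code_error :: "real \<Rightarrow> nat \<Rightarrow> nat \<Rightarrow> nat \<Rightarrow> nat \<Rightarrow> nat \<Rightarrow> real" where
  "code_error \<gamma> n m M K L = dY \<gamma> n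
    + sqrt (2 powr (real n * (iY + \<gamma>)) / (real M * real K * real L))
    + (dX \<gamma> n + dYb1 \<gamma> m + dYb2 \<gamma> m)
    + real M * real K * real L / (2 powr (real n * (iX - \<gamma>)) * 2 powr (real m * (iB - \<gamma>)))
    + real K * real L / (2 powr (real n * (iX - \<gamma>)) * 2 powr (real m * (iB2 - \<gamma>)))
    + (dZ \<gamma> n + dZb \<gamma> m)
    + sqrt (2 powr (real n * (iZ + \<gamma>)) * 2 powr (real m * (iE2 + \<gamma>)) / real L)"

lemma reverse_seq:
  "bind_pmf (replicate_pmf n px) (\<lambda>xs. map_pmf (\<lambda>yzs. (map fst yzs, xs, map snd yzs)) (dmbc_seq Wf xs))
    = joint (replicate_pmf n (bind_pmf pv ky)) (\<lambda>ys. map_pmf (\<lambda>l. (map fst l, map snd l)) (kernel_seq kxz ys))"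
proof -
  have "bind_pmf (replicate_pmf n px) (\<lambda>xs. map_pmf (\<lambda>yzs. (map fst yzs, xs, map snd yzs)) (dmbc_seq Wf xs))
      = map_pmf (\<lambda>(xs, yzs). (map fst yzs, xs, map snd yzs)) (joint (replicate_pmf n px) (kernel_seq Wf))"
    by (simp add: map_calc dmbc_seq_eq)
  also have "\<dots> = map_pmf (\<lambda>l. (map fst l, map (\<lambda>x. fst (snd x)) l, map (\<lambda>x. snd (snd x)) l))
      (map_pmf (map (\<lambda>(x, y, z). (y, x, z))) (replicate_pmf n (joint px Wf)))"
    unfolding joint_replicate_pmf by (simp add: map_pmf_comp o_def case_prod_beta')
  also have "map_pmf (map (\<lambda>(x, y, z). (y, x, z))) (replicate_pmf n (joint px Wf)) = replicate_pmf n (joint (bind_pmf pv ky) kxz)"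
    unfolding map_replicate_pmf reverse[symmetric] by (simp add: map_calc case_prod_beta')
  also have "map_pmf (\<lambda>l. (map fst l, map (\<lambda>x. fst (snd x)) l, map (\<lambda>x. snd (snd x)) l)) (replicate_pmf n (joint (bind_pmf pv ky) kxz))
      = map_pmf (\<lambda>(ys, l). (ys, map fst l, map snd l)) (joint (replicate_pmf n (bind_pmf pv ky)) (kernel_seq kxz))"
    unfolding joint_replicate_pmf by (simp add: map_pmf_comp o_def)
  also have "\<dots> = joint (replicate_pmf n (bind_pmf pv ky)) (\<lambda>ys. map_pmf (\<lambda>l. (map fst l, map snd l)) (kernel_seq kxz ys))"
    by (simp add: map_calc)
  finally show ?thesis .
qed

text \<open>A codeword is a pair: a forward word drawn independently of the cloud, and a backward
  word superposed on the centre. Hence \<open>fst\<close> has the same law in every cloud, as the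
  covering requires. Alice decodes from the output of \<open>?D\<close> and Eve sees that of
  \<open>?Z\<close>; in both, the forward and backward parts are independent given the
  codeword.\<close>

lemma block_protocol_exists:
  fixes \<gamma> :: real
  assumes pos: "0 < n" "0 < m" "0 < M" "0 < K" "0 < L"
  defines "\<beta> \<equiv> code_error \<gamma> n m M K L"
  obtains \<pi> :: "('xf, 'yf, 'xb, 'yb) protocol" and Q' where "protocol_wf \<pi>" "n_f \<pi> = n" "n_b \<pi> = m"
    and "range (key \<pi> :: ('xf, 'yf, 'zf, 'xb, 'yb, 'zb) views \<Rightarrow> nat) \<subseteq> {..<K}"
    and "prob_of (execution Wf Wb \<pi>) {\<omega>. key_estimate \<pi> \<omega> \<noteq> key \<pi> \<omega>} \<le> 2 * \<beta>"
    and "near (4 * \<beta>) (map_pmf (\<lambda>\<omega>. (key \<pi> \<omega>, view_eve \<omega>)) (execution Wf Wb \<pi>)) (pair_pmf (pmf_of_set {..<K}) Q')"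
proof -
  let ?PV = "replicate_pmf n pv" and ?P2 = "replicate_pmf m pw2"
  let ?A = "\<lambda>w2. pair_pmf ?PV (kernel_seq pw1 w2)"
  let ?D = "\<lambda>(v, w). pair_pmf (kernel_seq kX v) (kernel_seq kYb w)"
  let ?Z = "\<lambda>(v, w). pair_pmf (kernel_seq kZ v) (kernel_seq kZb w)"
  let ?KXZ = "\<lambda>ys. map_pmf (\<lambda>l. (map fst l, map snd l)) (kernel_seq kxz ys)"
  interpret S: superposition ?P2 ?A M K L
    using pos finite_supports
    by unfold_locales (auto intro: finite_replicate_pmf finite_kernel_seq)
  have kX: "bind_pmf (kernel_seq ky v) (\<lambda>y. map_pmf fst (?KXZ y)) = kernel_seq kX v" for v
    by (simp add: map_pmf_comp o_def map_kernel_seq bind_kernel_seq kX_def[abs_def])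
  have kZ: "bind_pmf (kernel_seq ky v) (\<lambda>y. map_pmf snd (?KXZ y)) = kernel_seq kZ v" for v
    by (simp add: map_pmf_comp o_def map_kernel_seq bind_kernel_seq kZ_def[abs_def])
  have kYb: "bind_pmf (kernel_seq kx w) (\<lambda>x. map_pmf (map fst) (dmbc_seq Wb x)) = kernel_seq kYb w" for w
    by (simp add: dmbc_seq_eq map_kernel_seq bind_kernel_seq kYb_def[abs_def])
  have kZb: "bind_pmf (kernel_seq kx w) (\<lambda>x. map_pmf (map snd) (dmbc_seq Wb x)) = kernel_seq kZb w" for w
    by (simp add: dmbc_seq_eq map_kernel_seq bind_kernel_seq kZb_def[abs_def])
  define A1 A2 A3 B1 B2 B3 where "A1 = 2 powr (real n * (iY + \<gamma>))"
    and "A2 = 2 powr (real n * (iX - \<gamma>))" and "A3 = 2 powr (real n * (iZ + \<gamma>))"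
    and "B1 = 2 powr (real m * (iB - \<gamma>))"
    and "B2 = 2 powr (real m * (iB2 - \<gamma>))" and "B3 = 2 powr (real m * (iE2 + \<gamma>))"
  note AB = A1_def A2_def A3_def B1_def B2_def B3_def
  have nn: "0 < A1" "0 < A2" "0 < A3" "0 < B1" "0 < B2" "0 < B3" by (simp_all add: AB)
  define \<beta>' where "\<beta>' = prob_of (joint ?PV (kernel_seq ky)) {(v, y). pmf (kernel_seq ky v) y > A1 * pmf (bind_pmf ?PV (kernel_seq ky)) y}
      + sqrt (A1 / (real M * real K * real L))
      + prob_of (bind_pmf ?P2 (\<lambda>w. map_pmf (Pair w) (joint (?A w) ?D)))
        {(w, u, y). \<not> (A2 * B1 * pmf (bind_pmf (bind_pmf ?P2 ?A) ?D) y \<le> pmf (?D u) y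
           \<and> A2 * B2 * pmf (bind_pmf (?A w) ?D) y \<le> pmf (?D u) y)}
      + real M * real K * real L / (A2 * B1) + real K * real L / (A2 * B2)
      + prob_of (bind_pmf ?P2 (\<lambda>w. map_pmf (Pair w) (joint (?A w) ?Z)))
        {(w, u, z). pmf (?Z u) z > A3 * B3 * pmf (bind_pmf (?A w) ?Z) z} + sqrt (A3 * B3 / real L)"
  have le: "\<beta>' \<le> \<beta>"
    unfolding \<beta>'_def \<beta>_def code_error_def dY_def AB[symmetric]
  proof (intro add_mono order_refl)
    show "prob_of (bind_pmf ?P2 (\<lambda>w. map_pmf (Pair w) (joint (?A w) ?D)))
        {(w, u, y). \<not> (A2 * B1 * pmf (bind_pmf (bind_pmf ?P2 ?A) ?D) y \<le> pmf (?D u) y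
           \<and> A2 * B2 * pmf (bind_pmf (?A w) ?D) y \<le> pmf (?D u) y)} \<le> dX \<gamma> n + dYb1 \<gamma> m + dYb2 \<gamma> m"
      unfolding dX_def dYb1_def dYb2_def AB[symmetric] bind_replicate_pmf[of m pw2 pw1, symmetric]
      using nn by (intro product_atypical_below) auto
    show "prob_of (bind_pmf ?P2 (\<lambda>w. map_pmf (Pair w) (joint (?A w) ?Z)))
        {(w, u, z). pmf (?Z u) z > A3 * B3 * pmf (bind_pmf (?A w) ?Z) z} \<le> dZ \<gamma> n + dZb \<gamma> m"
      unfolding dZ_def dZb_def AB[symmetric]
      using nn by (intro product_atypical_above) auto
  qed
  obtain u dec Q where u: "\<And>t. t \<in> S.T \<Longrightarrow> u t \<in> set_pmf (bind_pmf ?P2 ?A)"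
    and dec: "\<And>y. dec y < K"
    and cover: "near \<beta>' (bind_pmf ?PV (kernel_seq ky)) (bind_pmf (pmf_of_set S.T) (\<lambda>t. kernel_seq ky (fst (u t))))"
    and decode: "prob_of (joint (pmf_of_set S.T) (\<lambda>t. ?D (u t))) {(t, y). dec y \<noteq> fst (snd t)} \<le> \<beta>'"
    and secret: "near \<beta>' (bind_pmf (pmf_of_set S.T) (\<lambda>t. map_pmf (Pair (fst (snd t))) (?Z (u t))))
      (pair_pmf (pmf_of_set {..<K}) Q)"
  proof (rule S.superposition_code_exists[where f=fst and P="?PV" and W="kernel_seq ky" and D="?D" and Z="?Z"
        and ?a1.0=A1 and ?a3.0="A3 * B3" and ?c1.0="A2 * B1" and ?c2.0="A2 * B2"])
    show "map_pmf fst (?A w) = ?PV" for w by (rule map_fst_pair_pmf)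
  qed (use nn that in \<open>auto simp: \<beta>'_def case_prod_beta intro!: finite_kernel_seq\<close>)
  have PY: "replicate_pmf n (bind_pmf pv ky) = bind_pmf ?PV (kernel_seq ky)" by (rule bind_replicate_pmf[symmetric])
  show thesis
  proof (rule protocol_of_code[where Wf=Wf and Wb=Wb and n=n and m=m and PX="replicate_pmf n px" and PY="replicate_pmf n (bind_pmf pv ky)"
      and KXZ="?KXZ" and T=S.T and s="\<lambda>t. fst (snd t)" and dec=dec and K=K and \<beta>=\<beta> and Q=Q
      and KY="\<lambda>t. kernel_seq ky (fst (u t))" and KXb="\<lambda>t. kernel_seq kx (snd (u t))"])
    show "near \<beta> (replicate_pmf n (bind_pmf pv ky)) (bind_pmf (pmf_of_set S.T) (\<lambda>t. kernel_seq ky (fst (u t))))"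
      unfolding PY by (rule near_mono[OF cover le])
    show "length xs = m" if "t \<in> S.T" "xs \<in> set_pmf (kernel_seq kx (snd (u t)))" for t xs
      using u[OF that(1)] that(2) by (auto dest!: length_kernel_seq length_replicate_pmf)
    show "prob_of (joint (pmf_of_set S.T) (\<lambda>t. pair_pmf (bind_pmf (kernel_seq ky (fst (u t))) (\<lambda>y. map_pmf fst (?KXZ y)))
        (bind_pmf (kernel_seq kx (snd (u t))) (\<lambda>x. map_pmf (map fst) (dmbc_seq Wb x))))) {(t, y). dec y \<noteq> fst (snd t)} \<le> \<beta>"
      unfolding kX kYb using decode le by (simp add: case_prod_beta')
    show "near \<beta> (bind_pmf (pmf_of_set S.T) (\<lambda>t. map_pmf (Pair (fst (snd t))) (pair_pmf (bind_pmf (kernel_seq ky (fst (u t))) (\<lambda>y. map_pmf snd (?KXZ y)))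
        (bind_pmf (kernel_seq kx (snd (u t))) (\<lambda>x. map_pmf (map snd) (dmbc_seq Wb x)))))) (pair_pmf (pmf_of_set {..<K}) Q)"
      unfolding kZ kZb using near_mono[OF secret le] by (simp add: case_prod_beta')
  qed (use pos dec that S.finT reverse_seq in \<open>auto dest!: length_replicate_pmf\<close>)
qed

end

section \<open>Achievable rates\<close>

text \<open>Rounding up keeps every count positive, also at rate 0, and costs at most a factor 2 at
  nonnegative rates.\<close>

definition pow2_ceil :: "real \<Rightarrow> nat \<Rightarrow> nat" where
  "pow2_ceil x m = nat \<lceil>2 powr (real m * x)\<rceil>"

lemma pow2_ceil_ge: "2 powr (real m * x) \<le> real (pow2_ceil x m)"
  unfolding pow2_ceil_def by linarith

lemma pow2_ceil_pos: "0 < pow2_ceil x m"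
  using pow2_ceil_ge[of m x] by (metis powr_gt_zero[of 2 "real m * x"] zero_neq_numeral of_nat_0_less_iff order_less_le_trans)

lemma pow2_ceil_le:
  assumes "0 \<le> x" shows "real (pow2_ceil x m) \<le> 2 * 2 powr (real m * x)"
proof -
  have "1 \<le> 2 powr (real m * x)" using assms by (intro ge_one_powr_ge_zero) auto
  then show ?thesis unfolding pow2_ceil_def by linarith
qed

lemma powr_decay:
  assumes "c < 0"
  shows "(\<lambda>m. C * 2 powr (real m * c)) \<longlonglongrightarrow> 0"
proof -
  have "2 powr (real m * c) = (2 powr c) ^ m" for m
    by (simp add: powr_powr[symmetric] powr_realpow mult.commute)
  moreover have "(\<lambda>m. (2 powr c) ^ m) \<longlonglongrightarrow> 0"
    using assms by (intro LIMSEQ_realpow_zero) (auto simp: powr_less_one)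
  ultimately show ?thesis
    using tendsto_mult[OF tendsto_const[of C]] by fastforce
qed

lemma near_nonneg: "near \<beta> p q \<Longrightarrow> 0 \<le> \<beta>"
  using nearD[of \<beta> p q "{}"] by simp

text \<open>Views are lists of unbounded length, but the rounds of a protocol fix their lengths in
  advance.\<close>

lemma finite_execution:
  fixes Wf :: "('xf::finite, 'yf::finite, 'zf::finite) dmbc" and Wb :: "('xb::finite, 'yb::finite, 'zb::finite) dmbc"
  assumes "protocol_wf \<pi>"
  shows "finite (set_pmf (execution Wf Wb \<pi>))"
proof -
  have fin_seq: "finite (set_pmf (dmbc_seq W xs))" for W :: "'s \<Rightarrow> ('t::finite \<times> 'u::finite) pmf" and xs
    unfolding dmbc_seq_eq by (rule finite_kernel_seq) simp
  have lenfin: "finite (set_pmf q)" if "\<forall>xs\<in>set_pmf q. length xs = j" for q :: "'s::finite list pmf" and j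
    by (rule finite_subset[OF _ finite_lists_length_eq[of UNIV j]]) (use that in auto)
  have fin_round: "finite (set_pmf (run_round Wf Wb r v))" if "round_wf r" for r v
    using that by (cases r; cases v) (auto simp: fin_seq intro!: lenfin)
  have "finite (set_pmf (run_rounds Wf Wb rs v))" if "\<forall>r\<in>set rs. round_wf r" for rs v
    using that by (induction rs arbitrary: v) (auto simp: fin_round)
  then show ?thesis
    using assms unfolding execution_def protocol_wf_def by blast
qed

context ske_kernels
begin

text \<open>Here \<mu>, k and l are the rates of clouds, key and randomization per unit of m. Each
  of the four inequalities makes one exponential term decay: covering, confusion with other clouds,
  confusion inside a cloud, leakage to Eve.\<close>

lemma code_error_vanishes:
  assumes n: "0 < nf" "0 < nb" and \<gamma>: "0 < \<gamma>" and nn: "0 \<le> \<mu>" "0 \<le> k" "0 \<le> l"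
    and 1: "real nf * (iY + \<gamma>) < \<mu> + k + l"
    and 2: "\<mu> + k + l < real nf * (iX - \<gamma>) + real nb * (iB - \<gamma>)"
    and 3: "k + l < real nf * (iX - \<gamma>) + real nb * (iB2 - \<gamma>)"
    and 4: "real nf * (iZ + \<gamma>) + real nb * (iE2 + \<gamma>) < l"
  shows "(\<lambda>m. code_error \<gamma> (nf * m) (nb * m) (pow2_ceil \<mu> m) (pow2_ceil k m) (pow2_ceil l m)) \<longlonglongrightarrow> 0"
proof -
  let ?Y = "\<lambda>m. 2 powr (real (nf * m) * (iY + \<gamma>))" and ?y = "real nf * (iY + \<gamma>)"
  let ?X = "\<lambda>m. 2 powr (real (nf * m) * (iX - \<gamma>))" and ?x = "real nf * (iX - \<gamma>)"
  let ?Z = "\<lambda>m. 2 powr (real (nf * m) * (iZ + \<gamma>))" and ?z = "real nf * (iZ + \<gamma>)"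
  let ?B = "\<lambda>m. 2 powr (real (nb * m) * (iB - \<gamma>))" and ?b = "real nb * (iB - \<gamma>)"
  let ?D = "\<lambda>m. 2 powr (real (nb * m) * (iB2 - \<gamma>))" and ?d = "real nb * (iB2 - \<gamma>)"
  let ?E = "\<lambda>m. 2 powr (real (nb * m) * (iE2 + \<gamma>))" and ?e = "real nb * (iE2 + \<gamma>)"
  have lim_f: "filterlim (\<lambda>m. nf * m) sequentially sequentially" "filterlim (\<lambda>m. nb * m) sequentially sequentially"
    using n by (auto intro!: mult_nat_left_at_top)
  note at = atypicality_vanishes[OF \<gamma>]
  define M K L where "M m = real (pow2_ceil \<mu> m)" and "K m = real (pow2_ceil k m)" and "L m = real (pow2_ceil l m)" for m
  have pos: "0 < M m" "0 < K m" "0 < L m" for m by (simp_all add: M_def K_def L_def pow2_ceil_pos)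
  have lo: "2 powr (real m * \<mu>) \<le> M m" "2 powr (real m * k) \<le> K m" "2 powr (real m * l) \<le> L m" for m
    by (simp_all add: M_def K_def L_def pow2_ceil_ge)
  have up: "M m \<le> 2 * 2 powr (real m * \<mu>)" "K m \<le> 2 * 2 powr (real m * k)" "L m \<le> 2 * 2 powr (real m * l)" for m
    using nn by (simp_all add: M_def K_def L_def pow2_ceil_le)
  \<comment> \<open>The constants 4 and 8 collect a factor 2 for each count that was rounded
    up.\<close>
  have KLup: "K m * L m \<le> 4 * 2 powr (real m * (k + l))" for m
  proof -
    have "K m * L m \<le> (2 * 2 powr (real m * k)) * (2 * 2 powr (real m * l))"
      using pos[of m] by (intro mult_mono up) auto
    then show ?thesis by (simp add: powr_add algebra_simps)
  qed
  have MKLup: "M m * K m * L m \<le> 8 * 2 powr (real m * (\<mu> + k + l))" for m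
  proof -
    have "M m * (K m * L m) \<le> (2 * 2 powr (real m * \<mu>)) * (4 * 2 powr (real m * (k + l)))"
      using pos[of m] by (intro mult_mono up KLup) auto
    then show ?thesis by (simp add: powr_add algebra_simps)
  qed
  have MKLlo: "2 powr (real m * (\<mu> + k + l)) \<le> M m * K m * L m" for m
  proof -
    have "2 powr (real m * \<mu>) * 2 powr (real m * k) * 2 powr (real m * l) \<le> M m * K m * L m"
      using pos[of m] by (intro mult_mono lo) auto
    then show ?thesis by (simp add: powr_add algebra_simps)
  qed
  have s: "(\<lambda>m. sqrt (f m)) \<longlonglongrightarrow> 0" if "\<And>m. 0 \<le> f m" "\<And>m. f m \<le> 2 powr (real m * c)" "c < 0" for f c
    using tendsto_real_sqrt[OF tendsto_0_le[OF that(1,2)], of "\<lambda>x. x"] powr_decay[OF that(3), of 1]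
      tendsto_real_sqrt[OF tendsto_0_le[OF that(1,2)]] by simp
  have t1: "(\<lambda>m. sqrt (?Y m / (M m * K m * L m))) \<longlonglongrightarrow> 0"
  proof (rule s)
    show "?Y m / (M m * K m * L m)
        \<le> 2 powr (real m * (?y - (\<mu> + k + l)))" for m
    proof -
      have "?Y m / (M m * K m * L m)
        \<le> ?Y m / 2 powr (real m * (\<mu> + k + l))"
        using pos[of m] by (intro divide_left_mono MKLlo) auto
      then show ?thesis by (simp add: powr_diff[symmetric] algebra_simps)
    qed
  qed (use 1 pos in \<open>auto intro!: divide_nonneg_nonneg mult_nonneg_nonneg less_imp_le\<close>)
  have t4: "(\<lambda>m. sqrt (?Z m * ?E m / L m)) \<longlonglongrightarrow> 0"
  proof (rule s)
    show "?Z m * ?E m / L m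
        \<le> 2 powr (real m * (?z + ?e - l))" for m
    proof -
      have "?Z m * ?E m / L m
        \<le> ?Z m * ?E m / 2 powr (real m * l)"
        using pos[of m] by (intro divide_left_mono lo) auto
      then show ?thesis by (simp add: powr_add[symmetric] powr_diff[symmetric] algebra_simps)
    qed
  qed (use 4 pos in \<open>auto intro!: divide_nonneg_nonneg mult_nonneg_nonneg less_imp_le\<close>)
  have t2: "(\<lambda>m. M m * K m * L m / (?X m * ?B m)) \<longlonglongrightarrow> 0"
  proof (rule tendsto_0_le[OF _ _ powr_decay])
    show "M m * K m * L m / (?X m * ?B m)
      \<le> 8 * 2 powr (real m * ((\<mu> + k + l) - (?x + ?b)))" for m
    proof -
      have "M m * K m * L m / (?X m * ?B m)
        \<le> 8 * 2 powr (real m * (\<mu> + k + l)) / (?X m * ?B m)"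
        by (intro divide_right_mono MKLup) auto
      also have "\<dots> = 8 * 2 powr (real m * ((\<mu> + k + l) - (?x + ?b)))"
        by (simp add: powr_add[symmetric] powr_diff[symmetric] algebra_simps flip: times_divide_eq_right)
      finally show ?thesis .
    qed
  qed (use 2 pos in \<open>auto intro!: divide_nonneg_nonneg mult_nonneg_nonneg less_imp_le\<close>)
  have t3: "(\<lambda>m. K m * L m / (?X m * ?D m)) \<longlonglongrightarrow> 0"
  proof (rule tendsto_0_le[OF _ _ powr_decay])
    show "K m * L m / (?X m * ?D m)
      \<le> 4 * 2 powr (real m * ((k + l) - (?x + ?d)))" for m
    proof -
      have "K m * L m / (?X m * ?D m)
        \<le> 4 * 2 powr (real m * (k + l)) / (?X m * ?D m)"
        by (intro divide_right_mono KLup) auto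
      also have "\<dots> = 4 * 2 powr (real m * ((k + l) - (?x + ?d)))"
        by (simp add: powr_add[symmetric] powr_diff[symmetric] algebra_simps flip: times_divide_eq_right)
      finally show ?thesis .
    qed
  qed (use 3 pos in \<open>auto intro!: divide_nonneg_nonneg mult_nonneg_nonneg less_imp_le\<close>)
  have cf: "(\<lambda>m. f (nf * m)) \<longlonglongrightarrow> 0" if "f \<longlonglongrightarrow> 0" for f :: "nat \<Rightarrow> real"
    by (rule filterlim_compose[OF that lim_f(1)])
  have cb: "(\<lambda>m. f (nb * m)) \<longlonglongrightarrow> 0" if "f \<longlonglongrightarrow> 0" for f :: "nat \<Rightarrow> real"
    by (rule filterlim_compose[OF that lim_f(2)])
  have "(\<lambda>m. dY \<gamma> (nf * m) + sqrt (?Y m / (M m * K m * L m))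
    + (dX \<gamma> (nf * m) + dYb1 \<gamma> (nb * m) + dYb2 \<gamma> (nb * m))
    + M m * K m * L m / (?X m * ?B m)
    + K m * L m / (?X m * ?D m)
    + (dZ \<gamma> (nf * m) + dZb \<gamma> (nb * m))
    + sqrt (?Z m * ?E m / L m)) \<longlonglongrightarrow> 0"
    by (intro tendsto_add_zero cf[OF at(1)] cf[OF at(2)] cf[OF at(3)] cb[OF at(4)] cb[OF at(5)] cb[OF at(6)] t1 t2 t3 t4)
  then show ?thesis
    unfolding code_error_def M_def K_def L_def .
qed

text \<open>A code error \<beta> leaves the key and Eve's view within 4 \<beta> of uniform and
  independent, so the entropy bounds lose the factor 1 - 16 \<beta>. The condition
  \<open>small\<close> makes both 16 \<beta> and 16 \<beta> k at most \<delta> / 2; the condition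
  \<open>large\<close> absorbs the additive constants from rounding and from log K - 1.\<close>

lemma secure_of_small_error:
  assumes n: "0 < nf" "0 < nb" and m: "0 < m" and k: "0 < k" and \<delta>: "0 < \<delta>" "\<delta> \<le> 1"
    and \<beta>: "code_error \<gamma> (nf * m) (nb * m) (pow2_ceil \<mu> m) (pow2_ceil k m) (pow2_ceil l m) \<le> \<beta>"
    and small: "32 * \<beta> * (1 + k) \<le> \<delta>" and large: "8 < \<delta> * real m * min 1 k"
  shows "\<exists>\<pi>. protocol_wf \<pi> \<and> secure Wf Wb (k / (real nf + real nb)) \<delta> \<pi>"
proof -
  let ?K = "pow2_ceil k m"
  obtain \<pi> :: "('xf, 'yf, 'xb, 'yb) protocol" and Q' where wf: "protocol_wf \<pi>" and nfb: "n_f \<pi> = nf * m" "n_b \<pi> = nb * m"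
    and rng: "range (key \<pi> :: ('xf, 'yf, 'zf, 'xb, 'yb, 'zb) views \<Rightarrow> nat) \<subseteq> {..<?K}"
    and err: "prob_of (execution Wf Wb \<pi>) {\<omega>. key_estimate \<pi> \<omega> \<noteq> key \<pi> \<omega>}
      \<le> 2 * code_error \<gamma> (nf * m) (nb * m) (pow2_ceil \<mu> m) ?K (pow2_ceil l m)"
    and nr: "near (4 * code_error \<gamma> (nf * m) (nb * m) (pow2_ceil \<mu> m) ?K (pow2_ceil l m))
      (map_pmf (\<lambda>\<omega>. (key \<pi> \<omega>, view_eve \<omega>)) (execution Wf Wb \<pi>)) (pair_pmf (pmf_of_set {..<?K}) Q')"
    by (rule block_protocol_exists[of "nf * m" "nb * m" "pow2_ceil \<mu> m" ?K "pow2_ceil l m" \<gamma>])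
      (use n m in \<open>auto simp: pow2_ceil_pos\<close>)
  let ?p = "execution Wf Wb \<pi>"
  have nr: "near (4 * \<beta>) (map_pmf (\<lambda>\<omega>. (key \<pi> \<omega>, view_eve \<omega>)) ?p) (pair_pmf (pmf_of_set {..<?K}) Q')"
    by (rule near_mono[OF nr]) (use \<beta> in simp)
  have \<beta>0: "0 \<le> \<beta>" using near_nonneg[OF nr] by simp
  have \<beta>s: "32 * \<beta> \<le> \<delta>" "32 * \<beta> * k \<le> \<delta>"
    using small \<beta>0 mult_nonneg_nonneg[OF \<beta>0 less_imp_le[OF k]] by (auto simp: algebra_simps)
  have fin: "finite (set_pmf ?p)" by (rule finite_execution[OF wf])
  have logK: "real m * k \<le> log 2 (real ?K)" "log 2 (real ?K) \<le> real m * k + 1"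
  proof -
    have "log 2 (2 powr (real m * k)) \<le> log 2 (real ?K)"
      using pow2_ceil_ge[of m k] pow2_ceil_pos[of k m] by (subst log_le_cancel_iff) auto
    then show "real m * k \<le> log 2 (real ?K)" by simp
    have "log 2 (real ?K) \<le> log 2 (2 * 2 powr (real m * k))"
      using pow2_ceil_le[of k m] pow2_ceil_pos[of k m] k by (subst log_le_cancel_iff) auto
    then show "log 2 (real ?K) \<le> real m * k + 1" by (simp add: log_mult)
  qed
  have mk: "8 < \<delta> * (real m * k)" "8 < \<delta> * real m"
  proof -
    have "\<delta> * real m * min 1 k \<le> \<delta> * real m * k" "\<delta> * real m * min 1 k \<le> \<delta> * real m * 1"
      using \<delta> by (intro mult_left_mono; simp)+
    then show "8 < \<delta> * (real m * k)" "8 < \<delta> * real m" using large by (auto simp: mult.assoc)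
  qed
  have mk8: "8 < real m * k" using mk(1) \<delta> mult_right_mono[of \<delta> 1 "real m * k"] k by simp
  have small4: "4 * (4 * \<beta>) \<le> 1" using \<beta>s \<delta> by simp
  have lower: "(1 - 16 * \<beta>) * (real m * k - 1) \<le> (1 - 4 * (4 * \<beta>)) * (log 2 (real ?K) - 1)"
    using logK small4 by (simp add: mult_left_mono)
  have ce: "(1 - 16 * \<beta>) * (real m * k - 1) \<le> cond_ent ?p (key \<pi>) view_eve"
    using cond_ent_ge[OF fin pow2_ceil_pos small4 nr] lower by linarith
  have "near (4 * \<beta>) (map_pmf (key \<pi>) ?p) (pmf_of_set {..<?K})"
    using near_map[OF nr, of fst] by (simp add: map_pmf_comp o_def map_fst_pair_pmf)
  from ent_ge[OF fin pow2_ceil_pos small4 this] lower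
  have en: "(1 - 16 * \<beta>) * (real m * k - 1) \<le> ent ?p (key \<pi>)" by linarith
  have rf: "finite (range (key \<pi> :: ('xf, 'yf, 'zf, 'xb, 'yb, 'zb) views \<Rightarrow> nat))"
    using rng by (rule finite_subset) simp
  have "card (range (key \<pi> :: ('xf, 'yf, 'zf, 'xb, 'yb, 'zb) views \<Rightarrow> nat)) \<le> ?K"
    using card_mono[OF _ rng] by simp
  from ent_le_log_card[OF rf this, of ?p] have eu: "ent ?p (key \<pi>) \<le> real m * k + 1" using logK by linarith
  have b16: "16 * \<beta> * (real m * k - 1) \<le> \<delta> / 2 * real m"
  proof -
    have "16 * \<beta> * (real m * k - 1) \<le> 16 * \<beta> * (real m * k)" using \<beta>0 by (intro mult_left_mono) auto
    also have "\<dots> = (16 * \<beta> * k) * real m" by simp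
    also have "\<dots> \<le> (\<delta> / 2) * real m" using \<beta>s by (intro mult_right_mono) auto
    finally show ?thesis .
  qed
  have rate: "k / (real nf + real nb) - \<delta> < ent ?p (key \<pi>) / real (n_f \<pi> + n_b \<pi>)"
  proof -
    have N: "0 < (real nf + real nb) * real m" using n m by simp
    have "(k / (real nf + real nb) - \<delta>) * ((real nf + real nb) * real m) = k * real m - \<delta> * real m * (real nf + real nb)"
      using n by (simp add: field_simps)
    also have "\<dots> \<le> k * real m - \<delta> * real m * 1"
      using n \<delta> by (intro diff_left_mono mult_left_mono) auto
    also have "\<dots> < (1 - 16 * \<beta>) * (real m * k - 1)"
      using b16 mk(2) by (simp add: algebra_simps)
    also have "\<dots> \<le> ent ?p (key \<pi>)" by (rule en)
    finally have "k / (real nf + real nb) - \<delta> < ent ?p (key \<pi>) / ((real nf + real nb) * real m)"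
      by (subst pos_less_divide_eq[OF N])
    then show ?thesis using nfb by (simp add: algebra_simps)
  qed
  have error: "prob_of ?p {\<omega>. key_estimate \<pi> \<omega> \<noteq> key \<pi> \<omega>} < \<delta>"
    using err \<beta> \<beta>s \<delta> by linarith
  have secrecy: "ent ?p (key \<pi>) = 0 \<or> cond_ent ?p (key \<pi>) view_eve / ent ?p (key \<pi>) > 1 - \<delta>"
  proof -
    have "0 < (1 - 16 * \<beta>) * (real m * k - 1)"
      using mk8 \<beta>s \<delta> by (intro mult_pos_pos) auto
    then have e0: "0 < ent ?p (key \<pi>)" using en by linarith
    have "(1 - \<delta>) * ent ?p (key \<pi>) \<le> (1 - \<delta>) * (real m * k + 1)"
      using eu \<delta> by (intro mult_left_mono) auto
    also have "\<dots> < (1 - \<delta> / 2) * (real m * k - 1)"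
      using mk(1) \<delta> by (simp add: algebra_simps)
    also have "\<dots> \<le> (1 - 16 * \<beta>) * (real m * k - 1)"
      using \<beta>s mk8 by (intro mult_right_mono) auto
    also note ce
    finally show ?thesis using e0 by (simp add: pos_less_divide_eq)
  qed
  show ?thesis
    using wf rate error secrecy unfolding secure_def Let_def by blast
qed

text \<open>Up to margins the constraints are a < \<mu> + k + l < b, k + l < c and d < l, with a the
  covering rate, b the total rate that Alice can decode, c the rate she can decode inside a cloud,
  and d the rate of Eve's observation. The hypotheses give a < b, c <= b and k + d < c, which makes
  them solvable with \<mu> >= 0.\<close>

theorem achievable_rate:
  assumes n: "0 < nf" "0 < nb" and k: "0 < k"
    and nonneg: "0 \<le> iZ" "0 \<le> iE2"
    and chain: "iB2 \<le> iB"
    and cover: "real nf * iY < real nf * iX + real nb * iB"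
    and rate: "k < real nf * (iX - iZ) + real nb * (iB2 - iE2)"
  shows "achievable Wf Wb (k / (real nf + real nb))"
proof -
  define a where "a = real nf * iY"
  define b where "b = real nf * iX + real nb * iB"
  define c where "c = real nf * iX + real nb * iB2"
  define d where "d = real nf * iZ + real nb * iE2"
  have ab: "a < b" and cb: "c \<le> b" and d0: "0 \<le> d" and kdc: "k + d < c"
    using cover chain nonneg rate mult_left_mono[OF chain, of "real nb"]
    by (auto simp: a_def b_def c_def d_def algebra_simps)
  \<comment> \<open>The midpoint of the interval from d to c - k.\<close>
  define l where "l = (d + (c - k)) / 2"
  have l: "d < l" "k + l < c" using kdc by (auto simp: l_def field_simps)
  \<comment> \<open>The clouds raise the total rate to the middle of the interval from a to b. If k
    + l already lies beyond it, \<mu> = 0 will do, because k + l < c <= b.\<close>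
  define \<mu> where "\<mu> = max 0 ((a + b) / 2 - (k + l))"
  have \<mu>: "0 \<le> \<mu>" "a < \<mu> + k + l" "\<mu> + k + l < b"
    unfolding \<mu>_def using ab l cb by (cases "(a + b) / 2 \<le> k + l"; simp add: max_def field_simps)+
  \<comment> \<open>The least slack in the four strict inequalities. The choice of \<gamma> lets the
    typicality margins of all letters together use up g / 2.\<close>
  define g where "g = min (min (\<mu> + k + l - a) (b - (\<mu> + k + l))) (min (c - (k + l)) (l - d))"
  define \<gamma> where "\<gamma> = g / (2 * (real nf + real nb))"
  have g: "0 < g" using \<mu> l by (simp add: g_def)
  have \<gamma>: "0 < \<gamma>" using g n by (simp add: \<gamma>_def)
  have sum: "(real nf + real nb) * \<gamma> = g / 2"
  proof -
    have *: "N * (g / (2 * N)) = g / 2" if "N \<noteq> 0" for N :: real using that by simp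
    show ?thesis unfolding \<gamma>_def by (rule *) (use n in simp)
  qed
  have part: "real nf * \<gamma> \<le> g / 2" using sum \<gamma> by (simp add: algebra_simps) (smt (verit) \<gamma> mult_nonneg_nonneg of_nat_0_le_iff)
  have gs: "g \<le> \<mu> + k + l - a" "g \<le> b - (\<mu> + k + l)" "g \<le> c - (k + l)" "g \<le> l - d" by (auto simp: g_def)
  have vanish: "(\<lambda>m. code_error \<gamma> (nf * m) (nb * m) (pow2_ceil \<mu> m) (pow2_ceil k m) (pow2_ceil l m)) \<longlonglongrightarrow> 0"
  proof (rule code_error_vanishes[OF n \<gamma> \<mu>(1)])
    show "0 \<le> k" "0 \<le> l" using k l d0 by auto
    show "real nf * (iY + \<gamma>) < \<mu> + k + l"
      using gs(1) part g by (simp add: a_def algebra_simps)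
    show "\<mu> + k + l < real nf * (iX - \<gamma>) + real nb * (iB - \<gamma>)"
      using gs(2) sum g by (simp add: b_def algebra_simps)
    show "k + l < real nf * (iX - \<gamma>) + real nb * (iB2 - \<gamma>)"
      using gs(3) sum g by (simp add: c_def algebra_simps)
    show "real nf * (iZ + \<gamma>) + real nb * (iE2 + \<gamma>) < l"
      using gs(4) sum g by (simp add: d_def algebra_simps)
  qed
  show ?thesis
    unfolding achievable_def
  proof (intro conjI allI impI)
    show "0 \<le> k / (real nf + real nb)" using k by simp
    fix \<delta> :: real assume \<delta>: "0 < \<delta> \<and> \<delta> \<le> 1"
    define \<beta> where "\<beta> = \<delta> / (32 * (1 + k))"
    have \<beta>: "0 < \<beta>" "32 * \<beta> * (1 + k) \<le> \<delta>" using \<delta> k by (auto simp: \<beta>_def field_simps)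
    have "eventually (\<lambda>m. code_error \<gamma> (nf * m) (nb * m) (pow2_ceil \<mu> m) (pow2_ceil k m) (pow2_ceil l m) < \<beta>) sequentially"
      by (rule order_tendstoD(2)[OF vanish \<beta>(1)])
    moreover have "eventually (\<lambda>m. real m > 8 / (\<delta> * min 1 k)) sequentially"
      using filterlim_real_sequentially by (simp add: filterlim_at_top_dense)
    moreover have "eventually (\<lambda>m::nat. 0 < m) sequentially" by (rule eventually_gt_at_top)
    ultimately have "eventually (\<lambda>m. code_error \<gamma> (nf * m) (nb * m) (pow2_ceil \<mu> m) (pow2_ceil k m) (pow2_ceil l m) < \<beta>
        \<and> real m > 8 / (\<delta> * min 1 k) \<and> 0 < m) sequentially" by eventually_elim auto
    then obtain m where m: "code_error \<gamma> (nf * m) (nb * m) (pow2_ceil \<mu> m) (pow2_ceil k m) (pow2_ceil l m) < \<beta>"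
        "real m > 8 / (\<delta> * min 1 k)" "0 < m"
      unfolding eventually_sequentially by blast
    have "8 < \<delta> * real m * min 1 k"
      using m(2) \<delta> k by (simp add: pos_divide_less_eq mult_ac)
    then show "\<exists>\<pi>. protocol_wf \<pi> \<and> secure Wf Wb (k / (real nf + real nb)) \<delta> \<pi>"
      using secure_of_small_error[OF n m(3) k _ _ less_imp_le[OF m(1)] \<beta>(2)] \<delta> by blast
  qed
qed

end

section \<open>Mutual information of random variables and of channels\<close>

lemma pmf_joint: "pmf (joint P K) (a, b) = pmf P a * pmf (K a) b"
proof -
  have K: "pmf (map_pmf (Pair u) (K u)) (a, b) = indicator {a} u * pmf (K a) b" for u
  proof (cases "u = a")
    case True
    then show ?thesis by (simp add: pmf_map_inj' inj_on_def)
  next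
    case False
    then have "Pair u -` {(a, b)} = {}" by auto
    then show ?thesis using False by (simp add: pmf_map)
  qed
  show ?thesis
    by (simp add: pmf_bind K measure_pmf_single)
qed

lemma joint_snd: "map_pmf snd (joint P K) = bind_pmf P K"
  by (simp add: map_calc)

text \<open>Gibbs' inequality: ln x <= x - 1 for x = Q / W, whose mean is at most 1 because it only
  collects the mass of Q on the support of \<open>W u\<close>.\<close>

lemma minfo_nonneg:
  assumes "finite (set_pmf P)" "\<And>u. finite (set_pmf (W u))"
  shows "0 \<le> minfo P W"
proof -
  let ?Q = "bind_pmf P W"
  have fin: "finite (set_pmf (joint P W))" using assms by auto
  have "mean (joint P W) (\<lambda>(u, y). pmf ?Q y / pmf (W u) y)
      = mean P (\<lambda>u. mean (W u) (\<lambda>y. pmf ?Q y / pmf (W u) y))"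
    using assms by (subst expectation_joint) auto
  also have "\<dots> \<le> mean P (\<lambda>u. 1)"
  proof (intro integral_mono integrable_measure_pmf_finite assms)
    fix u
    have "mean (W u) (\<lambda>y. pmf ?Q y / pmf (W u) y) = (\<Sum>y\<in>set_pmf (W u). pmf ?Q y)"
      by (subst integral_measure_pmf[OF assms(2)[of u]]) (auto simp: set_pmf_iff)
    also have "\<dots> = prob_of ?Q (set_pmf (W u))"
      using assms(2) by (simp add: measure_measure_pmf_finite)
    finally show "mean (W u) (\<lambda>y. pmf ?Q y / pmf (W u) y) \<le> 1" by simp
  qed
  finally have E: "mean (joint P W) (\<lambda>(u, y). pmf ?Q y / pmf (W u) y) \<le> 1" by simp
  have "0 \<le> (1 - mean (joint P W) (\<lambda>(u, y). pmf ?Q y / pmf (W u) y)) / ln 2"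
    using E by simp
  also have "\<dots> = mean (joint P W) (\<lambda>x. (1 - (case x of (u, y) \<Rightarrow> pmf ?Q y / pmf (W u) y)) / ln 2)"
    by (subst integral_divide_zero, subst Bochner_Integration.integral_diff) (auto intro: integrable_measure_pmf_finite fin)
  also have "\<dots> \<le> minfo P W"
    unfolding minfo_def
  proof (rule integral_mono_AE)
    show "AE x in joint P W. (1 - (case x of (u, y) \<Rightarrow> pmf ?Q y / pmf (W u) y)) / ln 2
        \<le> (case x of (u, y) \<Rightarrow> log 2 (pmf (W u) y / pmf ?Q y))"
      unfolding AE_measure_pmf_iff
    proof safe
      fix u y assume "(u, y) \<in> set_pmf (joint P W)"
      then have p: "0 < pmf (W u) y" "0 < pmf ?Q y" by (auto simp: pmf_positive intro: pmf_bind_pos)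
      then have "ln (pmf ?Q y / pmf (W u) y) \<le> pmf ?Q y / pmf (W u) y - 1" by (intro ln_le_minus_one) auto
      moreover have "ln (pmf ?Q y / pmf (W u) y) = - ln (pmf (W u) y / pmf ?Q y)" using p by (simp add: ln_div)
      ultimately have "1 - pmf ?Q y / pmf (W u) y \<le> ln (pmf (W u) y / pmf ?Q y)" by linarith
      then show "(1 - pmf ?Q y / pmf (W u) y) / ln 2 \<le> log 2 (pmf (W u) y / pmf ?Q y)"
        unfolding log_def by (intro divide_right_mono) auto
    qed
  qed (auto intro: integrable_measure_pmf_finite fin)
  finally show ?thesis .
qed

lemma cminfo_eq:
  assumes "finite (set_pmf P2)" "\<And>w. finite (set_pmf (A w))" "\<And>u. finite (set_pmf (W u))"
  shows "cminfo P2 A W = mean P2 (\<lambda>w. minfo (A w) W)"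
  unfolding cminfo_def minfo_def
  by (subst expectation_bind_finite) (use assms in auto)

lemma cminfo_nonneg:
  assumes "finite (set_pmf P2)" "\<And>w. finite (set_pmf (A w))" "\<And>u. finite (set_pmf (W u))"
  shows "0 \<le> cminfo P2 A W"
  unfolding cminfo_eq[OF assms] using assms by (auto intro!: integral_nonneg_AE minfo_nonneg)

text \<open>Chain rule along w -> u -> y, where y is independent of w given u. With the last summand
  nonnegative, it shows that the information inside a cloud is at most the total.\<close>

lemma minfo_chain:
  assumes fin: "finite (set_pmf P2)" "\<And>w. finite (set_pmf (A w))" "\<And>u. finite (set_pmf (W u))"
  shows "minfo (bind_pmf P2 A) W = cminfo P2 A W + minfo P2 (\<lambda>w. bind_pmf (A w) W)"
proof -
  let ?J = "bind_pmf P2 (\<lambda>w. map_pmf (Pair w) (joint (A w) W))"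
  let ?Q = "bind_pmf (bind_pmf P2 A) W"
  have finJ: "finite (set_pmf ?J)" using fin by auto
  note int = integrable_measure_pmf_finite[OF finJ]
  have 1: "joint (bind_pmf P2 A) W = map_pmf snd ?J"
    by (simp add: joint_bind_pmf map_calc)
  have 2: "joint P2 (\<lambda>w. bind_pmf (A w) W) = map_pmf (\<lambda>x. (fst x, snd (snd x))) ?J"
    by (simp add: map_calc)
  have "minfo (bind_pmf P2 A) W = mean ?J (\<lambda>x. log 2 (pmf (W (fst (snd x))) (snd (snd x)) / pmf ?Q (snd (snd x))))"
    unfolding minfo_def 1 by (simp add: case_prod_beta')
  also have "\<dots> = mean ?J (\<lambda>x. log 2 (pmf (W (fst (snd x))) (snd (snd x)) / pmf (bind_pmf (A (fst x)) W) (snd (snd x)))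
      + log 2 (pmf (bind_pmf (A (fst x)) W) (snd (snd x)) / pmf ?Q (snd (snd x))))"
  proof (rule integral_cong_AE)
    show "AE x in ?J. log 2 (pmf (W (fst (snd x))) (snd (snd x)) / pmf ?Q (snd (snd x)))
      = log 2 (pmf (W (fst (snd x))) (snd (snd x)) / pmf (bind_pmf (A (fst x)) W) (snd (snd x)))
      + log 2 (pmf (bind_pmf (A (fst x)) W) (snd (snd x)) / pmf ?Q (snd (snd x)))"
      unfolding AE_measure_pmf_iff
    proof
      fix x assume "x \<in> set_pmf ?J"
      then obtain w u y where x: "x = (w, u, y)" "w \<in> set_pmf P2" "u \<in> set_pmf (A w)" "y \<in> set_pmf (W u)" by auto
      have "0 < pmf (W u) y" "0 < pmf (bind_pmf (A w) W) y" "0 < pmf ?Q y"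
        using x by (intro pmf_positive; force)+
      then show "log 2 (pmf (W (fst (snd x))) (snd (snd x)) / pmf ?Q (snd (snd x)))
      = log 2 (pmf (W (fst (snd x))) (snd (snd x)) / pmf (bind_pmf (A (fst x)) W) (snd (snd x)))
      + log 2 (pmf (bind_pmf (A (fst x)) W) (snd (snd x)) / pmf ?Q (snd (snd x)))"
        by (simp add: x log_divide)
    qed
  qed auto
  also have "\<dots> = cminfo P2 A W + minfo P2 (\<lambda>w. bind_pmf (A w) W)"
    unfolding cminfo_def minfo_def 2
    by (subst Bochner_Integration.integral_add, rule int, rule int) (simp add: case_prod_beta' bind_assoc_pmf)
  finally show ?thesis .
qed

text \<open>If a word equals its centre, nothing is left to learn inside the cloud. This is the
  choice W_2 = W_1, which replaces a negative backward term of the bound by 0.\<close>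

lemma cminfo_return: "cminfo P return_pmf W = 0"
  unfolding cminfo_def
  by (rule integral_eq_zero_AE) (auto simp: AE_measure_pmf_iff bind_return_pmf set_pmf_iff)

text \<open>The bridge from random variables to kernels. Any version of the conditional law may be
  used, since values v of mass zero do not enter the mean.\<close>

lemma mut_inf_kernel:
  assumes fin: "finite (range V)" "finite (range X)"
    and K: "map_pmf (\<lambda>i. (V i, X i)) p = joint (map_pmf V p) K"
  shows "mut_inf p V X = minfo (map_pmf V p) K"
proof -
  have X: "map_pmf X p = bind_pmf (map_pmf V p) K"
    using arg_cong[OF K, of "map_pmf snd"] by (simp only: joint_snd) (simp add: map_pmf_comp o_def)
  show ?thesis
    unfolding mut_inf_eq[OF fin] minfo_def K X
  proof (rule integral_cong_AE)
    show "AE x in joint (map_pmf V p) K. (case x of (x, y) \<Rightarrow> log 2 (pmf (joint (map_pmf V p) K) (x, y) / (pmf (map_pmf V p) x * pmf (bind_pmf (map_pmf V p) K) y)))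
      = (case x of (u, y) \<Rightarrow> log 2 (pmf (K u) y / pmf (bind_pmf (map_pmf V p) K) y))"
      unfolding AE_measure_pmf_iff pmf_joint
    proof safe
      fix v x assume "(v, x) \<in> set_pmf (joint (map_pmf V p) K)"
      then have "v \<in> set_pmf (map_pmf V p)" by auto
      then have "0 < pmf (map_pmf V p) v" by (rule pmf_positive)
      then show "log 2 (pmf (map_pmf V p) v * pmf (K v) x / (pmf (map_pmf V p) v * pmf (bind_pmf (map_pmf V p) K) x))
        = log 2 (pmf (K v) x / pmf (bind_pmf (map_pmf V p) K) x)"
        by simp
    qed
  qed auto
qed

lemma cond_mut_inf_kernel:
  assumes fin: "finite (range X)" "finite (range Y)" "finite (range Z)"
    and K: "map_pmf (\<lambda>i. (Z i, X i, Y i)) p = bind_pmf (map_pmf Z p) (\<lambda>z. map_pmf (Pair z) (joint (A z) K))"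
  shows "cond_mut_inf p X Y Z = cminfo (map_pmf Z p) A K"
proof -
  let ?J = "joint (map_pmf Z p) (\<lambda>z. joint (A z) K)"
  have XYZ: "pmf (map_pmf (\<lambda>i. (X i, Y i, Z i)) p) (x, y, z) = pmf (map_pmf Z p) z * (pmf (A z) x * pmf (K x) y)" for x y z
  proof -
    have "pmf (map_pmf (\<lambda>i. (X i, Y i, Z i)) p) (x, y, z)
        = pmf (map_pmf (\<lambda>(z, x, y). (x, y, z)) (map_pmf (\<lambda>i. (Z i, X i, Y i)) p)) ((\<lambda>(z, x, y). (x, y, z)) (z, x, y))"
      by (simp add: map_pmf_comp o_def)
    also have "\<dots> = pmf ?J (z, x, y)"
      unfolding K by (rule pmf_map_inj') (auto simp: inj_on_def)
    finally show ?thesis by (simp only: pmf_joint)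
  qed
  have XZ: "pmf (map_pmf (\<lambda>i. (X i, Z i)) p) (x, z) = pmf (map_pmf Z p) z * pmf (A z) x" for x z
  proof -
    have "map_pmf (\<lambda>i. (X i, Z i)) p = map_pmf (\<lambda>(z, x). (x, z)) (map_pmf (apsnd fst) (map_pmf (\<lambda>i. (Z i, X i, Y i)) p))"
      by (simp add: map_pmf_comp o_def)
    also have "map_pmf (apsnd fst) (map_pmf (\<lambda>i. (Z i, X i, Y i)) p) = joint (map_pmf Z p) A"
      unfolding K by (simp add: map_calc bind_return_pmf' map_pmf_def[symmetric])
    finally have "pmf (map_pmf (\<lambda>i. (X i, Z i)) p) (x, z) = pmf (map_pmf (\<lambda>(z, x). (x, z)) (joint (map_pmf Z p) A)) ((\<lambda>(z, x). (x, z)) (z, x))"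
      by simp
    also have "\<dots> = pmf (joint (map_pmf Z p) A) (z, x)"
      by (rule pmf_map_inj') (auto simp: inj_on_def)
    finally show ?thesis by (simp only: pmf_joint)
  qed
  have YZ: "pmf (map_pmf (\<lambda>i. (Y i, Z i)) p) (y, z) = pmf (map_pmf Z p) z * pmf (bind_pmf (A z) K) y" for y z
  proof -
    have "map_pmf (\<lambda>i. (Y i, Z i)) p = map_pmf (\<lambda>(z, x). (x, z)) (map_pmf (apsnd snd) (map_pmf (\<lambda>i. (Z i, X i, Y i)) p))"
      by (simp add: map_pmf_comp o_def)
    also have "map_pmf (apsnd snd) (map_pmf (\<lambda>i. (Z i, X i, Y i)) p) = joint (map_pmf Z p) (\<lambda>z. bind_pmf (A z) K)"
      unfolding K by (simp add: map_calc)
    finally have "pmf (map_pmf (\<lambda>i. (Y i, Z i)) p) (y, z) = pmf (map_pmf (\<lambda>(z, x). (x, z)) (joint (map_pmf Z p) (\<lambda>z. bind_pmf (A z) K))) ((\<lambda>(z, x). (x, z)) (z, y))"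
      by simp
    also have "\<dots> = pmf (joint (map_pmf Z p) (\<lambda>z. bind_pmf (A z) K)) (z, y)"
      by (rule pmf_map_inj') (auto simp: inj_on_def)
    finally show ?thesis by (simp only: pmf_joint)
  qed
  have L: "map_pmf (\<lambda>i. (X i, Y i, Z i)) p = map_pmf (\<lambda>(z, x, y). (x, y, z)) ?J"
    unfolding K[symmetric] by (simp add: map_pmf_comp o_def)
  have "cond_mut_inf p X Y Z = mean ?J (\<lambda>(z, x, y). log 2 (pmf (map_pmf Z p) z * (pmf (A z) x * pmf (K x) y) /
       (pmf (map_pmf Z p) z * pmf (A z) x * (pmf (map_pmf Z p) z * pmf (bind_pmf (A z) K) y / pmf (map_pmf Z p) z))))"
    unfolding cond_mut_inf_eq[OF fin] XYZ XZ YZ unfolding L integral_map_pmf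
    by (rule Bochner_Integration.integral_cong[OF refl]) (simp only: case_prod_beta fst_conv snd_conv)
  also have "\<dots> = cminfo (map_pmf Z p) A K"
    unfolding cminfo_def
  proof (rule integral_cong_AE)
    show "AE x in ?J. (case x of (z, x, y) \<Rightarrow> log 2 (pmf (map_pmf Z p) z * (pmf (A z) x * pmf (K x) y) /
       (pmf (map_pmf Z p) z * pmf (A z) x * (pmf (map_pmf Z p) z * pmf (bind_pmf (A z) K) y / pmf (map_pmf Z p) z))))
      = (case x of (w, u, y) \<Rightarrow> log 2 (pmf (K u) y / pmf (bind_pmf (A w) K) y))"
      unfolding AE_measure_pmf_iff
    proof safe
      fix z x y assume "(z, x, y) \<in> set_pmf ?J"
      then have "0 < pmf ?J (z, x, y)" by (rule pmf_positive)
      then have "pmf (map_pmf Z p) z \<noteq> 0" "pmf (A z) x \<noteq> 0"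
        unfolding pmf_joint by auto
      then show "log 2 (pmf (map_pmf Z p) z * (pmf (A z) x * pmf (K x) y) /
         (pmf (map_pmf Z p) z * pmf (A z) x * (pmf (map_pmf Z p) z * pmf (bind_pmf (A z) K) y / pmf (map_pmf Z p) z)))
        = log 2 (pmf (K x) y / pmf (bind_pmf (A z) K) y)"
        by simp
    qed
  qed auto
  finally show ?thesis .
qed

text \<open>Divided by the mass of b, the product form of the Markov property says that a
  conditional law given B alone also serves given (A, B).\<close>

lemma markov3_kernel:
  fixes A :: "'w \<Rightarrow> 'a" and B :: "'w \<Rightarrow> 'b" and C :: "'w \<Rightarrow> 'c"
  assumes m: "markov3 p A B C" and K: "map_pmf (\<lambda>i. (B i, C i)) p = joint (map_pmf B p) K"
  shows "map_pmf (\<lambda>i. (A i, B i, C i)) p = bind_pmf (map_pmf (\<lambda>i. (A i, B i)) p) (\<lambda>(a, b). map_pmf (\<lambda>c. (a, b, c)) (K b))"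
proof -
  have "map_pmf (\<lambda>i. ((A i, B i), C i)) p = joint (map_pmf (\<lambda>i. (A i, B i)) p) (\<lambda>ab. K (snd ab))"
  proof (rule pmf_eqI)
    fix x :: "('a \<times> 'b) \<times> 'c"
    obtain a b c where x: "x = ((a, b), c)" by (metis surj_pair)
    have "pmf (map_pmf (\<lambda>i. ((A i, B i), C i)) p) x = pmf (map_pmf (\<lambda>i. (A i, B i, C i)) p) (a, b, c)"
      by (simp add: x pmf_map vimage_def)
    also have "\<dots> = pmf (map_pmf (\<lambda>i. (A i, B i)) p) (a, b) * pmf (K b) c"
    proof (cases "pmf (map_pmf B p) b = 0")
      \<comment> \<open>At values b of mass zero the product form is void, but both sides vanish
        there.\<close>
      case True
      have "pmf (map_pmf (\<lambda>i. (A i, B i)) p) (a, b) \<le> pmf (map_pmf B p) b"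
        "pmf (map_pmf (\<lambda>i. (A i, B i, C i)) p) (a, b, c) \<le> pmf (map_pmf B p) b"
        unfolding pmf_map by (intro measure_pmf.finite_measure_mono; auto)+
      then show ?thesis using True
        using pmf_nonneg[of "map_pmf (\<lambda>i. (A i, B i)) p" "(a, b)"]
          pmf_nonneg[of "map_pmf (\<lambda>i. (A i, B i, C i)) p" "(a, b, c)"] by simp
    next
      case False
      have "pmf (map_pmf (\<lambda>i. (B i, C i)) p) (b, c) = pmf (map_pmf B p) b * pmf (K b) c"
        unfolding K by (rule pmf_joint)
      then have "pmf (map_pmf (\<lambda>i. (A i, B i, C i)) p) (a, b, c) * pmf (map_pmf B p) b
          = pmf (map_pmf (\<lambda>i. (A i, B i)) p) (a, b) * pmf (K b) c * pmf (map_pmf B p) b"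
        using m unfolding markov3_def by (simp only: mult_ac)
      then show ?thesis by (simp only: mult_right_cancel[OF False])
    qed
    also have "\<dots> = pmf (joint (map_pmf (\<lambda>i. (A i, B i)) p) (\<lambda>ab. K (snd ab))) x"
      unfolding x pmf_joint by simp
    finally show "pmf (map_pmf (\<lambda>i. ((A i, B i), C i)) p) x = pmf (joint (map_pmf (\<lambda>i. (A i, B i)) p) (\<lambda>ab. K (snd ab))) x" .
  qed
  from arg_cong[OF this, of "map_pmf (\<lambda>((a, b), c). (a, b, c))"] show ?thesis
    by (simp add: map_pmf_comp o_def map_bind_pmf case_prod_beta')
qed

lemma consistent_joint:
  fixes X :: "'w \<Rightarrow> 'x" and Y :: "'w \<Rightarrow> 'y" and Z :: "'w \<Rightarrow> 'z"
  assumes "consistent W p X Y Z"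
  shows "map_pmf (\<lambda>i. (X i, Y i, Z i)) p = joint (map_pmf X p) W"
proof (rule pmf_eqI)
  fix t :: "'x \<times> 'y \<times> 'z"
  obtain x y z where t: "t = (x, y, z)" by (metis surj_pair)
  show "pmf (map_pmf (\<lambda>i. (X i, Y i, Z i)) p) t = pmf (joint (map_pmf X p) W) t"
    using assms unfolding t consistent_def pmf_joint by blast
qed

text \<open>I(V;Y,X) equals I(V;X) + I(V;Y|X) by the chain rule, and I(V;Y) because X tells nothing
  about V beyond Y. Pointwise, the factor \<open>K y\<close> cancels inside the logarithm. The
  identity turns the constraint on I(V_f;Y_f|X_f) into one on \<open>iY\<close> and
  \<open>iX\<close>.\<close>

lemma cond_mut_inf_markov:
  assumes fin: "finite (range V)" "finite (range Y)" "finite (range X)"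
    and K: "map_pmf (\<lambda>i. (V i, Y i, X i)) p = bind_pmf (map_pmf (\<lambda>i. (V i, Y i)) p) (\<lambda>(v, y). map_pmf (\<lambda>x. (v, y, x)) (K y))"
  shows "cond_mut_inf p V Y X = mut_inf p V Y - mut_inf p V X"
proof -
  let ?J = "map_pmf (\<lambda>i. (V i, Y i, X i)) p"
  let ?VY = "pmf (map_pmf (\<lambda>i. (V i, Y i)) p)" and ?VX = "pmf (map_pmf (\<lambda>i. (V i, X i)) p)"
  let ?V = "pmf (map_pmf V p)" and ?Y = "pmf (map_pmf Y p)" and ?X = "pmf (map_pmf X p)"
  have finJ: "finite (set_pmf ?J)"
    by (rule finite_subset[of _ "range V \<times> range Y \<times> range X"]) (use fin in auto)
  note int = integrable_measure_pmf_finite[OF finJ]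
  have J: "pmf ?J (v, y, x) = ?VY (v, y) * pmf (K y) x" for v y x
  proof -
    have "?J = map_pmf (\<lambda>((v, y), x). (v, y, x)) (joint (map_pmf (\<lambda>i. (V i, Y i)) p) (\<lambda>vy. K (snd vy)))"
      unfolding K by (simp add: map_calc case_prod_beta')
    then have "pmf ?J (v, y, x) = pmf (map_pmf (\<lambda>((v, y), x). (v, y, x)) (joint (map_pmf (\<lambda>i. (V i, Y i)) p) (\<lambda>vy. K (snd vy)))) ((\<lambda>((v, y), x). (v, y, x)) ((v, y), x))"
      by simp
    also have "\<dots> = pmf (joint (map_pmf (\<lambda>i. (V i, Y i)) p) (\<lambda>vy. K (snd vy))) ((v, y), x)"
      by (rule pmf_map_inj') (auto simp: inj_on_def)
    finally show ?thesis unfolding pmf_joint by simp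
  qed
  have YX: "pmf (map_pmf (\<lambda>i. (Y i, X i)) p) (y, x) = ?Y y * pmf (K y) x" for y x
  proof -
    have "map_pmf (\<lambda>i. (Y i, X i)) p = map_pmf snd ?J" by (simp add: map_pmf_comp o_def)
    also have "\<dots> = joint (map_pmf Y p) K"
      unfolding K by (simp add: bind_map_pmf map_calc case_prod_beta')
    finally show ?thesis by (simp only: pmf_joint)
  qed
  have VY: "mut_inf p V Y = mean ?J (\<lambda>(v, y, x). log 2 (?VY (v, y) / (?V v * ?Y y)))"
    unfolding mut_inf_eq[OF fin(1,2)] by (simp add: case_prod_beta')
  have VX: "mut_inf p V X = mean ?J (\<lambda>(v, y, x). log 2 (?VX (v, x) / (?V v * ?X x)))"
    unfolding mut_inf_eq[OF fin(1,3)] by (simp add: case_prod_beta')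
  have "cond_mut_inf p V Y X = mean ?J (\<lambda>(v, y, x). log 2 (?VY (v, y) * pmf (K y) x /
     (?VX (v, x) * (?Y y * pmf (K y) x / ?X x))))"
    unfolding cond_mut_inf_eq[OF fin] J YX ..
  also have "\<dots> = mean ?J (\<lambda>t. (case t of (v, y, x) \<Rightarrow> log 2 (?VY (v, y) / (?V v * ?Y y)))
      - (case t of (v, y, x) \<Rightarrow> log 2 (?VX (v, x) / (?V v * ?X x))))"
  proof (rule integral_cong_AE)
    show "AE t in ?J. (case t of (v, y, x) \<Rightarrow> log 2 (?VY (v, y) * pmf (K y) x / (?VX (v, x) * (?Y y * pmf (K y) x / ?X x))))
      = (case t of (v, y, x) \<Rightarrow> log 2 (?VY (v, y) / (?V v * ?Y y))) - (case t of (v, y, x) \<Rightarrow> log 2 (?VX (v, x) / (?V v * ?X x)))"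
      unfolding AE_measure_pmf_iff
    proof safe
      fix v y x assume t: "(v, y, x) \<in> set_pmf ?J"
      then obtain i where i: "i \<in> set_pmf p" "v = V i" "y = Y i" "x = X i" by auto
      have pos: "0 < ?VY (v, y)" "0 < ?VX (v, x)" "0 < ?V v" "0 < ?Y y" "0 < ?X x"
        unfolding i(2-4) using i(1) by (intro pmf_positive; force)+
      have "0 < pmf ?J (v, y, x)" using t by (rule pmf_positive)
      then have "0 < pmf (K y) x" unfolding J using pos(1) by (simp add: zero_less_mult_iff)
      with pos show "log 2 (?VY (v, y) * pmf (K y) x / (?VX (v, x) * (?Y y * pmf (K y) x / ?X x)))
        = log 2 (?VY (v, y) / (?V v * ?Y y)) - log 2 (?VX (v, x) / (?V v * ?X x))"
        by (simp add: log_divide log_mult del: pmf_map)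
    qed
  qed auto
  also have "\<dots> = mut_inf p V Y - mut_inf p V X"
    unfolding VY VX by (rule Bochner_Integration.integral_diff) (rule int)+
  finally show ?thesis .
qed

lemma cond_mut_inf_nonneg:
  assumes "finite (range X)" "finite (range Y)" "finite (range Z)"
  shows "0 \<le> cond_mut_inf p X Y Z"
proof -
  interpret information_space "measure_pmf p" 2 by (rule information_space_pmf)
  show ?thesis
    unfolding cond_mut_inf_def
    using conditional_mutual_information_nonneg[of X Y Z] assms by (simp add: simple_function_def)
qed

section \<open>The two lower bounds\<close>

context ske_kernels
begin

text \<open>The key rate per block is k = R (nf + nb). The data processing inequality
  \<open>process\<close> makes the left side of \<open>cover\<close> nonnegative and so excludes nb
  = 0; the case nf = 0 is reached by approximation.\<close>

lemma achievable_below: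
  assumes n: "0 < nf + nb" and process: "iX \<le> iY"
    and cover: "real nf * (iY - iX) < real nb * iB"
    and R: "0 < R" "R * (real nf + real nb) < real nf * (iX - iZ) + real nb * (iB2 - iE2)"
  shows "achievable Wf Wb R"
proof -
  have nonneg: "0 \<le> iZ" "0 \<le> iE2"
    using finite_supports by (auto intro: minfo_nonneg cminfo_nonneg)
  have chain: "iB2 \<le> iB"
    using finite_supports minfo_nonneg[of pw2 "\<lambda>w. bind_pmf (pw1 w) kYb"] by (subst minfo_chain) auto
  have rate: "achievable Wf Wb R"
    if "0 < j" "0 < l" "real j * (iY - iX) < real l * iB"
      "R * (real j + real l) < real j * (iX - iZ) + real l * (iB2 - iE2)" for j l
  proof -
    have "achievable Wf Wb (R * (real j + real l) / (real j + real l))"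
      using that R(1) by (intro achievable_rate nonneg chain mult_pos_pos) (auto simp: algebra_simps)
    then show ?thesis using that by simp
  qed
  have "nb \<noteq> 0"
  proof
    assume "nb = 0"
    moreover have "0 \<le> real nf * (iY - iX)" using process by simp
    ultimately show False using cover by simp
  qed
  show ?thesis
  proof (cases "nf = 0")
    case False
    then show ?thesis using \<open>nb \<noteq> 0\<close> cover R by (intro rate) auto
  next
    case True
    \<comment> \<open>The scheme needs a forward round; one forward use per \<open>N\<close> backward uses costs no rate as \<open>N\<close> grows.\<close>
    define d where "d = iB2 - iE2 - R"
    define J where "J = iB"
    have "real nb * R < real nb * (iB2 - iE2)" "0 < real nb * J"
      using True cover R by (simp_all add: J_def mult.commute)
    then have pos: "0 < d" "0 < J" using \<open>nb \<noteq> 0\<close> by (auto simp: d_def zero_less_mult_iff)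
    \<comment> \<open>Adding the absolute values makes N exceed each quotient as well as 0.\<close>
    obtain N :: nat where N: "(R - (iX - iZ)) / d + (iY - iX) / J
        + \<bar>(R - (iX - iZ)) / d\<bar> + \<bar>(iY - iX) / J\<bar> < real N"
      using reals_Archimedean2 by blast
    have "0 < real N" "(R - (iX - iZ)) / d < real N" "(iY - iX) / J < real N"
      using N by linarith+
    then have "0 < N" "R - (iX - iZ) < real N * d" "iY - iX < real N * J"
      using pos by (simp_all add: pos_divide_less_eq)
    then show ?thesis
      by (intro rate[of 1 N]) (auto simp: d_def J_def algebra_simps)
  qed
qed

end

text \<open>Conditional laws of the variables supply the kernels, and the Markov chains show that
  composing these kernels reproduces the joint laws behind each information quantity. The positive
  part comes from two choices of the cloud centre: W2, or W1 itself when the backward difference is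
  negative.\<close>

lemma variables_achievable:
  fixes Wf :: "('xf::finite, 'yf::finite, 'zf::finite) dmbc" and Wb :: "('xb::finite, 'yb::finite, 'zb::finite) dmbc"
    and V :: "'w \<Rightarrow> 'v" and W1 :: "'w \<Rightarrow> 'w1" and W2 :: "'w \<Rightarrow> 'w2"
  assumes cf: "consistent Wf p X Y Z" and cb: "consistent Wb p Xb Yb Zb"
    and fin: "finite (range V)" "finite (range W1)" "finite (range W2)"
    and mv: "markov3 p V Y (\<lambda>i. (X i, Z i))" and mw: "markov4 p W2 W1 Xb (\<lambda>i. (Yb i, Zb i))"
    and n: "0 < nf + nb" and cover: "real nf * cond_mut_inf p V Y X < real nb * mut_inf p W1 Yb"
    and R: "0 < R" "R < (real nf * (mut_inf p V X - mut_inf p V Z)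
      + real nb * max 0 (cond_mut_inf p W1 Yb W2 - cond_mut_inf p W1 Zb W2)) / (real nf + real nb)"
  shows "achievable Wf Wb R"
proof -
  have finr: "finite (range (F :: 'w \<Rightarrow> 'q::finite))" for F by simp
  obtain ky where "map_pmf (\<lambda>i. (V i, Y i)) p = joint (map_pmf fst (map_pmf (\<lambda>i. (V i, Y i)) p)) ky"
    by (rule disintegrate_pmf[of "map_pmf (\<lambda>i. (V i, Y i)) p"], rule that)
  then have ky: "map_pmf (\<lambda>i. (V i, Y i)) p = joint (map_pmf V p) ky" by (simp add: map_pmf_comp o_def)
  obtain kxz where "map_pmf (\<lambda>i. (Y i, X i, Z i)) p = joint (map_pmf fst (map_pmf (\<lambda>i. (Y i, X i, Z i)) p)) kxz"
    by (rule disintegrate_pmf[of "map_pmf (\<lambda>i. (Y i, X i, Z i)) p"], rule that)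
  then have kxz: "map_pmf (\<lambda>i. (Y i, X i, Z i)) p = joint (map_pmf Y p) kxz" by (simp add: map_pmf_comp o_def)
  \<comment> \<open>Finite support is required of \<open>pw1 w\<close> for all w, so the support
    bound at values of mass zero matters here.\<close>
  obtain pw1 where pw1': "map_pmf (\<lambda>i. (W2 i, W1 i)) p = joint (map_pmf fst (map_pmf (\<lambda>i. (W2 i, W1 i)) p)) pw1"
      "\<And>w. set_pmf (pw1 w) \<subseteq> snd ` set_pmf (map_pmf (\<lambda>i. (W2 i, W1 i)) p)"
    by (rule disintegrate_pmf[of "map_pmf (\<lambda>i. (W2 i, W1 i)) p"], rule that)
  then have pw1: "map_pmf (\<lambda>i. (W2 i, W1 i)) p = joint (map_pmf W2 p) pw1" by (simp add: map_pmf_comp o_def)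
  have fin_pw1: "finite (set_pmf (pw1 w))" for w
    by (rule finite_subset[OF pw1'(2)]) (auto intro!: finite_subset[OF _ fin(2)])
  obtain kx where "map_pmf (\<lambda>i. (W1 i, Xb i)) p = joint (map_pmf fst (map_pmf (\<lambda>i. (W1 i, Xb i)) p)) kx"
    by (rule disintegrate_pmf[of "map_pmf (\<lambda>i. (W1 i, Xb i)) p"], rule that)
  then have kx: "map_pmf (\<lambda>i. (W1 i, Xb i)) p = joint (map_pmf W1 p) kx" by (simp add: map_pmf_comp o_def)
  have Y: "bind_pmf (map_pmf V p) ky = map_pmf Y p"
    using arg_cong[OF ky, of "map_pmf snd"] by (simp only: joint_snd) (simp add: map_pmf_comp o_def)
  have W1: "bind_pmf (map_pmf W2 p) pw1 = map_pmf W1 p"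
    using arg_cong[OF pw1, of "map_pmf snd"] by (simp only: joint_snd) (simp add: map_pmf_comp o_def)
  have reverse: "bind_pmf (map_pmf X p) (\<lambda>x. map_pmf (\<lambda>(y, z). (y, x, z)) (Wf x)) = joint (bind_pmf (map_pmf V p) ky) kxz"
    unfolding Y kxz[symmetric] using arg_cong[OF consistent_joint[OF cf], of "map_pmf (\<lambda>(x, y, z). (y, x, z))"]
    by (simp add: map_calc case_prod_beta')
  have fin_pv: "finite (set_pmf (map_pmf V p))" and fin_w1: "finite (set_pmf (map_pmf W1 p))" and fin_w2: "finite (set_pmf (map_pmf W2 p))"
    using fin by (auto intro: finite_subset[OF image_mono[OF subset_UNIV]])
  interpret I: ske_kernels Wf Wb "map_pmf V p" ky "map_pmf X p" kxz "map_pmf W2 p" pw1 kx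
    by unfold_locales (rule fin_pv fin_w2 fin_pw1 reverse)+
  \<comment> \<open>The same forward kernels, with every backward word equal to its centre
    W1.\<close>
  interpret J: ske_kernels Wf Wb "map_pmf V p" ky "map_pmf X p" kxz "map_pmf W1 p" return_pmf kx
    by unfold_locales (rule fin_pv fin_w1 reverse | simp)+
  have VYXZ: "map_pmf (\<lambda>i. (V i, Y i, X i, Z i)) p
      = bind_pmf (map_pmf (\<lambda>i. (V i, Y i)) p) (\<lambda>(v, y). map_pmf (\<lambda>c. (v, y, c)) (kxz y))"
    by (rule markov3_kernel[OF mv kxz])
  have VYX: "map_pmf (\<lambda>i. (V i, Y i, X i)) p
      = bind_pmf (map_pmf (\<lambda>i. (V i, Y i)) p) (\<lambda>(v, y). map_pmf (\<lambda>x. (v, y, x)) (map_pmf fst (kxz y)))"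
    using arg_cong[OF VYXZ, of "map_pmf (\<lambda>(v, y, x, z). (v, y, x))"]
    by (simp add: map_calc case_prod_beta')
  have VX: "map_pmf (\<lambda>i. (V i, X i)) p = joint (map_pmf V p) I.kX"
    using arg_cong[OF VYXZ, of "map_pmf (\<lambda>(v, y, x, z). (v, x))"]
    unfolding ky I.kX_def[abs_def] by (simp add: bind_map_pmf bind_assoc_pmf map_calc case_prod_beta')
  have VZ: "map_pmf (\<lambda>i. (V i, Z i)) p = joint (map_pmf V p) I.kZ"
    using arg_cong[OF VYXZ, of "map_pmf (\<lambda>(v, y, x, z). (v, z))"]
    unfolding ky I.kZ_def[abs_def] by (simp add: bind_map_pmf bind_assoc_pmf map_calc case_prod_beta')
  \<comment> \<open>The second half of \<open>markov4\<close> attaches the channel to Xb given both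
    auxiliary variables; the first half then lets W2 act only through W1.\<close>
  have WX: "map_pmf (\<lambda>i. ((W2 i, W1 i), Xb i, Yb i, Zb i)) p
      = bind_pmf (map_pmf (\<lambda>i. ((W2 i, W1 i), Xb i)) p) (\<lambda>(w, x). map_pmf (\<lambda>c. (w, x, c)) (Wb x))"
    using mw unfolding markov4_def by (intro markov3_kernel consistent_joint[OF cb]) auto
  have "map_pmf (\<lambda>i. (W1 i, Xb i, Yb i, Zb i)) p = bind_pmf (map_pmf (\<lambda>i. (W1 i, Xb i)) p) (\<lambda>(w, x). map_pmf (\<lambda>c. (w, x, c)) (Wb x))"
    using arg_cong[OF WX, of "map_pmf (\<lambda>((w2, w1), c). (w1, c))"]
    by (simp add: bind_map_pmf map_calc case_prod_beta')
  then have "map_pmf (\<lambda>i. (W1 i, Xb i, Yb i, Zb i)) p = joint (map_pmf W1 p) (\<lambda>w. joint (kx w) Wb)"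
    unfolding kx by (simp add: bind_map_pmf bind_assoc_pmf map_calc case_prod_beta')
  from markov3_kernel[OF _ this, of W2] mw
  have WW: "map_pmf (\<lambda>i. (W2 i, W1 i, Xb i, Yb i, Zb i)) p
      = bind_pmf (map_pmf (\<lambda>i. (W2 i, W1 i)) p) (\<lambda>(a, b). map_pmf (\<lambda>c. (a, b, c)) (joint (kx b) Wb))"
    unfolding markov4_def by blast
  have WWY: "map_pmf (\<lambda>i. (W2 i, W1 i, Yb i)) p = bind_pmf (map_pmf W2 p) (\<lambda>z. map_pmf (Pair z) (joint (pw1 z) I.kYb))"
    using arg_cong[OF WW, of "map_pmf (\<lambda>(a, b, x, y, z). (a, b, y))"]
    unfolding pw1 I.kYb_def[abs_def] by (simp add: bind_map_pmf bind_assoc_pmf map_calc case_prod_beta')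
  have WWZ: "map_pmf (\<lambda>i. (W2 i, W1 i, Zb i)) p = bind_pmf (map_pmf W2 p) (\<lambda>z. map_pmf (Pair z) (joint (pw1 z) I.kZb))"
    using arg_cong[OF WW, of "map_pmf (\<lambda>(a, b, x, y, z). (a, b, z))"]
    unfolding pw1 I.kZb_def[abs_def] by (simp add: bind_map_pmf bind_assoc_pmf map_calc case_prod_beta')
  have WY: "map_pmf (\<lambda>i. (W1 i, Yb i)) p = joint (map_pmf W1 p) I.kYb"
    using arg_cong[OF WWY, of "map_pmf snd"]
    unfolding W1[symmetric] joint_bind_pmf by (simp add: map_calc)
  have IY: "minfo (map_pmf V p) ky = mut_inf p V Y" using mut_inf_kernel[OF fin(1) finr ky] by simp
  have IX: "minfo (map_pmf V p) I.kX = mut_inf p V X" using mut_inf_kernel[OF fin(1) finr VX] by simp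
  have IZ: "minfo (map_pmf V p) I.kZ = mut_inf p V Z" using mut_inf_kernel[OF fin(1) finr VZ] by simp
  have J1: "minfo (map_pmf W1 p) I.kYb = mut_inf p W1 Yb" using mut_inf_kernel[OF fin(2) finr WY] by simp
  have J2: "cminfo (map_pmf W2 p) pw1 I.kYb = cond_mut_inf p W1 Yb W2" using cond_mut_inf_kernel[OF fin(2) finr fin(3) WWY] by simp
  have J3: "cminfo (map_pmf W2 p) pw1 I.kZb = cond_mut_inf p W1 Zb W2" using cond_mut_inf_kernel[OF fin(2) finr fin(3) WWZ] by simp
  have cmi: "cond_mut_inf p V Y X = mut_inf p V Y - mut_inf p V X" by (rule cond_mut_inf_markov[OF fin(1) finr finr VYX])
  have process: "mut_inf p V X \<le> mut_inf p V Y" using cond_mut_inf_nonneg[OF fin(1) finr finr, of p Y X] cmi by simp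
  have "0 < real nf + real nb" using n by linarith
  with R have rate: "R * (real nf + real nb) < real nf * (mut_inf p V X - mut_inf p V Z)
      + real nb * max 0 (cond_mut_inf p W1 Yb W2 - cond_mut_inf p W1 Zb W2)"
    by (simp add: pos_less_divide_eq)
  show ?thesis
  proof (cases "cond_mut_inf p W1 Yb W2 - cond_mut_inf p W1 Zb W2 \<ge> 0")
    case True
    show ?thesis
      by (rule I.achievable_below[OF n _ _ R(1)])
        (use process cover rate True in \<open>simp_all add: IY IX IZ J1 J2 J3 W1 cmi\<close>)
  next
    case False
    show ?thesis
      by (rule J.achievable_below[OF n _ _ R(1)])
        (use process cover rate False in \<open>simp_all add: IY IX IZ J1 cminfo_return bind_return_pmf' cmi\<close>)
  qed
qed

text \<open>Rate 0 keeps the supremum from running over the empty set and settles all nonpositive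
  values of the bounds. A constant key has entropy 0, for which secrecy holds by convention; as a
  protocol has at least one round, a single dummy symbol is sent.\<close>

lemma trivial_achievable:
  fixes Wf :: "('xf::finite, 'yf::finite, 'zf::finite) dmbc" and Wb :: "('xb::finite, 'yb::finite, 'zb::finite) dmbc"
  shows "achievable Wf Wb 0"
proof -
  define \<pi> :: "('xf, 'yf, 'xb, 'yb) protocol" where
    "\<pi> = \<lparr>rounds = [Forward 1 (\<lambda>_. return_pmf [undefined])], out_alice = (\<lambda>_. 0), out_bob = (\<lambda>_. 0), key_by_alice = True\<rparr>"
  have wf: "protocol_wf \<pi>" by (simp add: \<pi>_def protocol_wf_def)
  have key: "key \<pi> = (\<lambda>v :: ('xf, 'yf, 'zf, 'xb, 'yb, 'zb) views. 0)" "key_estimate \<pi> = (\<lambda>v :: ('xf, 'yf, 'zf, 'xb, 'yb, 'zb) views. 0)"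
    by (auto simp: key_def key_estimate_def \<pi>_def)
  have "ent (execution Wf Wb \<pi>) (key \<pi>) = 0"
    unfolding ent_eq[OF finite_execution[OF wf]] key by (simp add: map_pmf_const)
  then show ?thesis
    unfolding achievable_def secure_def Let_def key using wf by (auto simp: key)
qed

section \<open>Exchanging the roles of Alice and Bob\<close>

primrec swap_round :: "('xb, 'yb, 'xf, 'yf) round \<Rightarrow> ('xf, 'yf, 'xb, 'yb) round" where
  "swap_round (Forward n f) = Backward n f"
| "swap_round (Backward n g) = Forward n g"

definition swap_protocol :: "('xb, 'yb, 'xf, 'yf) protocol \<Rightarrow> ('xf, 'yf, 'xb, 'yb) protocol" where
  "swap_protocol \<pi> = \<lparr>rounds = map swap_round (rounds \<pi>), out_alice = out_bob \<pi>, out_bob = out_alice \<pi>,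
     key_by_alice = (\<not> key_by_alice \<pi>)\<rparr>"

text \<open>Eve's tags tell forward from backward outputs, so they change places. The relabelling is
  injective and hence preserves the conditional entropy of the key.\<close>

definition swap_eve :: "('zb, 'zf) view \<Rightarrow> ('zf, 'zb) view" where
  "swap_eve = map (case_sum Inr Inl)"

definition swap_views :: "('xb, 'yb, 'zb, 'xf, 'yf, 'zf) views \<Rightarrow> ('xf, 'yf, 'zf, 'xb, 'yb, 'zb) views" where
  "swap_views = (\<lambda>(a, b, e). (b, a, swap_eve e))"

lemma inj_swap_eve: "inj swap_eve"
  unfolding swap_eve_def by (rule inj_mapI) (auto simp: inj_def split: sum.splits)

lemma run_round_swap: "run_round Wf Wb (swap_round r) (swap_views v) = map_pmf swap_views (run_round Wb Wf r v)"
  by (cases r; cases v) (auto simp: swap_views_def swap_eve_def map_calc)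

lemma run_rounds_swap: "run_rounds Wf Wb (map swap_round rs) (swap_views v) = map_pmf swap_views (run_rounds Wb Wf rs v)"
  by (induction rs arbitrary: v) (simp_all add: run_round_swap bind_map_pmf map_bind_pmf)

lemma execution_swap: "execution Wf Wb (swap_protocol \<pi>) = map_pmf swap_views (execution Wb Wf \<pi>)"
  using run_rounds_swap[of Wf Wb "rounds \<pi>" "([], [], [])"]
  by (simp add: execution_def swap_protocol_def) (simp add: swap_views_def swap_eve_def)

lemma swap_protocol_wf:
  assumes "protocol_wf \<pi>" shows "protocol_wf (swap_protocol \<pi>)"
proof -
  have 1: "is_forward (swap_round r) = (\<not> is_forward r)" "round_wf (swap_round r) = round_wf r" for r :: "('a, 'b, 'c, 'd) round"
    by (cases r; simp)+
  show ?thesis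
    using assms by (auto simp: protocol_wf_def swap_protocol_def 1 successively_map)
qed

lemma secure_swap:
  fixes Wf :: "('xf::finite, 'yf::finite, 'zf::finite) dmbc" and Wb :: "('xb::finite, 'yb::finite, 'zb::finite) dmbc"
    and \<pi> :: "('xb, 'yb, 'xf, 'yf) protocol"
  assumes wf: "protocol_wf \<pi>" and sec: "secure Wb Wf R \<delta> \<pi>"
  shows "secure Wf Wb R \<delta> (swap_protocol \<pi>)"
proof -
  let ?p = "execution Wb Wf \<pi>" and ?q = "execution Wf Wb (swap_protocol \<pi>)" and ?\<sigma> = "swap_protocol \<pi>"
  note finp = finite_execution[OF wf, of Wb Wf] and finq = finite_execution[OF swap_protocol_wf[OF wf], of Wf Wb]
  have uses: "n_f ?\<sigma> = n_b \<pi>" "n_b ?\<sigma> = n_f \<pi>"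
  proof -
    have 1: "forward_uses (swap_round r) = backward_uses r" "backward_uses (swap_round r) = forward_uses r"
      for r :: "('xb, 'yb, 'xf, 'yf) round"
      by (cases r; simp)+
    show "n_f ?\<sigma> = n_b \<pi>" "n_b ?\<sigma> = n_f \<pi>"
      by (simp_all add: n_f_def n_b_def swap_protocol_def o_def 1)
  qed
  have key: "key ?\<sigma> (swap_views v) = key \<pi> v" "key_estimate ?\<sigma> (swap_views v) = key_estimate \<pi> v"
    "view_eve (swap_views v) = swap_eve (view_eve v)" for v :: "('xb, 'yb, 'zb, 'xf, 'yf, 'zf) views"
    by (auto simp: key_def key_estimate_def view_eve_def swap_protocol_def swap_views_def split: prod.split)
  have S: "map_pmf (key ?\<sigma>) ?q = map_pmf (key \<pi>) ?p"
    unfolding execution_swap by (simp add: map_pmf_comp o_def key)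
  have ent: "ent ?q (key ?\<sigma>) = ent ?p (key \<pi>)"
    unfolding ent_eq[OF finp] ent_eq[OF finq] S ..
  have E: "map_pmf view_eve ?q = map_pmf swap_eve (map_pmf view_eve ?p)"
    unfolding execution_swap by (simp add: map_pmf_comp o_def key)
  have SE: "map_pmf (\<lambda>i. (key ?\<sigma> i, view_eve i)) ?q = map_pmf (apsnd swap_eve) (map_pmf (\<lambda>i. (key \<pi> i, view_eve i)) ?p)"
    unfolding execution_swap by (simp add: map_pmf_comp o_def key)
  have SE': "pmf (map_pmf (apsnd swap_eve) r) (s, swap_eve e) = pmf r (s, e)" for r :: "(nat \<times> ('zb, 'zf) view) pmf" and s e
    using pmf_map_inj'[of "apsnd swap_eve :: nat \<times> ('zb, 'zf) view \<Rightarrow> _" r "(s, e)"] inj_swap_eve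
    by (simp add: inj_apsnd)
  have cond: "cond_ent ?q (key ?\<sigma>) view_eve = cond_ent ?p (key \<pi>) view_eve"
    unfolding cond_ent_eq[OF finp] cond_ent_eq[OF finq] E SE integral_map_pmf
    by (rule Bochner_Integration.integral_cong[OF refl])
      (simp add: SE' pmf_map_inj'[OF inj_swap_eve] case_prod_beta del: pmf_map)
  have err: "prob_of ?q {i. key_estimate ?\<sigma> i \<noteq> key ?\<sigma> i} = prob_of ?p {i. key_estimate \<pi> i \<noteq> key \<pi> i}"
    unfolding execution_swap prob_map_pmf by (simp add: key)
  show ?thesis
    using sec unfolding secure_def Let_def ent cond err uses by (simp add: add.commute)
qed

lemma achievable_swap:
  fixes Wf :: "('xf::finite, 'yf::finite, 'zf::finite) dmbc" and Wb :: "('xb::finite, 'yb::finite, 'zb::finite) dmbc"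
  assumes "achievable Wb Wf R" shows "achievable Wf Wb R"
  using assms swap_protocol_wf secure_swap unfolding achievable_def by meson

text \<open>The capacity is a supremum, so rates strictly below r suffice. If it were below r, a
  rate could be chosen in the gap, and \<open>trivial_achievable\<close> makes that rate
  positive.\<close>

lemma capacity_ge:
  fixes Wf :: "('xf::finite, 'yf::finite, 'zf::finite) dmbc" and Wb :: "('xb::finite, 'yb::finite, 'zb::finite) dmbc"
  assumes "\<And>R. 0 < R \<Longrightarrow> R < r \<Longrightarrow> achievable Wf Wb R"
  shows "ereal r \<le> sk_capacity Wf Wb"
proof (rule ccontr)
  have up: "ereal R \<le> sk_capacity Wf Wb" if "achievable Wf Wb R" for R
    unfolding sk_capacity_def using that by (auto intro: Sup_upper)
  assume "\<not> ?thesis"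
  then have "sk_capacity Wf Wb < ereal r" by simp
  then obtain R where R: "sk_capacity Wf Wb < ereal R" "ereal R < ereal r" using ereal_dense2 by blast
  have "ereal 0 < ereal R" using up[OF trivial_achievable] R(1) by (rule order_le_less_trans)
  then have "achievable Wf Wb R" using assms R(2) by simp
  then show False using up R(1) by (simp add: not_le[symmetric])
qed

theorem theorem1:
  fixes Wf :: "('xf::finite, 'yf::finite, 'zf::finite) dmbc"
    and Wb :: "('xb::finite, 'yb::finite, 'zb::finite) dmbc"
  shows "sk_capacity Wf Wb \<ge> max (L_A Wf Wb) (L_B Wf Wb)"
proof (rule max.boundedI)
  show "L_A Wf Wb \<le> sk_capacity Wf Wb"
    unfolding L_A_def
  proof (rule Sup_least)
    fix r assume "r \<in> {ereal ((real nf * R_A_s1 u + real nb * max 0 (R_A_s2 u)) / (real nf + real nb)) | nf nb u.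
        0 < nf + nb \<and> admissible Wf Wb u \<and> real nf * cond_mut_inf (law u) (V_f u) (Y_f u) (X_f u) < real nb * mut_inf (law u) (W1_b u) (Y_b u)}"
    then obtain nf nb u where r: "r = ereal ((real nf * R_A_s1 u + real nb * max 0 (R_A_s2 u)) / (real nf + real nb))"
      and n: "0 < nf + nb" and u: "admissible Wf Wb u"
      and cover: "real nf * cond_mut_inf (law u) (V_f u) (Y_f u) (X_f u) < real nb * mut_inf (law u) (W1_b u) (Y_b u)"
      by blast
    show "r \<le> sk_capacity Wf Wb"
      unfolding r
    proof (rule capacity_ge)
      fix R assume R: "0 < R" "R < (real nf * R_A_s1 u + real nb * max 0 (R_A_s2 u)) / (real nf + real nb)"
      show "achievable Wf Wb R"
        by (rule variables_achievable[where V="V_f u" and ?W1.0="W1_b u" and ?W2.0="W2_b u" and p="law u" and nf=nf and nb=nb])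
          (use u n cover R in \<open>auto simp: admissible_def R_A_s1_def R_A_s2_def\<close>)
    qed
  qed
  show "L_B Wf Wb \<le> sk_capacity Wf Wb"
    unfolding L_B_def
  proof (rule Sup_least)
    fix r assume "r \<in> {ereal ((real nb * R_B_s1 u + real nf * max 0 (R_B_s2 u)) / (real nf + real nb)) | nf nb u.
        0 < nf + nb \<and> admissible Wf Wb u \<and> real nb * cond_mut_inf (law u) (V_b u) (Y_b u) (X_b u) < real nf * mut_inf (law u) (W1_f u) (Y_f u)}"
    then obtain nf nb u where r: "r = ereal ((real nb * R_B_s1 u + real nf * max 0 (R_B_s2 u)) / (real nf + real nb))"
      and n: "0 < nf + nb" and u: "admissible Wf Wb u"
      and cover: "real nb * cond_mut_inf (law u) (V_b u) (Y_b u) (X_b u) < real nf * mut_inf (law u) (W1_f u) (Y_f u)"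
      by blast
    show "r \<le> sk_capacity Wf Wb"
      unfolding r
    proof (rule capacity_ge)
      fix R assume R: "0 < R" "R < (real nb * R_B_s1 u + real nf * max 0 (R_B_s2 u)) / (real nf + real nb)"
      have "achievable Wb Wf R"
        by (rule variables_achievable[where V="V_b u" and ?W1.0="W1_f u" and ?W2.0="W2_f u" and p="law u" and nf=nb and nb=nf])
          (use u n cover R in \<open>auto simp: admissible_def R_B_s1_def R_B_s2_def add.commute\<close>)
      then show "achievable Wf Wb R" by (rule achievable_swap)
    qed
  qed
qed

end
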